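(* Let $H$ be a Hopf algebra with bijective antipode over a field $\Bbbk$, $V$ a (left-left) Yetter–Drinfeld module over $H$ with coaction $\delta(x)=x_{(-1)}\otimes x_{(0)}$, and $M$ an extension of $V$ by $H$, with $\mathfrak{X}$, $\mathfrak{H}$ and the bilinear maps $b_t$ as in the context. Endow $T_H(M)$ with the unique Hopf algebra structure such that $H$ is a Hopf subalgebra and $\Delta(v)=v\otimes 1+\delta(v)$ for $v\in V\cong\Bbbk\mathfrak{X}$. Then $T(V)\#_MH$ is a Hopf algebra quotient of $T_H(M)$ if and only if $$\sum_{t\in\mathfrak{H}}b_t(h_{(1)},x)\,t_{(1)}h_{(2)}\otimes t_{(2)}h_{(3)}=\sum_{t\in\mathfrak{H}}b_t(h_{(1)},x)\,th_{(2)}\otimes h_{(3)}+\sum_{t\in\mathfrak{H}}h_{(1)}x_{(-1)}\otimes b_t(h_{(2)},x_{(0)})\,th_{(3)}$$ for all $h\in H$ and $x\in\Bbbk\mathfrak{X}$. In such a case, the coradical of $T(V)\#_MH$ coincides with the coradical of $H$.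
   Context: $H$ is regarded as an $H$-module via the adjoint action $h\cdot k=h_{(1)}kS(h_{(2)})$. An extension of $V$ by $H$ is an $H$-module $M$ fitting in a short exact sequence of $H$-modules $0\to H\to M\to V\to 0$. Fix a linearly independent set $\mathfrak{X}=\{x_i\}_{i\in I}\subset M$ with $M=\Bbbk\mathfrak{X}\oplus H$ as vector spaces; the images of the $x_i$ form a basis of $V$, denoted in the same way, so $V$ is identified with $\Bbbk\mathfrak{X}$ as a vector space (and the coaction $\delta:V\to H\otimes V$ is transported to $\Bbbk\mathfrak{X}$). Fix a basis $\mathfrak{H}$ of $H$ with $1\in\mathfrak{H}$. The action on $M$ is written $$h\cdot x=h\cdot_Vx+\sum_{t\in\mathfrak{H}}b_t(h,x)\,t,\qquad h\in H,\ x\in\Bbbk\mathfrak{X},$$ where $h\cdot_V x\in\Bbbk\mathfrak{X}$ is the action in $V$ and $b_t:H\times\Bbbk\mathfrak{X}\to\Bbbk$ are bilinear maps. $T_H(M)$ is the unital algebra generated by $\mathfrak{X}$ and $\mathfrak{H}$ (with $1\in\mathfrak{H}$ the unit) subject only to the relations expressing the multiplication of $H$ in the basis $\mathfrak{H}$; it contains $H$ as a subalgebra and $M=\Bbbk\mathfrak{X}\oplus H$ as a subspace. $T(V)\#_MH$ is the quotient of $T_H(M)$ by the ideal $J_M$ generated by $hx-(h_{(1)}\cdot x)h_{(2)}$, $h\in H$, $x\in M$ (with $h_{(1)}\cdot x$ computed in $M$). "$T(V)\#_MH$ is a Hopf algebra quotient of $T_H(M)$" means that $J_M$ is a Hopf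 ideal. *)

theory Defs
  imports Complex_Main "HOL-Library.Poly_Mapping"
begin

section \<open>Tensor products\<close>

text \<open>
  A vector space is an additive group \<open>'a\<close> with a scalar multiplication
  \<open>'k \<Rightarrow> 'a \<Rightarrow> 'a\<close> (locale \<^locale>\<open>vector_space\<close>).  The tensor product of \<open>A\<close> and \<open>B\<close> is the
  free vector space on \<open>A \<times> B\<close> modulo the span of the bilinearity relations.  The quotient is not
  formed as a type, because it depends on the scalar multiplications; instead, tensors are
  represented by elements of the free vector space and compared with the congruence
  \<open>tensor_eq\<close>.  Analogously, \<open>tensor3_eq\<close> is equality in \<open>A \<otimes> B \<otimes> C\<close>.
\<close>

definition fscale :: "'k::field \<Rightarrow> ('p \<Rightarrow>\<^sub>0 'k) \<Rightarrow> ('p \<Rightarrow>\<^sub>0 'k)" where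
  "fscale c = Poly_Mapping.map ((*) c)"

definition tens :: "'a \<Rightarrow> 'b \<Rightarrow> ('a \<times> 'b \<Rightarrow>\<^sub>0 'k::field)" where
  "tens a b = Poly_Mapping.single (a, b) 1"

definition tens3 :: "'a \<Rightarrow> 'b \<Rightarrow> 'c \<Rightarrow> ('a \<times> 'b \<times> 'c \<Rightarrow>\<^sub>0 'k::field)" where
  "tens3 a b c = Poly_Mapping.single (a, b, c) 1"

definition tensor_null ::
    "('k::field \<Rightarrow> 'a::ab_group_add \<Rightarrow> 'a) \<Rightarrow> ('k \<Rightarrow> 'b::ab_group_add \<Rightarrow> 'b)
      \<Rightarrow> ('a \<times> 'b \<Rightarrow>\<^sub>0 'k) set" where
  "tensor_null sA sB = module.span fscale
     ({tens (a + a') b - tens a b - tens a' b | a a' b. True} \<union>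
      {tens a (b + b') - tens a b - tens a b' | a b b'. True} \<union>
      {tens (sA r a) b - fscale r (tens a b) | r a b. True} \<union>
      {tens a (sB r b) - fscale r (tens a b) | r a b. True})"

definition tensor_eq ::
    "('k::field \<Rightarrow> 'a::ab_group_add \<Rightarrow> 'a) \<Rightarrow> ('k \<Rightarrow> 'b::ab_group_add \<Rightarrow> 'b)
      \<Rightarrow> ('a \<times> 'b \<Rightarrow>\<^sub>0 'k) \<Rightarrow> ('a \<times> 'b \<Rightarrow>\<^sub>0 'k) \<Rightarrow> bool" where
  "tensor_eq sA sB u v \<longleftrightarrow> u - v \<in> tensor_null sA sB"

definition tensor3_null ::
    "('k::field \<Rightarrow> 'a::ab_group_add \<Rightarrow> 'a) \<Rightarrow> ('k \<Rightarrow> 'b::ab_group_add \<Rightarrow> 'b)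
      \<Rightarrow> ('k \<Rightarrow> 'c::ab_group_add \<Rightarrow> 'c) \<Rightarrow> ('a \<times> 'b \<times> 'c \<Rightarrow>\<^sub>0 'k) set" where
  "tensor3_null sA sB sC = module.span fscale
     ({tens3 (a + a') b c - tens3 a b c - tens3 a' b c | a a' b c. True} \<union>
      {tens3 a (b + b') c - tens3 a b c - tens3 a b' c | a b b' c. True} \<union>
      {tens3 a b (c + c') - tens3 a b c - tens3 a b c' | a b c c'. True} \<union>
      {tens3 (sA r a) b c - fscale r (tens3 a b c) | r a b c. True} \<union>
      {tens3 a (sB r b) c - fscale r (tens3 a b c) | r a b c. True} \<union>
      {tens3 a b (sC r c) - fscale r (tens3 a b c) | r a b c. True})"

definition tensor3_eq ::
    "('k::field \<Rightarrow> 'a::ab_group_add \<Rightarrow> 'a) \<Rightarrow> ('k \<Rightarrow> 'b::ab_group_add \<Rightarrow> 'b)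
      \<Rightarrow> ('k \<Rightarrow> 'c::ab_group_add \<Rightarrow> 'c)
      \<Rightarrow> ('a \<times> 'b \<times> 'c \<Rightarrow>\<^sub>0 'k) \<Rightarrow> ('a \<times> 'b \<times> 'c \<Rightarrow>\<^sub>0 'k) \<Rightarrow> bool" where
  "tensor3_eq sA sB sC u v \<longleftrightarrow> u - v \<in> tensor3_null sA sB sC"

text \<open>
  Every element of a tensor product is a finite sum of simple tensors.  Maps into a tensor product,
  such as comultiplications and coactions, are therefore given by lists of pairs: a list
  \<open>[(a\<^sub>1, b\<^sub>1), \<dots>, (a\<^sub>n, b\<^sub>n)]\<close> stands for \<open>\<Sum>\<^sub>i a\<^sub>i \<otimes> b\<^sub>i\<close>, and Sweedler sums become sums over such
  lists.  Which list represents a given tensor is immaterial: axioms only constrain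
  these maps up to \<open>tensor_eq\<close>.
\<close>

definition formal_sum :: "'p list \<Rightarrow> ('p \<Rightarrow>\<^sub>0 'k::field)" where
  "formal_sum ps = (\<Sum>p\<leftarrow>ps. Poly_Mapping.single p 1)"


section \<open>Algebras, coalgebras and Hopf algebras\<close>

locale k_algebra = vector_space scale
  for scale :: "'k::field \<Rightarrow> 'a::ring_1 \<Rightarrow> 'a" +
  assumes scale_mult_left: "scale c x * y = scale c (x * y)"
    and scale_mult_right: "x * scale c y = scale c (x * y)"

locale coalgebra = vector_space scale
  for scale :: "'k::field \<Rightarrow> 'a::ab_group_add \<Rightarrow> 'a"
    and \<Delta> :: "'a \<Rightarrow> ('a \<times> 'a) list"
    and \<epsilon> :: "'a \<Rightarrow> 'k" +
  assumes comult_add: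
      "tensor_eq scale scale (formal_sum (\<Delta> (x + y))) (formal_sum (\<Delta> x) + formal_sum (\<Delta> y))"
    and comult_scale:
      "tensor_eq scale scale (formal_sum (\<Delta> (scale c x))) (fscale c (formal_sum (\<Delta> x)))"
    and counit_linear: "Vector_Spaces.linear scale (*) \<epsilon>"
    and coassoc:
      "tensor3_eq scale scale scale
         (\<Sum>(x1, y)\<leftarrow>\<Delta> x. \<Sum>(x2, x3)\<leftarrow>\<Delta> y. tens3 x1 x2 x3)
         (\<Sum>(y, x3)\<leftarrow>\<Delta> x. \<Sum>(x1, x2)\<leftarrow>\<Delta> y. tens3 x1 x2 x3)"
    and counit_left: "(\<Sum>(x1, x2)\<leftarrow>\<Delta> x. scale (\<epsilon> x1) x2) = x"
    and counit_right: "(\<Sum>(x1, x2)\<leftarrow>\<Delta> x. scale (\<epsilon> x2) x1) = x"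

locale hopf_algebra = k_algebra scale + coalgebra scale \<Delta> \<epsilon>
  for scale :: "'k::field \<Rightarrow> 'a::ring_1 \<Rightarrow> 'a"
    and \<Delta> :: "'a \<Rightarrow> ('a \<times> 'a) list"
    and \<epsilon> :: "'a \<Rightarrow> 'k"
    and S :: "'a \<Rightarrow> 'a" +
  assumes comult_mult:
      "tensor_eq scale scale (formal_sum (\<Delta> (x * y)))
         (\<Sum>(x1, x2)\<leftarrow>\<Delta> x. \<Sum>(y1, y2)\<leftarrow>\<Delta> y. tens (x1 * y1) (x2 * y2))"
    and comult_one: "tensor_eq scale scale (formal_sum (\<Delta> 1)) (tens 1 1)"
    and counit_mult: "\<epsilon> (x * y) = \<epsilon> x * \<epsilon> y"
    and counit_one: "\<epsilon> 1 = 1"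
    and antipode_linear: "Vector_Spaces.linear scale scale S"
    and antipode_left: "(\<Sum>(x1, x2)\<leftarrow>\<Delta> x. S x1 * x2) = scale (\<epsilon> x) 1"
    and antipode_right: "(\<Sum>(x1, x2)\<leftarrow>\<Delta> x. x1 * S x2) = scale (\<epsilon> x) 1"

definition algebra_hom ::
    "('k::field \<Rightarrow> 'a::ring_1 \<Rightarrow> 'a) \<Rightarrow> ('k \<Rightarrow> 'b::ring_1 \<Rightarrow> 'b) \<Rightarrow> ('a \<Rightarrow> 'b) \<Rightarrow> bool" where
  "algebra_hom sA sB f \<longleftrightarrow>
     Vector_Spaces.linear sA sB f \<and> f 1 = 1 \<and> (\<forall>x y. f (x * y) = f x * f y)"

definition hopf_hom ::
    "('k::field \<Rightarrow> 'a::ring_1 \<Rightarrow> 'a) \<Rightarrow> ('a \<Rightarrow> ('a \<times> 'a) list) \<Rightarrow> ('a \<Rightarrow> 'k) \<Rightarrow> ('a \<Rightarrow> 'a)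
      \<Rightarrow> ('k \<Rightarrow> 'b::ring_1 \<Rightarrow> 'b) \<Rightarrow> ('b \<Rightarrow> ('b \<times> 'b) list) \<Rightarrow> ('b \<Rightarrow> 'k) \<Rightarrow> ('b \<Rightarrow> 'b)
      \<Rightarrow> ('a \<Rightarrow> 'b) \<Rightarrow> bool" where
  "hopf_hom sA \<Delta>A \<epsilon>A SA sB \<Delta>B \<epsilon>B SB f \<longleftrightarrow>
     algebra_hom sA sB f \<and>
     (\<forall>x. tensor_eq sB sB (formal_sum (\<Delta>B (f x))) (\<Sum>(x1, x2)\<leftarrow>\<Delta>A x. tens (f x1) (f x2))) \<and>
     (\<forall>x. \<epsilon>B (f x) = \<epsilon>A x) \<and>
     (\<forall>x. SB (f x) = f (SA x))"

text \<open>\<open>A\<close> is a Hopf subalgebra of \<open>B\<close> via \<open>f\<close>.\<close>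

definition hopf_embedding ::
    "('k::field \<Rightarrow> 'a::ring_1 \<Rightarrow> 'a) \<Rightarrow> ('a \<Rightarrow> ('a \<times> 'a) list) \<Rightarrow> ('a \<Rightarrow> 'k) \<Rightarrow> ('a \<Rightarrow> 'a)
      \<Rightarrow> ('k \<Rightarrow> 'b::ring_1 \<Rightarrow> 'b) \<Rightarrow> ('b \<Rightarrow> ('b \<times> 'b) list) \<Rightarrow> ('b \<Rightarrow> 'k) \<Rightarrow> ('b \<Rightarrow> 'b)
      \<Rightarrow> ('a \<Rightarrow> 'b) \<Rightarrow> bool" where
  "hopf_embedding sA \<Delta>A \<epsilon>A SA sB \<Delta>B \<epsilon>B SB f \<longleftrightarrow>
     hopf_hom sA \<Delta>A \<epsilon>A SA sB \<Delta>B \<epsilon>B SB f \<and> inj f"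

text \<open>The two-sided ideal generated by \<open>R\<close> in a subring \<open>A\<close>.\<close>

inductive_set ideal_gen :: "'a::ring_1 set \<Rightarrow> 'a set \<Rightarrow> 'a set"
  for A R :: "'a set" where
  zero: "0 \<in> ideal_gen A R"
| gen: "\<lbrakk>a \<in> A; r \<in> R; b \<in> A\<rbrakk> \<Longrightarrow> a * r * b \<in> ideal_gen A R"
| add: "\<lbrakk>x \<in> ideal_gen A R; y \<in> ideal_gen A R\<rbrakk> \<Longrightarrow> x + y \<in> ideal_gen A R"

definition two_sided_ideal :: "'a::ring_1 set \<Rightarrow> bool" where
  "two_sided_ideal J \<longleftrightarrow> 0 \<in> J \<and> (\<forall>x\<in>J. \<forall>y\<in>J. x + y \<in> J) \<and> (\<forall>x\<in>J. \<forall>a. a * x \<in> J \<and> x * a \<in> J)"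

text \<open>
  \<open>\<Delta>(J) \<subseteq> J \<otimes> A + A \<otimes> J\<close> is expressed by lists of pairs having a component in \<open>J\<close>.
\<close>

definition hopf_ideal ::
    "('k::field \<Rightarrow> 'a::ring_1 \<Rightarrow> 'a) \<Rightarrow> ('a \<Rightarrow> ('a \<times> 'a) list) \<Rightarrow> ('a \<Rightarrow> 'k) \<Rightarrow> ('a \<Rightarrow> 'a)
      \<Rightarrow> 'a set \<Rightarrow> bool" where
  "hopf_ideal s \<Delta> \<epsilon> S J \<longleftrightarrow>
     two_sided_ideal J \<and>
     (\<forall>x\<in>J. \<exists>ps. set ps \<subseteq> J \<times> UNIV \<union> UNIV \<times> J \<and>
        tensor_eq s s (formal_sum (\<Delta> x)) (formal_sum ps)) \<and>
     (\<forall>x\<in>J. \<epsilon> x = 0) \<and>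
     (\<forall>x\<in>J. S x \<in> J)"

definition subcoalgebra ::
    "('k::field \<Rightarrow> 'a::ab_group_add \<Rightarrow> 'a) \<Rightarrow> ('a \<Rightarrow> ('a \<times> 'a) list) \<Rightarrow> 'a set \<Rightarrow> bool" where
  "subcoalgebra s \<Delta> C \<longleftrightarrow>
     module.subspace s C \<and>
     (\<forall>x\<in>C. \<exists>ps. set ps \<subseteq> C \<times> C \<and> tensor_eq s s (formal_sum (\<Delta> x)) (formal_sum ps))"

definition simple_subcoalgebra ::
    "('k::field \<Rightarrow> 'a::ab_group_add \<Rightarrow> 'a) \<Rightarrow> ('a \<Rightarrow> ('a \<times> 'a) list) \<Rightarrow> 'a set \<Rightarrow> bool" where
  "simple_subcoalgebra s \<Delta> C \<longleftrightarrow>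
     subcoalgebra s \<Delta> C \<and> C \<noteq> {0} \<and> (\<forall>D. subcoalgebra s \<Delta> D \<and> D \<subseteq> C \<longrightarrow> D = {0} \<or> D = C)"

definition coradical ::
    "('k::field \<Rightarrow> 'a::ab_group_add \<Rightarrow> 'a) \<Rightarrow> ('a \<Rightarrow> ('a \<times> 'a) list) \<Rightarrow> 'a set" where
  "coradical s \<Delta> = module.span s (\<Union>{C. simple_subcoalgebra s \<Delta> C})"


section \<open>Yetter--Drinfeld modules and extensions\<close>

locale algebra_module = k_algebra sH + Module: vector_space sM
  for sH :: "'k::field \<Rightarrow> 'h::ring_1 \<Rightarrow> 'h"
    and sM :: "'k \<Rightarrow> 'm::ab_group_add \<Rightarrow> 'm"
    and act :: "'h \<Rightarrow> 'm \<Rightarrow> 'm" +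
  assumes act_linear_left: "Vector_Spaces.linear sH sM (\<lambda>h. act h m)"
    and act_linear_right: "Vector_Spaces.linear sM sM (act h)"
    and act_one: "act 1 m = m"
    and act_mult: "act (g * h) m = act g (act h m)"

locale comodule = coalgebra sH \<Delta> \<epsilon> + Comodule: vector_space sV
  for sH :: "'k::field \<Rightarrow> 'h::ab_group_add \<Rightarrow> 'h"
    and \<Delta> :: "'h \<Rightarrow> ('h \<times> 'h) list"
    and \<epsilon> :: "'h \<Rightarrow> 'k"
    and sV :: "'k \<Rightarrow> 'v::ab_group_add \<Rightarrow> 'v"
    and \<delta> :: "'v \<Rightarrow> ('h \<times> 'v) list" +
  assumes coact_add:
      "tensor_eq sH sV (formal_sum (\<delta> (v + w))) (formal_sum (\<delta> v) + formal_sum (\<delta> w))"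
    and coact_scale:
      "tensor_eq sH sV (formal_sum (\<delta> (sV c v))) (fscale c (formal_sum (\<delta> v)))"
    and coact_coassoc:
      "tensor3_eq sH sH sV
         (\<Sum>(g, w)\<leftarrow>\<delta> v. \<Sum>(h, u)\<leftarrow>\<delta> w. tens3 g h u)
         (\<Sum>(y, u)\<leftarrow>\<delta> v. \<Sum>(g, h)\<leftarrow>\<Delta> y. tens3 g h u)"
    and coact_counit: "(\<Sum>(g, w)\<leftarrow>\<delta> v. sV (\<epsilon> g) w) = v"

text \<open>Iterated comultiplication: \<open>h \<mapsto> h\<^sub>(\<^sub>1\<^sub>) \<otimes> h\<^sub>(\<^sub>2\<^sub>) \<otimes> h\<^sub>(\<^sub>3\<^sub>)\<close>.\<close>

definition comult3 :: "('a \<Rightarrow> ('a \<times> 'a) list) \<Rightarrow> 'a \<Rightarrow> ('a \<times> 'a \<times> 'a) list" where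
  "comult3 \<Delta> h = concat (map (\<lambda>(h1, y). map (\<lambda>(h2, h3). (h1, h2, h3)) (\<Delta> y)) (\<Delta> h))"

locale yetter_drinfeld =
  hopf_algebra sH \<Delta> \<epsilon> S + algebra_module sH sV act + comodule sH \<Delta> \<epsilon> sV \<delta>
  for sH :: "'k::field \<Rightarrow> 'h::ring_1 \<Rightarrow> 'h"
    and \<Delta> :: "'h \<Rightarrow> ('h \<times> 'h) list"
    and \<epsilon> :: "'h \<Rightarrow> 'k"
    and S :: "'h \<Rightarrow> 'h"
    and sV :: "'k \<Rightarrow> 'v::ab_group_add \<Rightarrow> 'v"
    and act :: "'h \<Rightarrow> 'v \<Rightarrow> 'v"
    and \<delta> :: "'v \<Rightarrow> ('h \<times> 'v) list" +
  assumes yetter_drinfeld_compat: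
    "tensor_eq sH sV (formal_sum (\<delta> (act h v)))
       (\<Sum>(h1, h2, h3)\<leftarrow>comult3 \<Delta> h. \<Sum>(g, w)\<leftarrow>\<delta> v. tens (h1 * g * S h3) (act h2 w))"

definition adjoint_action ::
    "('h::ring_1 \<Rightarrow> ('h \<times> 'h) list) \<Rightarrow> ('h \<Rightarrow> 'h) \<Rightarrow> 'h \<Rightarrow> 'h \<Rightarrow> 'h" where
  "adjoint_action \<Delta> S h k = (\<Sum>(h1, h2)\<leftarrow>\<Delta> h. h1 * k * S h2)"

text \<open>
  A short exact sequence \<open>0 \<rightarrow> H \<rightarrow> M \<rightarrow> V \<rightarrow> 0\<close> of \<open>H\<close>-modules, with maps \<open>\<iota>\<close> and \<open>\<pi>\<close>, where \<open>H\<close>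
  carries the adjoint action.
\<close>

locale module_extension =
  hopf_algebra sH \<Delta> \<epsilon> S + V: algebra_module sH sV actV + M: algebra_module sH sM actM
  for sH :: "'k::field \<Rightarrow> 'h::ring_1 \<Rightarrow> 'h"
    and \<Delta> :: "'h \<Rightarrow> ('h \<times> 'h) list"
    and \<epsilon> :: "'h \<Rightarrow> 'k"
    and S :: "'h \<Rightarrow> 'h"
    and sV :: "'k \<Rightarrow> 'v::ab_group_add \<Rightarrow> 'v"
    and actV :: "'h \<Rightarrow> 'v \<Rightarrow> 'v"
    and sM :: "'k \<Rightarrow> 'm::ab_group_add \<Rightarrow> 'm"
    and actM :: "'h \<Rightarrow> 'm \<Rightarrow> 'm"
    and \<iota> :: "'h \<Rightarrow> 'm"
    and \<pi> :: "'m \<Rightarrow> 'v" +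
  assumes \<iota>_linear: "Vector_Spaces.linear sH sM \<iota>"
    and \<iota>_hom: "\<iota> (adjoint_action \<Delta> S h k) = actM h (\<iota> k)"
    and \<pi>_linear: "Vector_Spaces.linear sM sV \<pi>"
    and \<pi>_hom: "\<pi> (actM h m) = actV h (\<pi> m)"
    and \<iota>_inj: "inj \<iota>"
    and exact: "range \<iota> = {m. \<pi> m = 0}"
    and \<pi>_surj: "surj \<pi>"

text \<open>
  \<open>X\<close> is linearly independent and \<open>M\<close> is the direct sum of the span of \<open>X\<close> and the image of \<open>H\<close>.
\<close>

definition complement_basis ::
    "('k::field \<Rightarrow> 'm::ab_group_add \<Rightarrow> 'm) \<Rightarrow> ('h \<Rightarrow> 'm) \<Rightarrow> 'm set \<Rightarrow> bool" where
  "complement_basis sM \<iota> X \<longleftrightarrow>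
     \<not> module.dependent sM X \<and>
     module.span sM X \<inter> range \<iota> = {0} \<and>
     (\<forall>m. \<exists>x\<in>module.span sM X. \<exists>h. m = x + \<iota> h)"

definition is_basis :: "('k::field \<Rightarrow> 'a::ab_group_add \<Rightarrow> 'a) \<Rightarrow> 'a set \<Rightarrow> bool" where
  "is_basis s B \<longleftrightarrow> \<not> module.dependent s B \<and> module.span s B = UNIV"

text \<open>
  The identification of \<open>V\<close> with the span of \<open>X\<close>, i.e. the inverse of the restriction of \<open>\<pi>\<close> to
  this span, and the coaction transported along it.
\<close>

definition lift_V ::
    "('k::field \<Rightarrow> 'm::ab_group_add \<Rightarrow> 'm) \<Rightarrow> 'm set \<Rightarrow> ('m \<Rightarrow> 'v) \<Rightarrow> 'v \<Rightarrow> 'm" where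
  "lift_V sM X \<pi> = inv_into (module.span sM X) \<pi>"

definition coaction_X ::
    "('k::field \<Rightarrow> 'm::ab_group_add \<Rightarrow> 'm) \<Rightarrow> 'm set \<Rightarrow> ('m \<Rightarrow> 'v) \<Rightarrow> ('v \<Rightarrow> ('h \<times> 'v) list)
      \<Rightarrow> 'm \<Rightarrow> ('h \<times> 'm) list" where
  "coaction_X sM X \<pi> \<delta> x = map (\<lambda>(g, v). (g, lift_V sM X \<pi> v)) (\<delta> (\<pi> x))"

text \<open>
  \<open>b t h x\<close> is the coefficient \<open>b\<^sub>t(h, x)\<close> in
  \<open>h \<cdot> x = h \<cdot>\<^sub>V x + \<Sum>\<^sub>t b\<^sub>t(h, x) t\<close>, for \<open>t\<close> in the basis \<open>B\<close> of \<open>H\<close> and \<open>x\<close> in the span of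
  \<open>X\<close>.
\<close>

definition action_coefficients ::
    "('k::field \<Rightarrow> 'h::ring_1 \<Rightarrow> 'h) \<Rightarrow> ('h \<Rightarrow> 'v \<Rightarrow> 'v)
      \<Rightarrow> ('k \<Rightarrow> 'm::ab_group_add \<Rightarrow> 'm) \<Rightarrow> ('h \<Rightarrow> 'm \<Rightarrow> 'm) \<Rightarrow> ('h \<Rightarrow> 'm) \<Rightarrow> ('m \<Rightarrow> 'v)
      \<Rightarrow> 'm set \<Rightarrow> 'h set \<Rightarrow> ('h \<Rightarrow> 'h \<Rightarrow> 'm \<Rightarrow> 'k) \<Rightarrow> bool" where
  "action_coefficients sH actV sM actM \<iota> \<pi> X B b \<longleftrightarrow>
     (\<forall>t\<in>B. \<forall>h g c. \<forall>x\<in>module.span sM X. \<forall>y\<in>module.span sM X.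
        b t (h + g) x = b t h x + b t g x \<and> b t (sH c h) x = c * b t h x \<and>
        b t h (x + y) = b t h x + b t h y \<and> b t h (sM c x) = c * b t h x) \<and>
     (\<forall>h. \<forall>x\<in>module.span sM X.
        finite {t\<in>B. b t h x \<noteq> 0} \<and>
        actM h x = lift_V sM X \<pi> (actV h (\<pi> x)) + \<iota> (\<Sum>t | t \<in> B \<and> b t h x \<noteq> 0. sH (b t h x) t))"


section \<open>The algebras \<open>T\<^sub>H(M)\<close> and \<open>T(V)#\<^sub>MH\<close>\<close>

text \<open>
  Words form a monoid under concatenation, so that \<open>'g word \<Rightarrow>\<^sub>0 'k\<close> with the convolution product of
  \<^theory>\<open>HOL-Library.Poly_Mapping\<close> is the free unital algebra on \<open>'g\<close>.
\<close>

datatype 'g word = Word (letters: "'g list")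

instantiation word :: (type) monoid_add
begin

definition "0 = Word []"
definition "u + v = Word (letters u @ letters v)"

instance
  by standard (simp_all add: zero_word_def plus_word_def)

end

definition free_algebra :: "'g set \<Rightarrow> ('g word \<Rightarrow>\<^sub>0 'k::field) set" where
  "free_algebra G = {f. \<forall>w\<in>Poly_Mapping.keys f. set (letters w) \<subseteq> G}"

definition free_gen :: "'g \<Rightarrow> ('g word \<Rightarrow>\<^sub>0 'k::field)" where
  "free_gen g = Poly_Mapping.single (Word [g]) 1"

definition free_eval ::
    "('k::field \<Rightarrow> 'a::ring_1 \<Rightarrow> 'a) \<Rightarrow> ('g \<Rightarrow> 'a) \<Rightarrow> ('g word \<Rightarrow>\<^sub>0 'k) \<Rightarrow> 'a" where
  "free_eval s j f =
     (\<Sum>w\<in>Poly_Mapping.keys f. s (Poly_Mapping.lookup f w) (prod_list (map j (letters w))))"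

text \<open>
  The algebra \<open>'a\<close> is presented by generators \<open>G\<close>, mapped into it by \<open>j\<close>, and relations \<open>R\<close>.
\<close>

definition presented_by ::
    "('k::field \<Rightarrow> 'a::ring_1 \<Rightarrow> 'a) \<Rightarrow> ('g \<Rightarrow> 'a) \<Rightarrow> 'g set \<Rightarrow> ('g word \<Rightarrow>\<^sub>0 'k) set \<Rightarrow> bool" where
  "presented_by s j G R \<longleftrightarrow>
     k_algebra s \<and>
     free_eval s j ` free_algebra G = UNIV \<and>
     {f \<in> free_algebra G. free_eval s j f = 0} = ideal_gen (free_algebra G) R"

text \<open>
  The relations express the multiplication of \<open>H\<close> in the basis \<open>B\<close>, with \<open>1 \<in> B\<close> the unit.  Elements
  of \<open>B\<close> appear as generators through their images under \<open>\<iota>\<close>, so the generators of \<open>T\<^sub>H(M)\<close> are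
  the elements of the basis \<open>X \<union> \<iota> ` B\<close> of \<open>M\<close>.
\<close>

definition TH_relations ::
    "('k::field \<Rightarrow> 'h::ring_1 \<Rightarrow> 'h) \<Rightarrow> 'h set \<Rightarrow> ('h \<Rightarrow> 'm) \<Rightarrow> ('m word \<Rightarrow>\<^sub>0 'k) set" where
  "TH_relations sH B \<iota> =
     {free_gen (\<iota> s) * free_gen (\<iota> t)
        - (\<Sum>u | module.representation sH B (s * t) u \<noteq> 0.
             fscale (module.representation sH B (s * t) u) (free_gen (\<iota> u)))
      | s t. s \<in> B \<and> t \<in> B}
     \<union> {free_gen (\<iota> 1) - 1}"

text \<open>
  \<open>j\<close> is the linear extension to \<open>M\<close> of the map from generators to \<open>T\<^sub>H(M)\<close>; thus \<open>j \<circ> \<iota>\<close> is the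
  canonical map \<open>H \<rightarrow> T\<^sub>H(M)\<close>.
\<close>

definition is_TH ::
    "('k::field \<Rightarrow> 'h::ring_1 \<Rightarrow> 'h) \<Rightarrow> ('k \<Rightarrow> 'm::ab_group_add \<Rightarrow> 'm) \<Rightarrow> ('h \<Rightarrow> 'm)
      \<Rightarrow> 'm set \<Rightarrow> 'h set \<Rightarrow> ('k \<Rightarrow> 't::ring_1 \<Rightarrow> 't) \<Rightarrow> ('m \<Rightarrow> 't) \<Rightarrow> bool" where
  "is_TH sH sM \<iota> X B sT j \<longleftrightarrow>
     presented_by sT j (X \<union> \<iota> ` B) (TH_relations sH B \<iota>) \<and> Vector_Spaces.linear sM sT j"

definition J_ideal ::
    "('h \<Rightarrow> ('h \<times> 'h) list) \<Rightarrow> ('h \<Rightarrow> 'm \<Rightarrow> 'm) \<Rightarrow> ('h \<Rightarrow> 'm) \<Rightarrow> ('m \<Rightarrow> 't::ring_1) \<Rightarrow> 't set" where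
  "J_ideal \<Delta> actM \<iota> j =
     ideal_gen UNIV {j (\<iota> h) * j x - (\<Sum>(h1, h2)\<leftarrow>\<Delta> h. j (actM h1 x) * j (\<iota> h2)) | h x. True}"

definition is_quotient_algebra ::
    "('k::field \<Rightarrow> 'a::ring_1 \<Rightarrow> 'a) \<Rightarrow> 'a set \<Rightarrow> ('k \<Rightarrow> 'b::ring_1 \<Rightarrow> 'b) \<Rightarrow> ('a \<Rightarrow> 'b) \<Rightarrow> bool" where
  "is_quotient_algebra sA J sB p \<longleftrightarrow>
     k_algebra sA \<and> k_algebra sB \<and> algebra_hom sA sB p \<and> surj p \<and> {x. p x = 0} = J"

text \<open>
  The Hopf algebra structure on \<open>T\<^sub>H(M)\<close>: \<open>H\<close> is a Hopf subalgebra and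
  \<open>\<Delta>(x) = x \<otimes> 1 + \<delta>(x)\<close> for \<open>x\<close> in the span of \<open>X\<close>.
\<close>

definition TH_hopf_structure ::
    "('k::field \<Rightarrow> 'h::ring_1 \<Rightarrow> 'h) \<Rightarrow> ('h \<Rightarrow> ('h \<times> 'h) list) \<Rightarrow> ('h \<Rightarrow> 'k) \<Rightarrow> ('h \<Rightarrow> 'h)
      \<Rightarrow> ('v \<Rightarrow> ('h \<times> 'v) list) \<Rightarrow> ('k \<Rightarrow> 'm::ab_group_add \<Rightarrow> 'm) \<Rightarrow> ('h \<Rightarrow> 'm) \<Rightarrow> ('m \<Rightarrow> 'v)
      \<Rightarrow> 'm set \<Rightarrow> ('k \<Rightarrow> 't::ring_1 \<Rightarrow> 't) \<Rightarrow> ('m \<Rightarrow> 't)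
      \<Rightarrow> ('t \<Rightarrow> ('t \<times> 't) list) \<Rightarrow> ('t \<Rightarrow> 'k) \<Rightarrow> ('t \<Rightarrow> 't) \<Rightarrow> bool" where
  "TH_hopf_structure sH \<Delta> \<epsilon> S \<delta> sM \<iota> \<pi> X sT j \<Delta>T \<epsilon>T ST \<longleftrightarrow>
     hopf_algebra sT \<Delta>T \<epsilon>T ST \<and>
     hopf_embedding sH \<Delta> \<epsilon> S sT \<Delta>T \<epsilon>T ST (j \<circ> \<iota>) \<and>
     (\<forall>x\<in>module.span sM X.
        tensor_eq sT sT (formal_sum (\<Delta>T (j x)))
          (tens (j x) 1 + (\<Sum>(g, y)\<leftarrow>coaction_X sM X \<pi> \<delta> x. tens (j (\<iota> g)) (j y))))"

end

theory Submission
  imports Defs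
begin

text \<open>
  Let \<open>P\<close> be the projection of \<open>M\<close> onto \<open>H\<close> along the span of \<open>X\<close>, and put \<open>\<Gamma>(h, m) = P(h\<^sub>1 \<cdot> m)h\<^sub>2\<close>.  A
  direct computation with the Yetter--Drinfeld condition shows that the coproduct of the relator
  \<open>r(h, x) = hx - (h\<^sub>1 \<cdot> x)h\<^sub>2\<close> lies in \<open>J \<otimes> T + T \<otimes> J\<close> up to the element
  \<open>\<Gamma>(h\<^sub>1, x) \<otimes> h\<^sub>2 + h\<^sub>1x\<^sub>-\<^sub>1 \<otimes> \<Gamma>(h\<^sub>2, x\<^sub>0) - \<Delta>(\<Gamma>(h, x))\<close> of \<open>H \<otimes> H\<close>, whose vanishing is the condition of the
  theorem.  The condition is necessary because \<open>H\<close> embeds in \<open>T/J\<close>: the rule \<open>u \<triangleleft> m = \<Gamma>(u, m)\<close> makes \<open>H\<close>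
  a right \<open>T\<close>-module annihilated by \<open>J\<close> on which \<open>H\<close> acts by right multiplication (it is dual to the
  extension of the action \<open>H \<otimes> H\<^sup>* \<rightarrow> H\<^sup>*\<close> to \<open>M \<otimes> H\<^sup>*\<close> by injectivity of \<open>H\<^sup>*\<close>), so \<open>t \<mapsto> 1 \<triangleleft> t\<close> is a
  linear retraction \<open>T \<rightarrow> H\<close> that vanishes on \<open>J\<close>.  Finally, the number of factors from \<open>M\<close> gives a
  coalgebra filtration of \<open>T/J\<close> whose degree-zero part is \<open>H\<close>, and a coalgebra filtration contains the
  coradical in degree zero.

  Identities in tensor products are tested on multilinear forms; \<open>psum (\<Delta> x) (\<lambda>a b. \<phi> a b)\<close> stands
  for the Sweedler expression \<open>\<phi>(x\<^sub>1, x\<^sub>2)\<close>.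
\<close>

section \<open>Linear and multilinear maps\<close>

text \<open>The formula for \<open>\<Gamma>\<close> is forced by the relators. Modulo
  \<open>J\<close> the product \<open>hm\<close> equals \<open>(h1 \<cdot> m) h2\<close>, and
  \<open>\<Gamma> h m\<close> is what the \<open>H\<close>-component of \<open>h1 \<cdot> m\<close>
  contributes there. Rewriting moves all elements of \<open>H\<close> to the right; the retraction
  keeps the part of the result that lies in \<open>H\<close> and sends every word
  \<open>x1 ... xn h\<close> with factors from \<open>KX\<close> and \<open>n > 0\<close> to zero.
  The obstacle to necessity is that \<open>J\<close> might meet \<open>H\<close>, so that an
  identity in \<open>H \<otimes> H\<close> could be lost in \<open>T/J\<close>. A normal form
  theorem describing \<open>T/J\<close> as \<open>T(V) \<otimes> H\<close> would exclude this, but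
  much less is enough: a linear left inverse of the map from \<open>H\<close> to \<open>T/J\<close>.
  No compatibility of it with products or coproducts is asked, neither for necessity nor for the
  comparison of coradicals. As \<open>T\<close> is known only through its presentation, this map has
  to be built on the free algebra and shown to respect the relations, which is natural for a module
  structure.\<close>

definition linmap :: "('k::field \<Rightarrow> 'a::ab_group_add \<Rightarrow> 'a) \<Rightarrow> ('k \<Rightarrow> 'b::ab_group_add \<Rightarrow> 'b) \<Rightarrow> ('a \<Rightarrow> 'b) \<Rightarrow> bool"
  where "linmap sA sB f \<longleftrightarrow> (\<forall>x y. f (x + y) = f x + f y) \<and> (\<forall>c x. f (sA c x) = sB c (f x))"

definition bilinmap where
  "bilinmap sA sB sC \<phi> \<longleftrightarrow> (\<forall>a. linmap sB sC (\<phi> a)) \<and> (\<forall>b. linmap sA sC (\<lambda>a. \<phi> a b))"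

definition trilinmap where
  "trilinmap sA sB sC sD \<psi> \<longleftrightarrow> (\<forall>a. bilinmap sB sC sD (\<psi> a)) \<and> (\<forall>b c. linmap sA sD (\<lambda>a. \<psi> a b c))"

named_theorems linmap_intros

lemma linmapI: "(\<And>x y. f (x + y) = f x + f y) \<Longrightarrow> (\<And>c x. f (sA c x) = sB c (f x)) \<Longrightarrow> linmap sA sB f"
  by (simp add: linmap_def)

lemma linmap_add: "linmap sA sB f \<Longrightarrow> f (x + y) = f x + f y"
  and linmap_scale: "linmap sA sB f \<Longrightarrow> f (sA c x) = sB c (f x)"
  by (simp_all add: linmap_def)

lemma linmap_0: "linmap sA sB f \<Longrightarrow> f 0 = 0"
  using linmap_add[of sA sB f 0 0] by simp

lemma linmap_minus: "linmap sA sB f \<Longrightarrow> f (- x) = - f x"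
  using linmap_add[of sA sB f x "- x"] linmap_0[of sA sB f] by (simp add: eq_neg_iff_add_eq_0 add.commute)

lemma linmap_diff: "linmap sA sB f \<Longrightarrow> f (x - y) = f x - f y"
  using linmap_add[of sA sB f x "- y"] by (simp add: linmap_minus)

lemma linmap_sum: "linmap sA sB f \<Longrightarrow> f (\<Sum>i\<in>I. g i) = (\<Sum>i\<in>I. f (g i))"
  by (induction I rule: infinite_finite_induct) (auto simp: linmap_0 linmap_add)

lemma linmap_eq_0_on_span:
  assumes "vector_space sA" "vector_space sB" "linmap sA sB f" "\<And>x. x \<in> K \<Longrightarrow> f x = 0" "x \<in> module.span sA K"
  shows "f x = 0"
proof -
  interpret A: vector_space sA by fact
  interpret B: vector_space sB by fact
  show ?thesis using assms(5)
    by (induction rule: A.span_induct_alt)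
      (auto simp: linmap_0[OF assms(3)] linmap_add[OF assms(3)] linmap_scale[OF assms(3)] assms(4))
qed

lemma linear_imp_linmap: "Vector_Spaces.linear sA sB f \<Longrightarrow> linmap sA sB f"
  by (auto simp: Vector_Spaces.linear_iff linmap_def)

lemma linmap_imp_linear: "vector_space sA \<Longrightarrow> vector_space sB \<Longrightarrow> linmap sA sB f \<Longrightarrow> Vector_Spaces.linear sA sB f"
  by (auto simp: Vector_Spaces.linear_iff linmap_def)

lemma bilinmapI [linmap_intros]:
  "(\<And>a. linmap sB sC (\<lambda>b. \<phi> a b)) \<Longrightarrow> (\<And>b. linmap sA sC (\<lambda>a. \<phi> a b)) \<Longrightarrow> bilinmap sA sB sC (\<lambda>a b. \<phi> a b)"
  by (simp add: bilinmap_def)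

lemma trilinmapI [linmap_intros]:
  "(\<And>a b. linmap sC sD (\<lambda>c. \<psi> a b c)) \<Longrightarrow> (\<And>a c. linmap sB sD (\<lambda>b. \<psi> a b c)) \<Longrightarrow>
   (\<And>b c. linmap sA sD (\<lambda>a. \<psi> a b c)) \<Longrightarrow> trilinmap sA sB sC sD (\<lambda>a b c. \<psi> a b c)"
  by (simp add: trilinmap_def bilinmap_def)

lemma bilinmap_left: "bilinmap sA sB sC \<phi> \<Longrightarrow> linmap sA sC (\<lambda>a. \<phi> a b)"
  and bilinmap_right: "bilinmap sA sB sC \<phi> \<Longrightarrow> linmap sB sC (\<phi> a)"
  by (auto simp: bilinmap_def)

lemma linmap_compose: "linmap sB sC g \<Longrightarrow> linmap sA sB f \<Longrightarrow> linmap sA sC (\<lambda>x. g (f x))"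
  by (simp add: linmap_def)

lemma bilinmap_compose_left: "bilinmap sA sB sC \<phi> \<Longrightarrow> linmap s sA f \<Longrightarrow> linmap s sC (\<lambda>x. \<phi> (f x) c)"
  and bilinmap_compose_right: "bilinmap sA sB sC \<phi> \<Longrightarrow> linmap s sB g \<Longrightarrow> linmap s sC (\<lambda>x. \<phi> d (g x))"
  by (simp_all add: bilinmap_def linmap_def)

lemma linmap_id [linmap_intros]: "linmap s s (\<lambda>x. x)"
  by (simp add: linmap_def)

lemma linmap_plus [linmap_intros]:
  "vector_space sB \<Longrightarrow> linmap sA sB f \<Longrightarrow> linmap sA sB g \<Longrightarrow> linmap sA sB (\<lambda>x. f x + g x)"
  by (simp add: linmap_def vector_space_def)

lemma linmap_minus_fun [linmap_intros]:
  "vector_space sB \<Longrightarrow> linmap sA sB f \<Longrightarrow> linmap sA sB g \<Longrightarrow> linmap sA sB (\<lambda>x. f x - g x)"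
  by (simp add: linmap_def module.scale_right_diff_distrib module_iff_vector_space[symmetric])

lemma linmap_scale_vec [linmap_intros]: "vector_space sB \<Longrightarrow> linmap sA (*) f \<Longrightarrow> linmap sA sB (\<lambda>x. sB (f x) v)"
  and linmap_scale_const [linmap_intros]: "vector_space sB \<Longrightarrow> linmap sA sB g \<Longrightarrow> linmap sA sB (\<lambda>x. sB c (g x))"
  by (auto simp: linmap_def vector_space_def mult.commute)

lemma vector_space_field [linmap_intros]: "vector_space ((*) :: 'k::field \<Rightarrow> 'k \<Rightarrow> 'k)"
  by unfold_locales (simp_all add: algebra_simps)

lemma linmap_zero_fun: "vector_space sB \<Longrightarrow> linmap sA sB (\<lambda>_. 0)"
  by (simp add: linmap_def module.scale_zero_right module_iff_vector_space[symmetric])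

text \<open>A basis of the span of \<open>K\<close> stays independent after adjoining
  \<open>u\<close>, so the values 0 on it and 1 at \<open>u\<close> extend linearly. Every passage
  from forms back to tensors rests on this.\<close>

lemma (in vector_space) ex_separating_functional:
  assumes "u \<notin> span K"
  obtains F where "linmap scale (*) F" "\<And>x. x \<in> K \<Longrightarrow> F x = 0" "F u = 1"
proof -
  interpret p: vector_space_pair scale "(*) :: 'a \<Rightarrow> 'a \<Rightarrow> 'a"
    by unfold_locales (simp_all add: algebra_simps)
  obtain C where C: "C \<subseteq> K" "independent C" "K \<subseteq> span C"
    by (rule maximal_independent_subset)
  have "span C = span K"
    using C by (metis span_mono span_span subset_antisym)
  then have "independent (insert u C)"
    using assms C by (simp add: independent_insertI)
  from p.linear_independent_extend[OF this, of "\<lambda>x. if x = u then 1 else 0"]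
  obtain F where F: "Vector_Spaces.linear scale (*) F" "\<And>x. x \<in> insert u C \<Longrightarrow> F x = (if x = u then 1 else 0)"
    by blast
  have "u \<notin> C"
    using assms \<open>span C = span K\<close> span_base by blast
  then have "F x = 0" if "x \<in> C" for x
    using F(2)[of x] that by (auto split: if_splits)
  then have "F x = 0" if "x \<in> K" for x
    using linmap_eq_0_on_span[OF vector_space_axioms vector_space_field linear_imp_linmap[OF F(1)]] C(3) that
    by blast
  then show thesis
    using that linear_imp_linmap[OF F(1)] F(2)[of u] by simp
qed

section \<open>Sums over lists of pairs and linear extension\<close>

definition psum :: "('a \<times> 'b) list \<Rightarrow> ('a \<Rightarrow> 'b \<Rightarrow> 'c::ab_group_add) \<Rightarrow> 'c" where
  "psum xs \<phi> = (\<Sum>(a, b)\<leftarrow>xs. \<phi> a b)"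

lemma psum_Nil [simp]: "psum [] \<phi> = 0"
  and psum_Cons [simp]: "psum (p # xs) \<phi> = \<phi> (fst p) (snd p) + psum xs \<phi>"
  by (simp_all add: psum_def split_def)

lemma psum_cong: "(\<And>a b. (a, b) \<in> set xs \<Longrightarrow> \<phi> a b = \<psi> a b) \<Longrightarrow> psum xs \<phi> = psum xs \<psi>"
  by (induction xs) auto

lemma psum_zero: "(\<And>a b. (a, b) \<in> set xs \<Longrightarrow> \<phi> a b = 0) \<Longrightarrow> psum xs \<phi> = 0"
  by (induction xs) auto

lemma psum_add: "psum xs (\<lambda>a b. \<phi> a b + \<psi> a b) = psum xs \<phi> + psum xs \<psi>"
  by (induction xs) (auto simp: algebra_simps)

lemma psum_diff: "psum xs (\<lambda>a b. \<phi> a b - \<psi> a b) = psum xs \<phi> - psum xs \<psi>"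
  by (induction xs) (auto simp: algebra_simps)

lemma psum_swap: "psum xs (\<lambda>a b. psum ys (\<lambda>c d. F a b c d)) = psum ys (\<lambda>c d. psum xs (\<lambda>a b. F a b c d))"
proof (induction xs)
  case Nil
  then show ?case by (simp add: psum_zero)
qed (simp add: psum_add)

lemma psum_map: "psum (map (\<lambda>(a, b). (f a b, g a b)) xs) \<phi> = psum xs (\<lambda>a b. \<phi> (f a b) (g a b))"
  by (induction xs) auto

lemma linmap_psum: "linmap sA sB g \<Longrightarrow> g (psum xs \<phi>) = psum xs (\<lambda>a b. g (\<phi> a b))"
  by (induction xs) (auto simp: linmap_0 linmap_add)

lemma psum_mult_right: "psum xs \<phi> * (c::'a::ring_1) = psum xs (\<lambda>a b. \<phi> a b * c)"
  and psum_mult_left: "c * psum xs \<phi> = psum xs (\<lambda>a b. c * \<phi> a b)"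
  by (induction xs; simp add: algebra_simps)+

lemma linmap_psum_fun [linmap_intros]:
  assumes "vector_space sB" "\<And>a b. linmap sA sB (\<lambda>x. F x a b)"
  shows "linmap sA sB (\<lambda>x. psum xs (\<lambda>a b. F x a b))"
  by (induction xs) (auto intro!: linmap_plus linmap_zero_fun assms)

lemma psum_in_subspace:
  assumes "vector_space s" "module.subspace s K" "\<And>a b. (a, b) \<in> set xs \<Longrightarrow> \<phi> a b \<in> K"
  shows "psum xs \<phi> \<in> K"
proof -
  interpret vector_space s by fact
  show ?thesis
    using assms(2,3) by (induction xs) (auto simp: subspace_0 subspace_add)
qed

section \<open>Linear extension from the free vector space\<close>

definition lext :: "('k::field \<Rightarrow> 'c::ab_group_add \<Rightarrow> 'c) \<Rightarrow> ('p \<Rightarrow> 'c) \<Rightarrow> ('p \<Rightarrow>\<^sub>0 'k) \<Rightarrow> 'c" where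
  "lext s F u = (\<Sum>p\<in>Poly_Mapping.keys u. s (Poly_Mapping.lookup u p) (F p))"

lemma lookup_fscale [simp]: "Poly_Mapping.lookup (fscale c u) p = c * Poly_Mapping.lookup u p"
  by (simp add: fscale_def Poly_Mapping.map.rep_eq when_def)

lemma vector_space_fscale: "vector_space (fscale :: 'k::field \<Rightarrow> ('p \<Rightarrow>\<^sub>0 'k) \<Rightarrow> ('p \<Rightarrow>\<^sub>0 'k))"
  by unfold_locales (simp_all add: poly_mapping_eq_iff fun_eq_iff lookup_add algebra_simps)

interpretation F: vector_space "fscale :: 'k::field \<Rightarrow> ('p \<Rightarrow>\<^sub>0 'k) \<Rightarrow> ('p \<Rightarrow>\<^sub>0 'k)"
  by (rule vector_space_fscale)

lemma fscale_single: "fscale c (Poly_Mapping.single p r) = Poly_Mapping.single p (c * r)"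
  by (simp add: poly_mapping_eq_iff fun_eq_iff lookup_single when_def)

lemma sum_single_keys: "u = (\<Sum>p\<in>Poly_Mapping.keys u. Poly_Mapping.single p (Poly_Mapping.lookup u p))"
  by (rule poly_mapping_eqI)
    (simp add: lookup_sum lookup_single when_def sum.delta' in_keys_iff)

text \<open>Scaling is multiplication by the constant \<open>single 0 c\<close>, which is central
  because \<open>0\<close> is the unit of the monoid and the coefficients commute.\<close>

lemma fscale_mult: "fscale c u * v = fscale c (u * v)" "u * fscale c v = fscale c (u * v)"
  for u v :: "'w::monoid_add \<Rightarrow>\<^sub>0 'k::field"
proof -
  have 1: "fscale c x = Poly_Mapping.single 0 c * x" for x :: "'w \<Rightarrow>\<^sub>0 'k"
    by (simp add: fscale_def mult_map_scale_conv_mult)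
  have "u * Poly_Mapping.single 0 c = Poly_Mapping.single 0 c * u"
    by (subst (1 2) sum_single_keys[of u]) (simp add: sum_distrib_left sum_distrib_right mult_single mult.commute)
  then show "fscale c u * v = fscale c (u * v)" "u * fscale c v = fscale c (u * v)"
    by (metis 1 mult.assoc)+
qed

lemma linmap_lext:
  assumes "vector_space s"
  shows "linmap fscale s (lext s F)"
proof (rule linmapI)
  interpret vector_space s by fact
  have ext: "lext s F u = (\<Sum>p\<in>A. s (Poly_Mapping.lookup u p) (F p))"
    if "finite A" "Poly_Mapping.keys u \<subseteq> A" for u A
    unfolding lext_def using that by (intro sum.mono_neutral_left) (auto simp: in_keys_iff)
  show "lext s F (x + y) = lext s F x + lext s F y" for x y
    using ext[of "Poly_Mapping.keys x \<union> Poly_Mapping.keys y" x]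
      ext[of "Poly_Mapping.keys x \<union> Poly_Mapping.keys y" y]
      ext[of "Poly_Mapping.keys x \<union> Poly_Mapping.keys y" "x + y"] Poly_Mapping.keys_add[of x y]
    by (simp add: lookup_add scale_left_distrib sum.distrib)
  show "lext s F (fscale c x) = s c (lext s F x)" for c x
    using ext[of "Poly_Mapping.keys x" "fscale c x"]
    by (simp add: lext_def scale_sum_right in_keys_iff subset_iff)
qed

lemma lext_single: "vector_space s \<Longrightarrow> lext s F (Poly_Mapping.single p c) = s c (F p)"
  by (simp add: lext_def module.scale_zero_left module_iff_vector_space[symmetric])

lemma lext_unique:
  assumes "vector_space s" "linmap fscale s G"
  shows "G u = lext s (\<lambda>p. G (Poly_Mapping.single p 1)) u"
proof -
  have "G u = (\<Sum>p\<in>Poly_Mapping.keys u. G (fscale (Poly_Mapping.lookup u p) (Poly_Mapping.single p 1)))"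
    by (subst sum_single_keys[of u]) (simp add: linmap_sum[OF assms(2)] fscale_single)
  then show ?thesis
    by (simp add: linmap_scale[OF assms(2)] lext_def)
qed

section \<open>Tensors and multilinear forms\<close>

abbreviation lext2 :: "('k::field \<Rightarrow> 'c::ab_group_add \<Rightarrow> 'c) \<Rightarrow> ('a \<Rightarrow> 'b \<Rightarrow> 'c) \<Rightarrow> ('a \<times> 'b \<Rightarrow>\<^sub>0 'k) \<Rightarrow> 'c"
  where "lext2 s \<phi> \<equiv> lext s (\<lambda>(a, b). \<phi> a b)"

abbreviation lext3 :: "('k::field \<Rightarrow> 'd::ab_group_add \<Rightarrow> 'd) \<Rightarrow> ('a \<Rightarrow> 'b \<Rightarrow> 'c \<Rightarrow> 'd) \<Rightarrow> ('a \<times> 'b \<times> 'c \<Rightarrow>\<^sub>0 'k) \<Rightarrow> 'd"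
  where "lext3 s \<psi> \<equiv> lext s (\<lambda>(a, b, c). \<psi> a b c)"

lemma formal_sum_Nil [simp]: "formal_sum [] = 0"
  and formal_sum_Cons: "formal_sum (p # ps) = Poly_Mapping.single p 1 + formal_sum ps"
  by (simp_all add: formal_sum_def)

context
  fixes s :: "'k::field \<Rightarrow> 'c::ab_group_add \<Rightarrow> 'c"
  assumes s: "vector_space s"
begin

lemmas lext_add = linmap_add[OF linmap_lext[OF s]]
  and lext_diff = linmap_diff[OF linmap_lext[OF s]]
  and lext_fscale = linmap_scale[OF linmap_lext[OF s]]
  and lext_psum = linmap_psum[OF linmap_lext[OF s]]
  and lext_sum = linmap_sum[OF linmap_lext[OF s]]
  and lext_0 = linmap_0[OF linmap_lext[OF s]]

lemma lext2_tens: "lext2 s \<phi> (tens a b) = \<phi> a b"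
  by (simp add: tens_def lext_single[OF s] module.scale_one[OF s[folded module_iff_vector_space]])

lemma lext3_tens3: "lext3 s \<psi> (tens3 a b c) = \<psi> a b c"
  by (simp add: tens3_def lext_single[OF s] module.scale_one[OF s[folded module_iff_vector_space]])

lemma lext2_formal_sum: "lext2 s \<phi> (formal_sum ps) = psum ps \<phi>"
  by (induction ps)
    (auto simp: lext_0 formal_sum_Cons lext_add tens_def[symmetric] lext2_tens)

lemma lext2_tensor_null:
  assumes "bilinmap sA sB s \<phi>" "u \<in> tensor_null sA sB"
  shows "lext2 s \<phi> u = 0"
proof (rule linmap_eq_0_on_span[OF vector_space_fscale s linmap_lext[OF s] _ assms(2)[unfolded tensor_null_def]])
  have lin: "linmap sB s (\<phi> a)" "linmap sA s (\<lambda>a. \<phi> a b)" for a b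
    using assms(1) by (auto simp: bilinmap_def)
  then show "lext2 s \<phi> x = 0"
    if "x \<in> {tens (a + a') b - tens a b - tens a' b | a a' b. True} \<union>
      {tens a (b + b') - tens a b - tens a b' | a b b'. True} \<union>
      {tens (sA r a) b - fscale r (tens a b) | r a b. True} \<union>
      {tens a (sB r b) - fscale r (tens a b) | r a b. True}" for x
    using that by (auto simp: lext_diff lext_fscale lext2_tens linmap_add[OF lin(1)] linmap_add[OF lin(2)]
        linmap_scale[OF lin(1)] linmap_scale[OF lin(2)])
qed

lemma lext3_tensor3_null:
  assumes "trilinmap sA sB sC s \<psi>" "u \<in> tensor3_null sA sB sC"
  shows "lext3 s \<psi> u = 0"
proof (rule linmap_eq_0_on_span[OF vector_space_fscale s linmap_lext[OF s] _ assms(2)[unfolded tensor3_null_def]])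
  have lin: "linmap sC s (\<psi> a b)" "linmap sB s (\<lambda>b. \<psi> a b c)" "linmap sA s (\<lambda>a. \<psi> a b c)" for a b c
    using assms(1) by (auto simp: trilinmap_def bilinmap_def)
  then show "lext3 s \<psi> x = 0"
    if "x \<in> {tens3 (a + a') b c - tens3 a b c - tens3 a' b c | a a' b c. True} \<union>
      {tens3 a (b + b') c - tens3 a b c - tens3 a b' c | a b b' c. True} \<union>
      {tens3 a b (c + c') - tens3 a b c - tens3 a b c' | a b c c'. True} \<union>
      {tens3 (sA r a) b c - fscale r (tens3 a b c) | r a b c. True} \<union>
      {tens3 a (sB r b) c - fscale r (tens3 a b c) | r a b c. True} \<union>
      {tens3 a b (sC r c) - fscale r (tens3 a b c) | r a b c. True}" for x
    using that by (auto simp: lext_diff lext_fscale lext3_tens3 linmap_add[OF lin(1)] linmap_add[OF lin(2)]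
        linmap_add[OF lin(3)] linmap_scale[OF lin(1)] linmap_scale[OF lin(2)] linmap_scale[OF lin(3)])
qed

lemma tensor_eqD: "tensor_eq sA sB u v \<Longrightarrow> bilinmap sA sB s \<phi> \<Longrightarrow> lext2 s \<phi> u = lext2 s \<phi> v"
  using lext2_tensor_null[of sA sB \<phi> "u - v"] by (simp add: tensor_eq_def lext_diff)

lemma tensor3_eqD: "tensor3_eq sA sB sC u v \<Longrightarrow> trilinmap sA sB sC s \<psi> \<Longrightarrow> lext3 s \<psi> u = lext3 s \<psi> v"
  using lext3_tensor3_null[of sA sB sC \<psi> "u - v"] by (simp add: tensor3_eq_def lext_diff)

end

text \<open>A functional on the free space that kills the bilinearity relations is a bilinear form.
  If \<open>u\<close> were not congruent to a combination of tensors from \<open>K\<close>, a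
  separating functional would give a form that vanishes on \<open>K\<close> but not on
  \<open>u\<close>. This reduces the existence of lists in the definitions of Hopf ideals and
  subcoalgebras to the vanishing of forms.\<close>

lemma tensor_eq_formal_sumI:
  fixes sA :: "'k::field \<Rightarrow> 'a::ab_group_add \<Rightarrow> 'a" and sB :: "'k \<Rightarrow> 'b::ab_group_add \<Rightarrow> 'b"
  assumes forms: "\<And>\<phi>. bilinmap sA sB (*) \<phi> \<Longrightarrow> (\<And>a b. (a, b) \<in> K \<Longrightarrow> \<phi> a b = 0) \<Longrightarrow> lext2 (*) \<phi> u = 0"
    and K: "\<And>c a b. (a, b) \<in> K \<Longrightarrow> (sA c a, b) \<in> K"
  shows "\<exists>ps. set ps \<subseteq> K \<and> tensor_eq sA sB u (formal_sum ps)"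
proof -
  define N where "N = {tens (a + a') b - tens a b - tens a' b | a a' b. True} \<union>
      {tens a (b + b') - tens a b - tens a b' | a b b'. True} \<union>
      {tens (sA r a) b - fscale r (tens a b) | r a b. True} \<union>
      {tens a (sB r b) - fscale r (tens a b) | r a b. True}"
  have N_null: "F.span N = tensor_null sA sB"
    by (simp add: N_def tensor_null_def)
  have "u \<in> F.span (N \<union> {tens a b | a b. (a, b) \<in> K})"
  proof (rule ccontr)
    assume "u \<notin> F.span (N \<union> {tens a b | a b. (a, b) \<in> K})"
    then obtain G where G: "linmap fscale (*) G" "\<And>x. x \<in> N \<union> {tens a b | a b. (a, b) \<in> K} \<Longrightarrow> G x = 0"
      and Gu: "G u = 1"
      by (rule F.ex_separating_functional) blast
    note G_simps = linmap_add[OF G(1)] linmap_diff[OF G(1)] linmap_scale[OF G(1)]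
    have "bilinmap sA sB (*) (\<lambda>a b. G (tens a b))"
    proof (intro bilinmapI linmapI)
      show "G (tens a (x + y)) = G (tens a x) + G (tens a y)" for a x y
        proof -
        have "G (tens a (x + y) - tens a x - tens a y) = 0"
          by (rule G(2)) (unfold N_def, blast)
        then show ?thesis
          by (simp add: G_simps algebra_simps)
      qed
      show "G (tens (x + y) a) = G (tens x a) + G (tens y a)" for a x y
        proof -
        have "G (tens (x + y) a - tens x a - tens y a) = 0"
          by (rule G(2)) (unfold N_def, blast)
        then show ?thesis
          by (simp add: G_simps algebra_simps)
      qed
      show "G (tens a (sB c x)) = c * G (tens a x)" for a c x
        proof -
        have "G (tens a (sB c x) - fscale c (tens a x)) = 0"
          by (rule G(2)) (unfold N_def, blast)
        then show ?thesis
          by (simp add: G_simps algebra_simps)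
      qed
      show "G (tens (sA c x) a) = c * G (tens x a)" for a c x
        proof -
        have "G (tens (sA c x) a - fscale c (tens x a)) = 0"
          by (rule G(2)) (unfold N_def, blast)
        then show ?thesis
          by (simp add: G_simps algebra_simps)
      qed
    qed
    from forms[OF this] have "lext2 (*) (\<lambda>a b. G (tens a b)) u = 0"
      using G(2) by blast
    moreover have "lext2 (*) (\<lambda>a b. G (tens a b)) u = G u"
      by (subst (2) lext_unique[OF vector_space_field G(1)]) (simp add: tens_def split_def)
    ultimately show False
      using Gu by simp
  qed
  then obtain x y where u: "u = x + y" and x: "x \<in> tensor_null sA sB"
    and y: "y \<in> F.span {tens a b | a b. (a, b) \<in> K}"
    by (auto simp: F.span_Un N_null)
  from y have "\<exists>ps. set ps \<subseteq> K \<and> y - formal_sum ps \<in> tensor_null sA sB"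
  proof (induction rule: F.span_induct_alt)
    case base
    show ?case
      by (rule exI[of _ "[]"]) (simp add: N_null[symmetric] F.span_zero)
  next
    case (step c z w)
    then obtain a b ps where z: "z = tens a b" "(a, b) \<in> K"
      and ps: "set ps \<subseteq> K" "w - formal_sum ps \<in> tensor_null sA sB"
      by auto
    have "tens (sA c a) b - fscale c z \<in> N"
      using z by (auto simp: N_def)
    then have "(w - formal_sum ps) - (tens (sA c a) b - fscale c z) \<in> tensor_null sA sB"
      using F.span_diff[of "w - formal_sum ps" N "tens (sA c a) b - fscale c z"] F.span_base[of _ N] ps(2)
      by (simp add: N_null)
    then show ?case
      \<comment> \<open>Formal sums only have coefficients 1, so the scalar is absorbed into the
        first factor; \<open>K\<close> is closed under this.\<close>
      using ps z K by (intro exI[of _ "(sA c a, b) # ps"]) (simp add: formal_sum_Cons tens_def algebra_simps)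
  qed
  then obtain ps where ps: "set ps \<subseteq> K" "y - formal_sum ps \<in> tensor_null sA sB"
    by blast
  have "u - formal_sum ps \<in> tensor_null sA sB"
    using F.span_add[of x N "y - formal_sum ps"] ps x by (simp add: u N_null algebra_simps)
  then show ?thesis
    using ps by (auto simp: tensor_eq_def)
qed

text \<open>The case of an empty \<open>K\<close>: only the empty list is available, so the
  difference itself must be null.\<close>

lemma tensor_eqI:
  assumes "\<And>\<phi>. bilinmap sA sB (*) \<phi> \<Longrightarrow> lext2 (*) \<phi> u = lext2 (*) \<phi> v"
  shows "tensor_eq sA sB u v"
proof -
  have "\<exists>ps. set ps \<subseteq> {} \<and> tensor_eq sA sB (u - v) (formal_sum ps)"
    by (rule tensor_eq_formal_sumI) (auto simp: lext_diff[OF vector_space_field] assms)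
  then show ?thesis
    by (auto simp: tensor_eq_def)
qed

lemma tensor3_eqI:
  fixes sA :: "'k::field \<Rightarrow> 'a::ab_group_add \<Rightarrow> 'a" and sB :: "'k \<Rightarrow> 'b::ab_group_add \<Rightarrow> 'b"
    and sC :: "'k \<Rightarrow> 'c::ab_group_add \<Rightarrow> 'c"
  assumes forms: "\<And>\<psi>. trilinmap sA sB sC (*) \<psi> \<Longrightarrow> lext3 (*) \<psi> u = lext3 (*) \<psi> v"
  shows "tensor3_eq sA sB sC u v"
proof (rule ccontr)
  define N where "N = {tens3 (a + a') b c - tens3 a b c - tens3 a' b c | a a' b c. True} \<union>
      {tens3 a (b + b') c - tens3 a b c - tens3 a b' c | a b b' c. True} \<union>
      {tens3 a b (c + c') - tens3 a b c - tens3 a b c' | a b c c'. True} \<union>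
      {tens3 (sA r a) b c - fscale r (tens3 a b c) | r a b c. True} \<union>
      {tens3 a (sB r b) c - fscale r (tens3 a b c) | r a b c. True} \<union>
      {tens3 a b (sC r c) - fscale r (tens3 a b c) | r a b c. True}"
  assume "\<not> tensor3_eq sA sB sC u v"
  then have "u - v \<notin> F.span N"
    by (simp add: tensor3_eq_def tensor3_null_def N_def)
  then obtain G where G: "linmap fscale (*) G" "\<And>x. x \<in> N \<Longrightarrow> G x = 0" and Gu: "G (u - v) = 1"
    by (rule F.ex_separating_functional) blast
  note G_simps = linmap_add[OF G(1)] linmap_diff[OF G(1)] linmap_scale[OF G(1)]
  have "trilinmap sA sB sC (*) (\<lambda>a b c. G (tens3 a b c))"
  proof (intro trilinmapI linmapI)
    show "G (tens3 a b (x + y)) = G (tens3 a b x) + G (tens3 a b y)" for a b x y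
    proof -
      have "G (tens3 a b (x + y) - tens3 a b x - tens3 a b y) = 0"
        by (rule G(2)) (unfold N_def, blast)
      then show ?thesis
        by (simp add: G_simps algebra_simps)
    qed
    show "G (tens3 a (x + y) b) = G (tens3 a x b) + G (tens3 a y b)" for a b x y
    proof -
      have "G (tens3 a (x + y) b - tens3 a x b - tens3 a y b) = 0"
        by (rule G(2)) (unfold N_def, blast)
      then show ?thesis
        by (simp add: G_simps algebra_simps)
    qed
    show "G (tens3 (x + y) b c) = G (tens3 x b c) + G (tens3 y b c)" for b c x y
    proof -
      have "G (tens3 (x + y) b c - tens3 x b c - tens3 y b c) = 0"
        by (rule G(2)) (unfold N_def, intro UnI1 CollectI exI conjI TrueI, rule refl[of "tens3 (x + y) b c - tens3 x b c - tens3 y b c"])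
      then show ?thesis
        by (simp add: G_simps algebra_simps)
    qed
    show "G (tens3 a b (sC c x)) = c * G (tens3 a b x)" for a b c x
    proof -
      have "G (tens3 a b (sC c x) - fscale c (tens3 a b x)) = 0"
        by (rule G(2)) (unfold N_def, blast)
      then show ?thesis
        by (simp add: G_simps algebra_simps)
    qed
    show "G (tens3 a (sB c x) b) = c * G (tens3 a x b)" for a b c x
    proof -
      have "G (tens3 a (sB c x) b - fscale c (tens3 a x b)) = 0"
        by (rule G(2)) (unfold N_def, blast)
      then show ?thesis
        by (simp add: G_simps algebra_simps)
    qed
    show "G (tens3 (sA c x) a b) = c * G (tens3 x a b)" for a b c x
    proof -
      have "G (tens3 (sA c x) a b - fscale c (tens3 x a b)) = 0"
        by (rule G(2)) (unfold N_def, blast)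
      then show ?thesis
        by (simp add: G_simps algebra_simps)
    qed
  qed
  from forms[OF this] have "lext3 (*) (\<lambda>a b c. G (tens3 a b c)) (u - v) = 0"
    by (simp add: lext_diff[OF vector_space_field])
  moreover have "lext3 (*) (\<lambda>a b c. G (tens3 a b c)) (u - v) = G (u - v)"
    by (subst (2) lext_unique[OF vector_space_field G(1)]) (simp add: tens3_def split_def)
  ultimately show False
    using Gu by simp
qed

section \<open>Sweedler calculus in coalgebras and Hopf algebras\<close>

context coalgebra
begin

text \<open>The list \<open>\<Delta> x\<close> is an arbitrary representative and depends on
  \<open>x\<close> in no controlled way; linearity appears only after a bilinear map has been
  evaluated on it.\<close>

lemma comult_linmap:
  assumes "vector_space sC" "bilinmap scale scale sC \<phi>" "linmap s scale g"
  shows "linmap s sC (\<lambda>x. psum (\<Delta> (g x)) \<phi>)"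
proof (rule linmapI)
  note ev = lext_add[OF assms(1)] lext_fscale[OF assms(1)] lext2_formal_sum[OF assms(1)]
  show "psum (\<Delta> (g (x + y))) \<phi> = psum (\<Delta> (g x)) \<phi> + psum (\<Delta> (g y)) \<phi>" for x y
    using tensor_eqD[OF assms(1) comult_add assms(2)] by (simp add: ev linmap_add[OF assms(3)])
  show "psum (\<Delta> (g (s c x))) \<phi> = sC c (psum (\<Delta> (g x)) \<phi>)" for c x
    using tensor_eqD[OF assms(1) comult_scale assms(2)] by (simp add: ev linmap_scale[OF assms(3)])
qed

lemma comult_coassoc:
  assumes "vector_space sC" "trilinmap scale scale scale sC \<psi>"
  shows "psum (\<Delta> x) (\<lambda>a y. psum (\<Delta> y) (\<lambda>b c. \<psi> a b c)) = psum (\<Delta> x) (\<lambda>y c. psum (\<Delta> y) (\<lambda>a b. \<psi> a b c))"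
  using tensor3_eqD[OF assms(1) coassoc[folded psum_def] assms(2)]
  by (simp add: lext_psum[OF assms(1)] lext3_tens3[OF assms(1)])

lemma counit_linmap: "linmap s scale g \<Longrightarrow> linmap s (*) (\<lambda>x. \<epsilon> (g x))"
  by (rule linmap_compose[OF linear_imp_linmap[OF counit_linear]])

lemma comult_counit_left:
  assumes "linmap scale sC f"
  shows "psum (\<Delta> x) (\<lambda>a b. sC (\<epsilon> a) (f b)) = f x"
proof -
  have "f (psum (\<Delta> x) (\<lambda>a b. scale (\<epsilon> a) b)) = f x"
    using counit_left by (simp add: psum_def)
  then show ?thesis
    by (simp add: linmap_psum[OF assms] linmap_scale[OF assms])
qed

lemma comult_counit_right:
  assumes "linmap scale sC f"
  shows "psum (\<Delta> x) (\<lambda>a b. sC (\<epsilon> b) (f a)) = f x"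
proof -
  have "f (psum (\<Delta> x) (\<lambda>a b. scale (\<epsilon> b) a)) = f x"
    using counit_right by (simp add: psum_def)
  then show ?thesis
    by (simp add: linmap_psum[OF assms] linmap_scale[OF assms])
qed

text \<open>Dual description of subcoalgebras, obtained by separating \<open>\<Delta> x\<close> from
  the tensors with both factors in \<open>C\<close>.\<close>

lemma subcoalgebra_iff:
  "subcoalgebra scale \<Delta> C \<longleftrightarrow> subspace C \<and>
     (\<forall>x\<in>C. \<forall>\<phi>. bilinmap scale scale (*) \<phi> \<longrightarrow> (\<forall>a\<in>C. \<forall>b\<in>C. \<phi> a b = 0) \<longrightarrow> psum (\<Delta> x) \<phi> = 0)"
proof (intro iffI conjI ballI allI impI)
  fix x and \<phi> :: "'a \<Rightarrow> 'a \<Rightarrow> 'k"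
  assume C: "subcoalgebra scale \<Delta> C" "x \<in> C" and \<phi>: "bilinmap scale scale (*) \<phi>" "\<forall>a\<in>C. \<forall>b\<in>C. \<phi> a b = 0"
  from C obtain ps where ps: "set ps \<subseteq> C \<times> C" "tensor_eq scale scale (formal_sum (\<Delta> x)) (formal_sum ps)"
    by (auto simp: subcoalgebra_def)
  have "psum (\<Delta> x) \<phi> = psum ps \<phi>"
    using tensor_eqD[OF vector_space_field ps(2) \<phi>(1)] by (simp add: lext2_formal_sum[OF vector_space_field])
  also have "\<dots> = 0"
    using ps(1) \<phi>(2) by (intro psum_zero) auto
  finally show "psum (\<Delta> x) \<phi> = 0" .
next
  assume C: "subspace C \<and>
     (\<forall>x\<in>C. \<forall>\<phi>. bilinmap scale scale (*) \<phi> \<longrightarrow> (\<forall>a\<in>C. \<forall>b\<in>C. \<phi> a b = 0) \<longrightarrow> psum (\<Delta> x) \<phi> = 0)"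
  show "subcoalgebra scale \<Delta> C"
    unfolding subcoalgebra_def
  proof (intro conjI ballI)
    fix x assume "x \<in> C"
    show "\<exists>ps. set ps \<subseteq> C \<times> C \<and> tensor_eq scale scale (formal_sum (\<Delta> x)) (formal_sum ps)"
      by (rule tensor_eq_formal_sumI)
        (use C \<open>x \<in> C\<close> in \<open>auto simp: lext2_formal_sum[OF vector_space_field] subspace_scale\<close>)
  qed (use C in blast)
qed (simp add: subcoalgebra_def)

text \<open>The entries of \<open>\<Delta> x\<close> need not lie in \<open>C\<close>, but those of
  some equivalent list do, and bilinear maps cannot tell the two lists apart.\<close>

lemma subcoalgebra_psum_cong:
  assumes "subcoalgebra scale \<Delta> C" "x \<in> C" "vector_space sC" "bilinmap scale scale sC \<phi>" "bilinmap scale scale sC \<psi>"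
    and "\<And>a b. a \<in> C \<Longrightarrow> b \<in> C \<Longrightarrow> \<phi> a b = \<psi> a b"
  shows "psum (\<Delta> x) \<phi> = psum (\<Delta> x) \<psi>"
proof -
  from assms(1,2) obtain ps
    where ps: "set ps \<subseteq> C \<times> C" "tensor_eq scale scale (formal_sum (\<Delta> x)) (formal_sum ps)"
    by (auto simp: subcoalgebra_def)
  have "psum (\<Delta> x) \<phi> = psum ps \<phi>" "psum (\<Delta> x) \<psi> = psum ps \<psi>"
    using tensor_eqD[OF assms(3) ps(2) assms(4)] tensor_eqD[OF assms(3) ps(2) assms(5)]
    by (simp_all add: lext2_formal_sum[OF assms(3)])
  moreover have "psum ps \<phi> = psum ps \<psi>"
    by (rule psum_cong) (use ps(1) assms(6) in auto)
  ultimately show ?thesis by simp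
qed

end

lemmas (in coalgebra) coalgebra_linmap_intros = vector_space_axioms comult_linmap counit_linmap

lemma (in k_algebra) mult_linmap:
  "linmap s scale g \<Longrightarrow> linmap s scale (\<lambda>x. g x * c)"
  "linmap s scale g \<Longrightarrow> linmap s scale (\<lambda>x. c * g x)"
  by (simp_all add: linmap_def algebra_simps scale_mult_left scale_mult_right)

text \<open>Scaling by \<open>c\<close> is multiplication by the ring element
  \<open>scale c 1\<close>.\<close>

lemma (in k_algebra) subspace_two_sided_ideal: "two_sided_ideal J \<Longrightarrow> subspace J"
proof (rule subspaceI)
  assume J: "two_sided_ideal J"
  then show "0 \<in> J"
    by (simp add: two_sided_ideal_def)
  show "x + y \<in> J" if "x \<in> J" "y \<in> J" for x y
    using J that by (auto simp: two_sided_ideal_def)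
  show "scale c x \<in> J" if "x \<in> J" for c x
  proof -
    have "scale c 1 * x \<in> J"
      using J that by (auto simp: two_sided_ideal_def)
    then show ?thesis by (simp add: scale_mult_left)
  qed
qed

lemma two_sided_ideal_ideal_gen: "two_sided_ideal (ideal_gen UNIV R)"
  unfolding two_sided_ideal_def
proof (intro conjI ballI allI)
  show "a * x \<in> ideal_gen UNIV R" if "x \<in> ideal_gen UNIV R" for a x
    using that
  proof induction
    case (gen c r d)
    then show ?case using ideal_gen.gen[of "a * c" UNIV r R d] by (simp add: mult.assoc)
  qed (auto simp: algebra_simps intro: ideal_gen.intros)
  show "x * a \<in> ideal_gen UNIV R" if "x \<in> ideal_gen UNIV R" for a x
    using that
  proof induction
    case (gen c r d)
    then show ?case using ideal_gen.gen[of c UNIV r R "d * a"] by (simp add: mult.assoc)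
  qed (auto simp: algebra_simps intro: ideal_gen.intros)
qed (auto intro: ideal_gen.intros)

lemma psum_comult3:
  "(\<Sum>(h1, h2, h3)\<leftarrow>comult3 \<Delta> h. F h1 h2 h3) = psum (\<Delta> h) (\<lambda>h1 y. psum (\<Delta> y) (\<lambda>h2 h3. F h1 h2 h3))"
proof -
  have "(\<Sum>(h1, h2, h3)\<leftarrow>concat (map (\<lambda>(h1, y). map (\<lambda>(h2, h3). (h1, h2, h3)) (\<Delta> y)) xs). F h1 h2 h3)
    = psum xs (\<lambda>h1 y. psum (\<Delta> y) (\<lambda>h2 h3. F h1 h2 h3))" for xs
    by (induction xs) (auto simp: psum_def split_def comp_def)
  then show ?thesis by (simp add: comult3_def)
qed

section \<open>Hopf algebras, and the antipode as an anti-homomorphism\<close>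

context hopf_algebra
begin

lemma comult_mult_psum:
  assumes "vector_space sC" "bilinmap scale scale sC \<phi>"
  shows "psum (\<Delta> (x * y)) \<phi> = psum (\<Delta> x) (\<lambda>a b. psum (\<Delta> y) (\<lambda>c d. \<phi> (a * c) (b * d)))"
  using tensor_eqD[OF assms(1) comult_mult[folded psum_def] assms(2)]
  by (simp add: lext_psum[OF assms(1)] lext2_tens[OF assms(1)] lext2_formal_sum[OF assms(1)])

lemma comult_one_psum:
  assumes "vector_space sC" "bilinmap scale scale sC \<phi>"
  shows "psum (\<Delta> 1) \<phi> = \<phi> 1 1"
  using tensor_eqD[OF assms(1) comult_one assms(2)]
  by (simp add: lext2_tens[OF assms(1)] lext2_formal_sum[OF assms(1)])

lemma antipode_linmap: "linmap s scale g \<Longrightarrow> linmap s scale (\<lambda>x. S (g x))"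
  by (rule linmap_compose[OF linear_imp_linmap[OF antipode_linear]])

lemmas hopf_linmap_intros = coalgebra_linmap_intros antipode_linmap mult_linmap

lemma antipode_left_psum: "psum (\<Delta> x) (\<lambda>a b. S a * b) = scale (\<epsilon> x) 1"
  and antipode_right_psum: "psum (\<Delta> x) (\<lambda>a b. a * S b) = scale (\<epsilon> x) 1"
  using antipode_left antipode_right by (simp_all add: psum_def)

text \<open>Both sides are obtained from \<open>S(x\<^sub>1y\<^sub>1)x\<^sub>2y\<^sub>2S(y\<^sub>3)S(x\<^sub>3)\<close> by contracting at the two ends.\<close>

lemma antipode_mult: "S (x * y) = S y * S x"
proof -
  define Z where "Z = psum (\<Delta> x) (\<lambda>x1 x'. psum (\<Delta> y) (\<lambda>y1 y'.
    psum (\<Delta> x') (\<lambda>x2 x3. psum (\<Delta> y') (\<lambda>y2 y3. S (x1 * y1) * (x2 * y2) * (S y3 * S x3)))))"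
  \<comment> \<open>The contraction starts in the middle: \<open>y2 * S y3\<close> becomes a scalar,
    after which \<open>x2\<close> meets \<open>S x3\<close>.\<close>
  have inner: "psum (\<Delta> x') (\<lambda>x2 x3. psum (\<Delta> y') (\<lambda>y2 y3. u * (x2 * y2) * (S y3 * S x3)))
    = scale (\<epsilon> y') (scale (\<epsilon> x') u)" for u x' y'
  proof -
    have "psum (\<Delta> x') (\<lambda>x2 x3. psum (\<Delta> y') (\<lambda>y2 y3. u * (x2 * y2) * (S y3 * S x3)))
      = psum (\<Delta> x') (\<lambda>x2 x3. u * x2 * psum (\<Delta> y') (\<lambda>y2 y3. y2 * S y3) * S x3)"
      by (simp add: psum_mult_left psum_mult_right mult.assoc)
    also have "\<dots> = scale (\<epsilon> y') (u * psum (\<Delta> x') (\<lambda>x2 x3. x2 * S x3))"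
      unfolding antipode_right_psum[of y'] psum_mult_left
      by (subst linmap_psum[where g = "scale (\<epsilon> y')", OF linmap_scale_const[OF vector_space_axioms linmap_id]])
        (simp add: scale_mult_left scale_mult_right mult.assoc)
    finally show ?thesis
      by (simp add: antipode_right_psum scale_mult_right)
  qed
  have "Z = psum (\<Delta> x) (\<lambda>x1 x'. psum (\<Delta> y) (\<lambda>y1 y'. scale (\<epsilon> y') (scale (\<epsilon> x') (S (x1 * y1)))))"
    by (simp add: Z_def inner)
  also have "\<dots> = psum (\<Delta> x) (\<lambda>x1 x'. scale (\<epsilon> x') (S (x1 * y)))"
    by (intro psum_cong comult_counit_right linmap_intros hopf_linmap_intros)
  also have "\<dots> = S (x * y)"
    by (intro comult_counit_right linmap_intros hopf_linmap_intros)
  finally have 1: "Z = S (x * y)" .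
  have "Z = psum (\<Delta> x) (\<lambda>x1 x'. psum (\<Delta> x') (\<lambda>x2 x3. psum (\<Delta> y) (\<lambda>y1 y'.
    psum (\<Delta> y') (\<lambda>y2 y3. S (x1 * y1) * (x2 * y2) * (S y3 * S x3)))))"
    unfolding Z_def by (intro psum_cong psum_swap)
  also have "\<dots> = psum (\<Delta> x) (\<lambda>x' x3. psum (\<Delta> x') (\<lambda>x1 x2. psum (\<Delta> y) (\<lambda>y1 y'.
    psum (\<Delta> y') (\<lambda>y2 y3. S (x1 * y1) * (x2 * y2) * (S y3 * S x3)))))"
    by (intro comult_coassoc[where sC = scale] linmap_intros hopf_linmap_intros)
  also have "\<dots> = psum (\<Delta> x) (\<lambda>x' x3. psum (\<Delta> x') (\<lambda>x1 x2. psum (\<Delta> y) (\<lambda>y' y3.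
    psum (\<Delta> y') (\<lambda>y1 y2. S (x1 * y1) * (x2 * y2) * (S y3 * S x3)))))"
    by (intro psum_cong comult_coassoc[where sC = scale] linmap_intros hopf_linmap_intros)
  also have "\<dots> = psum (\<Delta> x) (\<lambda>x' x3. psum (\<Delta> y) (\<lambda>y' y3. psum (\<Delta> x') (\<lambda>x1 x2.
    psum (\<Delta> y') (\<lambda>y1 y2. S (x1 * y1) * (x2 * y2) * (S y3 * S x3)))))"
    by (intro psum_cong psum_swap)
  \<comment> \<open>The pairs \<open>x1 * y1\<close> and \<open>x2 * y2\<close> are the legs of
    \<open>\<Delta> (x' * y')\<close>, so the antipode axiom can be applied to the product as a
    whole.\<close>
  also have "\<dots> = psum (\<Delta> x) (\<lambda>x' x3. psum (\<Delta> y) (\<lambda>y' y3.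
      psum (\<Delta> (x' * y')) (\<lambda>a b. S a * b * (S y3 * S x3))))"
    by (intro psum_cong comult_mult_psum[where sC = scale, symmetric] linmap_intros hopf_linmap_intros)
  also have "\<dots> = psum (\<Delta> x) (\<lambda>x' x3. psum (\<Delta> y) (\<lambda>y' y3. scale (\<epsilon> y') (scale (\<epsilon> x') (S y3 * S x3))))"
    by (simp add: psum_mult_right[symmetric] antipode_left_psum scale_mult_left counit_mult mult.commute)
  also have "\<dots> = psum (\<Delta> x) (\<lambda>x' x3. scale (\<epsilon> x') (S y * S x3))"
    by (intro psum_cong comult_counit_left linmap_intros hopf_linmap_intros)
  also have "\<dots> = S y * S x"
    by (intro comult_counit_left linmap_intros hopf_linmap_intros)
  finally show ?thesis using 1 by simp
qed

end

lemma hopf_homD: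
  assumes "hopf_hom sA \<Delta>A \<epsilon>A SA sB \<Delta>B \<epsilon>B SB f"
  shows hopf_hom_linmap: "linmap sA sB f" and hopf_hom_one: "f 1 = 1" and hopf_hom_mult: "f (x * y) = f x * f y"
    and hopf_hom_counit: "\<epsilon>B (f x) = \<epsilon>A x" and hopf_hom_antipode: "SB (f x) = f (SA x)"
    and hopf_hom_comult: "vector_space sC \<Longrightarrow> bilinmap sB sB sC \<phi> \<Longrightarrow>
      psum (\<Delta>B (f x)) \<phi> = psum (\<Delta>A x) (\<lambda>a b. \<phi> (f a) (f b))"
proof -
  show "psum (\<Delta>B (f x)) \<phi> = psum (\<Delta>A x) (\<lambda>a b. \<phi> (f a) (f b))"
    if sC: "vector_space sC" and \<phi>: "bilinmap sB sB sC \<phi>"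
  proof -
    have "tensor_eq sB sB (formal_sum (\<Delta>B (f x))) (psum (\<Delta>A x) (\<lambda>x1 x2. tens (f x1) (f x2)))"
      using assms by (auto simp: hopf_hom_def psum_def)
    from tensor_eqD[OF sC this \<phi>] show ?thesis
      by (simp add: lext2_formal_sum[OF sC] lext_psum[OF sC] lext2_tens[OF sC])
  qed
qed (use assms in \<open>auto simp: hopf_hom_def algebra_hom_def linear_imp_linmap\<close>)

section \<open>The coradical and coalgebra filtrations\<close>

lemma (in vector_space) ex_projection:
  assumes "subspace A"
  obtains P where "linmap scale scale P" "range P \<subseteq> A" "\<And>x. x \<in> A \<Longrightarrow> P x = x"
proof -
  interpret p: vector_space_pair scale scale by unfold_locales
  from p.linear_exists_left_inverse_on[OF linear_id assms] obtain P
    where "range P \<subseteq> A" "Vector_Spaces.linear scale scale P" "\<forall>v\<in>A. P (id v) = v"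
    by auto
  then show thesis by (intro that[of P] linear_imp_linmap) auto
qed

text \<open>Let \<open>C\<close> be a complement of \<open>D \<inter> A\<close> in \<open>A\<close>.
  It meets \<open>D\<close> trivially, so the projection \<open>q\<close> along \<open>C\<close> is
  injective on \<open>D\<close>; a left inverse of \<open>q\<close> on \<open>D\<close>, composed
  with \<open>q\<close>, fixes \<open>D\<close> and kills \<open>C\<close>.\<close>

lemma (in vector_space) ex_compatible_projection:
  assumes D: "subspace D" and A: "subspace A"
  obtains P where "linmap scale scale P" "\<And>x. x \<in> D \<Longrightarrow> P x = x" "\<And>x. x \<in> A \<Longrightarrow> P x \<in> D \<inter> A"
proof -
  interpret p: vector_space_pair scale scale by unfold_locales
  obtain Q where Q: "linmap scale scale Q" "range Q \<subseteq> D \<inter> A" "\<And>x. x \<in> D \<inter> A \<Longrightarrow> Q x = x"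
    using ex_projection[OF subspace_inter[OF D A]] by blast
  define C where "C = {x \<in> A. Q x = 0}"
  have C: "subspace C"
    using A by (auto simp: C_def subspace_def linmap_0[OF Q(1)] linmap_add[OF Q(1)] linmap_scale[OF Q(1)])
  obtain R where R: "linmap scale scale R" "range R \<subseteq> C" "\<And>x. x \<in> C \<Longrightarrow> R x = x"
    using ex_projection[OF C] by blast
  define q where "q x = x - R x" for x
  have q: "linmap scale scale q"
    unfolding q_def by (intro linmap_intros R vector_space_axioms)
  have "inj_on q D"
  proof (rule inj_onI)
    fix x y assume xy: "x \<in> D" "y \<in> D" "q x = q y"
    then have "x - y = R (x - y)"
      by (simp add: q_def linmap_diff[OF R(1)] algebra_simps)
    then have "x - y \<in> C"
      using R(2) by (metis rangeI subsetD)
    moreover have "x - y \<in> D"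
      using xy D by (simp add: subspace_diff)
    ultimately show "x = y"
      using Q(3)[of "x - y"] by (simp add: C_def)
  qed
  from p.linear_exists_left_inverse_on[OF linmap_imp_linear[OF vector_space_axioms vector_space_axioms q] D this]
  obtain g where g: "Vector_Spaces.linear scale scale g" "\<And>x. x \<in> D \<Longrightarrow> g (q x) = x"
    by auto
  show thesis
  proof (rule that[of "\<lambda>x. g (q x)"])
    show lin: "linmap scale scale (\<lambda>x. g (q x))"
      by (rule linmap_compose[OF linear_imp_linmap[OF g(1)] q])
    show "g (q x) \<in> D \<inter> A" if "x \<in> A" for x
    proof -
      have "Q x \<in> D \<inter> A"
        using Q(2) by blast
      then have "x - Q x \<in> C"
        using that Q(3) A by (simp add: C_def linmap_diff[OF Q(1)] subspace_diff)
      then have "q (x - Q x) = 0"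
        using R(3) by (simp add: q_def)
      then have "g (q x) = g (q (Q x))"
        by (simp add: linmap_diff[OF q])
      then show ?thesis
        using \<open>Q x \<in> D \<inter> A\<close> g(2) by simp
    qed
  qed (use g in simp)
qed

text \<open>Passing from \<open>\<phi> a b\<close> to \<open>\<phi> (P a) (P b)\<close> changes
  nothing on \<open>C\<close>, where \<open>P\<close> is the identity, while on \<open>D\<close> the
  new form vanishes because \<open>P\<close> maps \<open>D\<close> into the intersection.\<close>

lemma (in coalgebra) subcoalgebra_inter:
  assumes "subcoalgebra scale \<Delta> C" "subcoalgebra scale \<Delta> D"
  shows "subcoalgebra scale \<Delta> (C \<inter> D)"
  unfolding subcoalgebra_iff
proof (intro conjI ballI allI impI)
  have sub: "subspace C" "subspace D"
    using assms by (auto simp: subcoalgebra_def)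
  then show "subspace (C \<inter> D)"
    by (rule subspace_inter)
  obtain P where P: "linmap scale scale P" "\<And>x. x \<in> C \<Longrightarrow> P x = x" "\<And>x. x \<in> D \<Longrightarrow> P x \<in> C \<inter> D"
    using ex_compatible_projection[OF sub] by blast
  fix x and \<phi> :: "'a \<Rightarrow> 'a \<Rightarrow> 'k"
  assume x: "x \<in> C \<inter> D" and \<phi>: "bilinmap scale scale (*) \<phi>" "\<forall>a\<in>C \<inter> D. \<forall>b\<in>C \<inter> D. \<phi> a b = 0"
  have bil: "bilinmap scale scale (*) (\<lambda>a b. \<phi> (P a) (P b))"
    by (intro linmap_intros bilinmap_compose_left[OF \<phi>(1)] bilinmap_compose_right[OF \<phi>(1)] P(1))
  have "psum (\<Delta> x) \<phi> = psum (\<Delta> x) (\<lambda>a b. \<phi> (P a) (P b))"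
    by (rule subcoalgebra_psum_cong[OF assms(1) _ vector_space_field \<phi>(1) bil]) (use x P(2) in auto)
  also have "\<dots> = 0"
    using assms(2) bil x \<phi>(2) P(3) unfolding subcoalgebra_iff by blast
  finally show "psum (\<Delta> x) \<phi> = 0" .
qed

text \<open>
  If a simple subcoalgebra \<open>D\<close> met \<open>A 0\<close> trivially, some functional \<open>e\<close> would vanish on \<open>A 0\<close> and
  agree with the counit on \<open>D\<close>.  For \<open>d \<in> D \<inter> A n\<close> with \<open>n\<close> minimal, \<open>d = e(d\<^sub>2)d\<^sub>1\<close> then lies in
  \<open>A (n - 1)\<close>.
\<close>

lemma (in coalgebra) simple_subcoalgebra_subset_filtration:
  assumes sub: "\<And>n. subspace (A n)" and mono: "\<And>n. A n \<subseteq> A (Suc n)" and exhaust: "\<And>x. \<exists>n. x \<in> A n"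
    and filtration: "\<And>n x \<phi>. x \<in> A n \<Longrightarrow> bilinmap scale scale (*) \<phi> \<Longrightarrow>
      (\<And>i a b. i \<le> n \<Longrightarrow> a \<in> A i \<Longrightarrow> b \<in> A (n - i) \<Longrightarrow> \<phi> a b = 0) \<Longrightarrow> psum (\<Delta> x) \<phi> = 0"
    and simple: "simple_subcoalgebra scale \<Delta> D"
  shows "D \<subseteq> A 0"
proof -
  have D: "subcoalgebra scale \<Delta> D" "subspace D" "D \<noteq> {0}"
    using simple by (auto simp: simple_subcoalgebra_def subcoalgebra_def)
  have A0: "subcoalgebra scale \<Delta> (A 0)"
    unfolding subcoalgebra_iff using sub filtration[of _ 0] by auto
  have "D \<inter> A 0 \<noteq> {0}"
  proof
    assume triv: "D \<inter> A 0 = {0}"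
    obtain d0 where "d0 \<in> D" "d0 \<noteq> 0"
      using D subspace_0 by blast
    then have ex: "\<exists>n. \<exists>d\<in>D \<inter> A n. d \<noteq> 0"
      using exhaust by blast
    define n where "n = (LEAST n. \<exists>d\<in>D \<inter> A n. d \<noteq> 0)"
    obtain d where d: "d \<in> D" "d \<in> A n" "d \<noteq> 0"
      using LeastI_ex[OF ex] by (auto simp: n_def)
    have "n \<noteq> 0"
      using d triv by (metis IntI singletonD)
    then obtain m where m: "n = Suc m"
      using not0_implies_Suc by blast
    have "d \<notin> A m"
      using not_less_Least[of m "\<lambda>n. \<exists>d\<in>D \<inter> A n. d \<noteq> 0"] d m by (auto simp: n_def)
    obtain P where P: "linmap scale scale P" "\<And>x. x \<in> D \<Longrightarrow> P x = x" "\<And>x. x \<in> A 0 \<Longrightarrow> P x \<in> D \<inter> A 0"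
      using ex_compatible_projection[OF D(2) sub[of 0]] by blast
    \<comment> \<open>\<open>P\<close> is the identity on \<open>D\<close> and maps
      \<open>A 0\<close> into \<open>D \<inter> A 0\<close>, which is zero here; this yields both
      properties of \<open>e\<close>.\<close>
    define e where "e x = \<epsilon> (P x)" for x
    have e: "linmap scale (*) e"
      unfolding e_def by (intro counit_linmap P)
    have "span (A m) = A m"
      using sub by simp
    then obtain F where F: "linmap scale (*) F" "\<And>x. x \<in> A m \<Longrightarrow> F x = 0" "F d = 1"
      using ex_separating_functional[of d "A m"] \<open>d \<notin> A m\<close> by metis
    have bil: "bilinmap scale scale (*) (\<lambda>a b. e b * F a)"
      by (intro linmap_intros F e)
    have "F d = psum (\<Delta> d) (\<lambda>a b. \<epsilon> b * F a)"
      by (rule comult_counit_right[OF F(1), symmetric])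
    also have "\<dots> = psum (\<Delta> d) (\<lambda>a b. e b * F a)"
      by (rule subcoalgebra_psum_cong[OF D(1) d(1) vector_space_field _ bil])
        (use P(2) in \<open>auto simp: e_def intro!: linmap_intros F(1) counit_linmap\<close>)
    also have "\<dots> = 0"
    proof (rule filtration[OF d(2) bil])
      fix i a b assume i: "i \<le> n" "a \<in> A i" "b \<in> A (n - i)"
      \<comment> \<open>For \<open>i = n\<close> the right leg lies in \<open>A 0\<close>, where
        \<open>e\<close> vanishes; for \<open>i \<le> m\<close> the left leg lies in
        \<open>A m\<close>, where \<open>F\<close> vanishes.\<close>
      show "e b * F a = 0"
      proof (cases "i = n")
        case True
        then have "P b \<in> {0}"
          using P(3)[of b] i triv by simp
        then show ?thesis
          using linmap_0[OF counit_linmap[OF linmap_id]] by (simp add: e_def)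
      next
        case False
        then have "i \<le> m" using i m by simp
        then have "a \<in> A m"
          using lift_Suc_mono_le[of A i m] mono i(2) by blast
        then show ?thesis using F(2) by simp
      qed
    qed
    finally show False using F(3) by simp
  qed
  then have "D \<inter> A 0 = D"
    using subcoalgebra_inter[OF D(1) A0] simple unfolding simple_subcoalgebra_def by blast
  then show ?thesis by blast
qed

text \<open>Forms pull back along \<open>f\<close> in one direction and along the left inverse
  \<open>g\<close> in the other, so subcoalgebras of the source correspond to those inside the image
  of \<open>f\<close>; linearity of \<open>g\<close> is enough. The last assumption places every
  simple subcoalgebra inside that image.\<close>

lemma coradical_image:
  assumes "coalgebra sA \<Delta>A \<epsilon>A" "coalgebra sB \<Delta>B \<epsilon>B"
    and f: "linmap sA sB f" and g: "linmap sB sA g" "\<And>x. g (f x) = x"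
    and comult: "\<And>\<phi> x. bilinmap sB sB (*) \<phi> \<Longrightarrow> psum (\<Delta>B (f x)) \<phi> = psum (\<Delta>A x) (\<lambda>a b. \<phi> (f a) (f b))"
    and range: "\<And>D. simple_subcoalgebra sB \<Delta>B D \<Longrightarrow> D \<subseteq> range f"
  shows "coradical sB \<Delta>B = f ` coradical sA \<Delta>A"
proof -
  interpret A: coalgebra sA \<Delta>A \<epsilon>A by fact
  interpret B: coalgebra sB \<Delta>B \<epsilon>B by fact
  interpret f: module_hom sA sB f
    using linmap_imp_linear[OF A.vector_space_axioms B.vector_space_axioms f] by (simp add: linear_iff_module_hom)
  have inj: "inj f"
    using g(2) by (rule inj_on_inverseI)
  have sub_iff: "subcoalgebra sB \<Delta>B (f ` C) \<longleftrightarrow> subcoalgebra sA \<Delta>A C" for C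
  proof -
    have "A.subspace C \<longleftrightarrow> B.subspace (f ` C)"
      using f.subspace_image[of C] f.subspace_vimage[of "f ` C"] inj by (auto simp: inj_vimage_image_eq)
    moreover have "psum (\<Delta>A x) \<phi> = 0"
      if "subcoalgebra sB \<Delta>B (f ` C)" "x \<in> C" "bilinmap sA sA (*) \<phi>" "\<forall>a\<in>C. \<forall>b\<in>C. \<phi> a b = 0" for x \<phi>
    proof -
      have bil: "bilinmap sB sB (*) (\<lambda>a b. \<phi> (g a) (g b))"
        by (intro linmap_intros bilinmap_compose_left[OF that(3)] bilinmap_compose_right[OF that(3)] g(1))
      have "psum (\<Delta>A x) \<phi> = psum (\<Delta>B (f x)) (\<lambda>a b. \<phi> (g a) (g b))"
        by (simp add: comult[OF bil] g(2))
      also have "\<dots> = 0"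
        using that bil unfolding B.subcoalgebra_iff by (auto simp: g(2))
      finally show ?thesis .
    qed
    moreover have "psum (\<Delta>B (f x)) \<phi> = 0"
      if "subcoalgebra sA \<Delta>A C" "x \<in> C" "bilinmap sB sB (*) \<phi>" "\<forall>a\<in>f ` C. \<forall>b\<in>f ` C. \<phi> a b = 0" for x \<phi>
    proof -
      have bil: "bilinmap sA sA (*) (\<lambda>a b. \<phi> (f a) (f b))"
        by (intro linmap_intros bilinmap_compose_left[OF that(3)] bilinmap_compose_right[OF that(3)] f)
      show ?thesis
        using that bil unfolding A.subcoalgebra_iff by (simp add: comult)
    qed
    ultimately show ?thesis
      unfolding A.subcoalgebra_iff[of C] B.subcoalgebra_iff[of "f ` C"]
      by (auto simp: A.subcoalgebra_iff B.subcoalgebra_iff)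
  qed
  have zero: "f ` C = {0} \<longleftrightarrow> C = {0}" for C
    using inj linmap_0[OF f] by (metis image_empty image_insert inj_image_eq_iff)
  have simple_iff: "simple_subcoalgebra sB \<Delta>B (f ` C) \<longleftrightarrow> simple_subcoalgebra sA \<Delta>A C" for C
  proof -
    have "(\<forall>D. subcoalgebra sB \<Delta>B D \<and> D \<subseteq> f ` C \<longrightarrow> D = {0} \<or> D = f ` C) \<longleftrightarrow>
      (\<forall>D. subcoalgebra sA \<Delta>A D \<and> D \<subseteq> C \<longrightarrow> D = {0} \<or> D = C)"
      (is "?L \<longleftrightarrow> ?R")
    proof
      assume L: ?L
      show ?R
      proof (intro allI impI)
        fix D assume "subcoalgebra sA \<Delta>A D \<and> D \<subseteq> C"
        then have "f ` D = {0} \<or> f ` D = f ` C"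
          using L sub_iff[of D] by (meson image_mono)
        then show "D = {0} \<or> D = C"
          using zero[of D] inj_image_eq_iff[OF inj, of D C] by simp
      qed
    next
      assume R: ?R
      show ?L
      proof (intro allI impI)
        fix D assume D: "subcoalgebra sB \<Delta>B D \<and> D \<subseteq> f ` C"
        then obtain E where E: "E \<subseteq> C" "D = f ` E"
          by (auto elim!: subset_imageE)
        then have "E = {0} \<or> E = C"
          using R D sub_iff[of E] by simp
        then show "D = {0} \<or> D = f ` C"
          using zero[of E] E(2) by auto
      qed
    qed
    then show ?thesis
      by (simp add: simple_subcoalgebra_def sub_iff zero)
  qed
  have "\<Union>{C. simple_subcoalgebra sB \<Delta>B C} = f ` \<Union>{C. simple_subcoalgebra sA \<Delta>A C}"
  proof (intro equalityI subsetI)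
    fix y assume "y \<in> \<Union>{C. simple_subcoalgebra sB \<Delta>B C}"
    then obtain D where D: "simple_subcoalgebra sB \<Delta>B D" "y \<in> D" by blast
    then obtain C where C: "D = f ` C"
      using range[OF D(1)] by (meson subset_imageE)
    then have "simple_subcoalgebra sA \<Delta>A C"
      using D(1) simple_iff[of C] by simp
    then show "y \<in> f ` \<Union>{C. simple_subcoalgebra sA \<Delta>A C}"
      using D(2) C by auto
  next
    fix y assume "y \<in> f ` \<Union>{C. simple_subcoalgebra sA \<Delta>A C}"
    then obtain C where C: "simple_subcoalgebra sA \<Delta>A C" "y \<in> f ` C"
      by auto
    then show "y \<in> \<Union>{C. simple_subcoalgebra sB \<Delta>B C}"
      using simple_iff[of C] by auto
  qed
  then show ?thesis
    by (simp add: coradical_def f.span_image)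
qed

lemma tensor_eq_iff:
  "tensor_eq sA sB u v \<longleftrightarrow> (\<forall>\<phi>. bilinmap sA sB (*) \<phi> \<longrightarrow> lext2 (*) \<phi> u = lext2 (*) \<phi> v)"
  using tensor_eqI[of sA sB u v] tensor_eqD[OF vector_space_field, of sA sB u v] by blast

lemma
  assumes "trilinmap sA sB sC sD \<psi>"
  shows trilinmap_3: "linmap s sC f \<Longrightarrow> linmap s sD (\<lambda>x. \<psi> a b (f x))"
    and trilinmap_2: "linmap s sB g \<Longrightarrow> linmap s sD (\<lambda>x. \<psi> a (g x) c)"
    and trilinmap_1: "linmap s sA h \<Longrightarrow> linmap s sD (\<lambda>x. \<psi> (h x) b c)"
  using assms by (simp_all add: trilinmap_def bilinmap_def linmap_def)

section \<open>Quotients by Hopf ideals\<close>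

lemma hopf_ideal_psum_eq_0:
  assumes "hopf_ideal s \<Delta> \<epsilon> S J" "x \<in> J" "vector_space sC" "bilinmap s s sC \<phi>"
    and "\<And>a b. a \<in> J \<or> b \<in> J \<Longrightarrow> \<phi> a b = 0"
  shows "psum (\<Delta> x) \<phi> = 0"
proof -
  obtain ps where ps: "set ps \<subseteq> J \<times> UNIV \<union> UNIV \<times> J" "tensor_eq s s (formal_sum (\<Delta> x)) (formal_sum ps)"
    using assms(1,2) unfolding hopf_ideal_def by blast
  have "psum (\<Delta> x) \<phi> = psum ps \<phi>"
    using tensor_eqD[OF assms(3) ps(2) assms(4)] by (simp add: lext2_formal_sum[OF assms(3)])
  also have "\<dots> = 0"
    by (rule psum_zero) (use ps(1) assms(5) in auto)
  finally show ?thesis .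
qed

text \<open>The operations are computed on the representative \<open>inv p q\<close>. As
  \<open>inv p (p x) - x\<close> lies in \<open>J\<close>, their values at \<open>p x\<close> are
  those of \<open>T\<close> at \<open>x\<close> pushed through \<open>p\<close>, and each axiom
  follows from the one in \<open>T\<close> once its arguments are written as images.\<close>

lemma hopf_algebra_quotient:
  fixes sT :: "'k::field \<Rightarrow> 't::ring_1 \<Rightarrow> 't" and sQ :: "'k \<Rightarrow> 'q::ring_1 \<Rightarrow> 'q"
  assumes "hopf_algebra sT \<Delta>T \<epsilon>T ST" and J: "hopf_ideal sT \<Delta>T \<epsilon>T ST J"
    and quot: "is_quotient_algebra sT J sQ p"
  obtains \<Delta>Q \<epsilon>Q SQ
  where "hopf_algebra sQ \<Delta>Q \<epsilon>Q SQ" "hopf_hom sT \<Delta>T \<epsilon>T ST sQ \<Delta>Q \<epsilon>Q SQ p"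
proof -
  interpret T: hopf_algebra sT \<Delta>T \<epsilon>T ST by fact
  interpret Q: k_algebra sQ using quot by (simp add: is_quotient_algebra_def)
  have p: "linmap sT sQ p" "p 1 = 1" "p (x * y) = p x * p y" for x y
    using quot by (auto simp: is_quotient_algebra_def algebra_hom_def linear_imp_linmap)
  have surj: "surj p" and ker: "p x = 0 \<longleftrightarrow> x \<in> J" for x
    using quot by (auto simp: is_quotient_algebra_def)
  define \<Delta>Q where "\<Delta>Q q = map (\<lambda>(a, b). (p a, p b)) (\<Delta>T (inv p q))" for q
  define \<epsilon>Q where "\<epsilon>Q q = \<epsilon>T (inv p q)" for q
  define SQ where "SQ q = p (ST (inv p q))" for q
  have inv_mem: "inv p (p x) - x \<in> J" for x
    using surj by (simp add: ker[symmetric] linmap_diff[OF p(1)] surj_f_inv_f)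
  have \<epsilon>Q: "\<epsilon>Q (p x) = \<epsilon>T x" for x
    using J inv_mem[of x] linmap_diff[OF T.counit_linmap[OF linmap_id], of "inv p (p x)" x]
    by (auto simp: hopf_ideal_def \<epsilon>Q_def)
  have SQ: "SQ (p x) = p (ST x)" for x
  proof -
    have "p (ST (inv p (p x) - x)) = 0"
      using J inv_mem[of x] unfolding ker hopf_ideal_def by blast
    then show ?thesis
      by (simp add: SQ_def linmap_diff[OF p(1)] linmap_diff[OF T.antipode_linmap[OF linmap_id]])
  qed
  have p_bil: "bilinmap sT sT sC (\<lambda>a b. \<phi> (p a) (p b))" if "bilinmap sQ sQ sC \<phi>" for sC :: "'k \<Rightarrow> 'c::ab_group_add \<Rightarrow> 'c" and \<phi>
    by (intro linmap_intros bilinmap_compose_left[OF that] bilinmap_compose_right[OF that] p(1))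
  have \<Delta>Q: "psum (\<Delta>Q (p x)) \<phi> = psum (\<Delta>T x) (\<lambda>a b. \<phi> (p a) (p b))"
    if sC: "vector_space sC" and \<phi>: "bilinmap sQ sQ sC \<phi>" for sC :: "'k \<Rightarrow> 'c::ab_group_add \<Rightarrow> 'c" and \<phi> x
  proof -
    have "psum (\<Delta>T (inv p (p x) - x)) (\<lambda>a b. \<phi> (p a) (p b)) = 0"
      by (rule hopf_ideal_psum_eq_0[OF J inv_mem sC p_bil[OF \<phi>]])
        (auto simp: ker[symmetric] linmap_0[OF bilinmap_left[OF \<phi>]] linmap_0[OF bilinmap_right[OF \<phi>]])
    then show ?thesis
      by (simp add: \<Delta>Q_def psum_map linmap_diff[OF T.comult_linmap[OF sC p_bil[OF \<phi>] linmap_id]])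
  qed
  have p_ex: "\<exists>x. q = p x" for q
    using surj by blast
  have \<Delta>Q_lin: "linmap sQ sC (\<lambda>q. psum (\<Delta>Q q) \<phi>)"
    if sC: "vector_space sC" and \<phi>: "bilinmap sQ sQ sC \<phi>" for sC :: "'k \<Rightarrow> 'c::ab_group_add \<Rightarrow> 'c" and \<phi>
  proof (rule linmapI)
    note lin = T.comult_linmap[OF sC p_bil[OF \<phi>] linmap_id]
    show "psum (\<Delta>Q (x + y)) \<phi> = psum (\<Delta>Q x) \<phi> + psum (\<Delta>Q y) \<phi>" for x y
      using p_ex[of x] p_ex[of y]
      by (auto simp: linmap_add[OF p(1), symmetric] \<Delta>Q[OF that] linmap_add[OF lin])
    show "psum (\<Delta>Q (sQ c x)) \<phi> = sC c (psum (\<Delta>Q x) \<phi>)" for c x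
      using p_ex[of x]
      by (auto simp: linmap_scale[OF p(1), symmetric] \<Delta>Q[OF that] linmap_scale[OF lin])
  qed
  have \<epsilon>Q_lin: "linmap sQ (*) \<epsilon>Q"
  proof (rule linmapI)
    show "\<epsilon>Q (x + y) = \<epsilon>Q x + \<epsilon>Q y" for x y
      using p_ex[of x] p_ex[of y]
      by (auto simp: linmap_add[OF p(1), symmetric] \<epsilon>Q linmap_add[OF T.counit_linmap[OF linmap_id]])
    show "\<epsilon>Q (sQ c x) = c * \<epsilon>Q x" for c x
      using p_ex[of x]
      by (auto simp: linmap_scale[OF p(1), symmetric] \<epsilon>Q linmap_scale[OF T.counit_linmap[OF linmap_id]])
  qed
  have SQ_lin: "linmap sQ sQ SQ"
  proof (rule linmapI)
    show "SQ (x + y) = SQ x + SQ y" for x y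
      using p_ex[of x] p_ex[of y]
      by (auto simp: linmap_add[OF p(1), symmetric] SQ linmap_add[OF T.antipode_linmap[OF linmap_id]])
    show "SQ (sQ c x) = sQ c (SQ x)" for c x
      using p_ex[of x]
      by (auto simp: linmap_scale[OF p(1), symmetric] SQ linmap_scale[OF T.antipode_linmap[OF linmap_id]])
  qed
  note vs = vector_space_field Q.vector_space_axioms T.vector_space_axioms
  note ev = lext_add[OF vector_space_field] lext_fscale[OF vector_space_field]
    lext_psum[OF vector_space_field] lext2_tens[OF vector_space_field]
    lext3_tens3[OF vector_space_field] lext2_formal_sum[OF vector_space_field]
  have "hopf_algebra sQ \<Delta>Q \<epsilon>Q SQ"
  proof (intro hopf_algebra.intro coalgebra.intro coalgebra_axioms.intro hopf_algebra_axioms.intro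
      Q.k_algebra_axioms Q.vector_space_axioms)
    fix x y c
    obtain u v where uv: "x = p u" "y = p v"
      using p_ex by blast
    show "tensor_eq sQ sQ (formal_sum (\<Delta>Q (x + y))) (formal_sum (\<Delta>Q x) + formal_sum (\<Delta>Q y))"
      by (rule tensor_eqI) (simp add: ev linmap_add[OF \<Delta>Q_lin[OF vector_space_field]])
    show "tensor_eq sQ sQ (formal_sum (\<Delta>Q (sQ c x))) (fscale c (formal_sum (\<Delta>Q x)))"
      by (rule tensor_eqI) (simp add: ev linmap_scale[OF \<Delta>Q_lin[OF vector_space_field]])
    show "Vector_Spaces.linear sQ (*) \<epsilon>Q" "Vector_Spaces.linear sQ sQ SQ"
      by (intro linmap_imp_linear vs \<epsilon>Q_lin SQ_lin)+
    show "tensor3_eq sQ sQ sQ (\<Sum>(x1, y)\<leftarrow>\<Delta>Q x. \<Sum>(x2, x3)\<leftarrow>\<Delta>Q y. tens3 x1 x2 x3)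
        (\<Sum>(y, x3)\<leftarrow>\<Delta>Q x. \<Sum>(x1, x2)\<leftarrow>\<Delta>Q y. tens3 x1 x2 x3)"
    proof (fold psum_def, rule tensor3_eqI, unfold ev)
      fix \<psi> :: "'q \<Rightarrow> 'q \<Rightarrow> 'q \<Rightarrow> 'k" assume \<psi>: "trilinmap sQ sQ sQ (*) \<psi>"
      note lin = trilinmap_1[OF \<psi>] trilinmap_2[OF \<psi>] trilinmap_3[OF \<psi>]
      have "psum (\<Delta>Q x) (\<lambda>a y. psum (\<Delta>Q y) (\<lambda>b c. \<psi> a b c))
        = psum (\<Delta>T u) (\<lambda>a y. psum (\<Delta>Q (p y)) (\<lambda>b c. \<psi> (p a) b c))"
        unfolding uv by (intro \<Delta>Q[of "(*)"] vs linmap_intros lin \<Delta>Q_lin)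
      also have "\<dots> = psum (\<Delta>T u) (\<lambda>a y. psum (\<Delta>T y) (\<lambda>b c. \<psi> (p a) (p b) (p c)))"
        by (intro psum_cong \<Delta>Q[of "(*)"] vs linmap_intros lin \<Delta>Q_lin)
      also have "\<dots> = psum (\<Delta>T u) (\<lambda>y c. psum (\<Delta>T y) (\<lambda>a b. \<psi> (p a) (p b) (p c)))"
        by (intro T.comult_coassoc[where sC = "(*)"] vs linmap_intros lin p)
      also have "\<dots> = psum (\<Delta>T u) (\<lambda>y c. psum (\<Delta>Q (p y)) (\<lambda>a b. \<psi> a b (p c)))"
        by (intro psum_cong \<Delta>Q[of "(*)", symmetric] vs linmap_intros lin \<Delta>Q_lin)
      also have "\<dots> = psum (\<Delta>Q x) (\<lambda>y c. psum (\<Delta>Q y) (\<lambda>a b. \<psi> a b c))"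
        unfolding uv by (intro \<Delta>Q[of "(*)", symmetric] vs linmap_intros lin \<Delta>Q_lin)
      finally show "psum (\<Delta>Q x) (\<lambda>a y. psum (\<Delta>Q y) (\<lambda>b c. \<psi> a b c))
        = psum (\<Delta>Q x) (\<lambda>y c. psum (\<Delta>Q y) (\<lambda>a b. \<psi> a b c))" .
    qed
    have "psum (\<Delta>Q x) (\<lambda>a b. sQ (\<epsilon>Q a) b) = psum (\<Delta>T u) (\<lambda>a b. sQ (\<epsilon>Q (p a)) (p b))"
      unfolding uv by (intro \<Delta>Q[of sQ] vs linmap_intros \<epsilon>Q_lin)
    then show "(\<Sum>(x1, x2)\<leftarrow>\<Delta>Q x. sQ (\<epsilon>Q x1) x2) = x"
      by (simp add: psum_def[symmetric] \<epsilon>Q T.comult_counit_left[OF p(1)] uv)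
    have "psum (\<Delta>Q x) (\<lambda>a b. sQ (\<epsilon>Q b) a) = psum (\<Delta>T u) (\<lambda>a b. sQ (\<epsilon>Q (p b)) (p a))"
      unfolding uv by (intro \<Delta>Q[of sQ] vs linmap_intros \<epsilon>Q_lin)
    then show "(\<Sum>(x1, x2)\<leftarrow>\<Delta>Q x. sQ (\<epsilon>Q x2) x1) = x"
      by (simp add: psum_def[symmetric] \<epsilon>Q T.comult_counit_right[OF p(1)] uv)
    show "tensor_eq sQ sQ (formal_sum (\<Delta>Q (x * y)))
         (\<Sum>(x1, x2)\<leftarrow>\<Delta>Q x. \<Sum>(y1, y2)\<leftarrow>\<Delta>Q y. tens (x1 * y1) (x2 * y2))"
    proof (fold psum_def, rule tensor_eqI, unfold ev)
      fix \<phi> :: "'q \<Rightarrow> 'q \<Rightarrow> 'k" assume \<phi>: "bilinmap sQ sQ (*) \<phi>"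
      note lin = bilinmap_compose_left[OF \<phi>] bilinmap_compose_right[OF \<phi>] Q.mult_linmap
      have "psum (\<Delta>Q (x * y)) \<phi> = psum (\<Delta>T u) (\<lambda>a b. psum (\<Delta>T v) (\<lambda>c d. \<phi> (p a * p c) (p b * p d)))"
        by (simp add: uv p(3)[symmetric] \<Delta>Q[OF vector_space_field \<phi>]
            T.comult_mult_psum[OF vector_space_field p_bil[OF \<phi>]])
      also have "\<dots> = psum (\<Delta>T u) (\<lambda>a b. psum (\<Delta>Q y) (\<lambda>c d. \<phi> (p a * c) (p b * d)))"
        unfolding uv by (intro psum_cong \<Delta>Q[of "(*)", symmetric] vs linmap_intros lin)
      also have "\<dots> = psum (\<Delta>Q x) (\<lambda>a b. psum (\<Delta>Q y) (\<lambda>c d. \<phi> (a * c) (b * d)))"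
        unfolding uv(1) by (intro \<Delta>Q[of "(*)", symmetric] vs linmap_intros lin)
      finally show "psum (\<Delta>Q (x * y)) \<phi> = psum (\<Delta>Q x) (\<lambda>a b. psum (\<Delta>Q y) (\<lambda>c d. \<phi> (a * c) (b * d)))" .
    qed
    show "tensor_eq sQ sQ (formal_sum (\<Delta>Q 1)) (tens 1 1)"
    proof (rule tensor_eqI, unfold ev)
      show "psum (\<Delta>Q 1) \<phi> = \<phi> 1 1" if "bilinmap sQ sQ (*) \<phi>" for \<phi> :: "'q \<Rightarrow> 'q \<Rightarrow> 'k"
        using \<Delta>Q[OF vector_space_field that, of 1] T.comult_one_psum[OF vector_space_field p_bil[OF that]]
        by (simp add: p(2))
    qed
    show "\<epsilon>Q (x * y) = \<epsilon>Q x * \<epsilon>Q y" "\<epsilon>Q 1 = 1"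
      using \<epsilon>Q[of 1] by (simp_all add: uv p(3)[symmetric] \<epsilon>Q T.counit_mult p(2) T.counit_one)
    have "psum (\<Delta>Q x) (\<lambda>a b. SQ a * b) = psum (\<Delta>T u) (\<lambda>a b. SQ (p a) * p b)"
      unfolding uv by (intro \<Delta>Q[of sQ] vs linmap_intros Q.mult_linmap SQ_lin)
    also have "\<dots> = p (psum (\<Delta>T u) (\<lambda>a b. ST a * b))"
      by (simp add: SQ p(3)[symmetric] linmap_psum[OF p(1)])
    finally show "(\<Sum>(x1, x2)\<leftarrow>\<Delta>Q x. SQ x1 * x2) = sQ (\<epsilon>Q x) 1"
      by (simp add: psum_def[symmetric] T.antipode_left_psum linmap_scale[OF p(1)] p(2) uv \<epsilon>Q)
    have "psum (\<Delta>Q x) (\<lambda>a b. a * SQ b) = psum (\<Delta>T u) (\<lambda>a b. p a * SQ (p b))"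
      unfolding uv by (intro \<Delta>Q[of sQ] vs linmap_intros Q.mult_linmap SQ_lin)
    also have "\<dots> = p (psum (\<Delta>T u) (\<lambda>a b. a * ST b))"
      by (simp add: SQ p(3)[symmetric] linmap_psum[OF p(1)])
    finally show "(\<Sum>(x1, x2)\<leftarrow>\<Delta>Q x. x1 * SQ x2) = sQ (\<epsilon>Q x) 1"
      by (simp add: psum_def[symmetric] T.antipode_right_psum linmap_scale[OF p(1)] p(2) uv \<epsilon>Q)
  qed
  moreover have "hopf_hom sT \<Delta>T \<epsilon>T ST sQ \<Delta>Q \<epsilon>Q SQ p"
    unfolding hopf_hom_def
  proof (intro conjI allI)
    show "algebra_hom sT sQ p"
      using quot by (simp add: is_quotient_algebra_def)
    show "tensor_eq sQ sQ (formal_sum (\<Delta>Q (p x))) (\<Sum>(x1, x2)\<leftarrow>\<Delta>T x. tens (p x1) (p x2))" for x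
      by (fold psum_def, rule tensor_eqI) (simp add: ev \<Delta>Q[OF vector_space_field])
  qed (simp_all add: \<epsilon>Q SQ)
  ultimately show thesis ..
qed

lemma hopf_hom_compose:
  assumes "vector_space sC" and f: "hopf_hom sA \<Delta>A \<epsilon>A SA sB \<Delta>B \<epsilon>B SB f"
    and g: "hopf_hom sB \<Delta>B \<epsilon>B SB sC \<Delta>C \<epsilon>C SC g"
  shows "hopf_hom sA \<Delta>A \<epsilon>A SA sC \<Delta>C \<epsilon>C SC (g \<circ> f)"
  unfolding hopf_hom_def algebra_hom_def
proof (intro conjI allI)
  show "Vector_Spaces.linear sA sC (g \<circ> f)"
    using f g by (auto simp: hopf_hom_def algebra_hom_def intro: Vector_Spaces.linear_compose)
  show "tensor_eq sC sC (formal_sum (\<Delta>C ((g \<circ> f) x))) (\<Sum>(x1, x2)\<leftarrow>\<Delta>A x. tens ((g \<circ> f) x1) ((g \<circ> f) x2))" for x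
  proof (fold psum_def, rule tensor_eqI)
    fix \<phi> assume \<phi>: "bilinmap sC sC (*) \<phi>"
    have bil: "bilinmap sB sB (*) (\<lambda>a b. \<phi> (g a) (g b))"
      by (intro linmap_intros bilinmap_compose_left[OF \<phi>] bilinmap_compose_right[OF \<phi>] hopf_hom_linmap[OF g])
    show "lext2 (*) \<phi> (formal_sum (\<Delta>C ((g \<circ> f) x)))
      = lext2 (*) \<phi> (psum (\<Delta>A x) (\<lambda>x1 x2. tens ((g \<circ> f) x1) ((g \<circ> f) x2)))"
      by (simp add: lext2_formal_sum[OF vector_space_field] lext_psum[OF vector_space_field]
          lext2_tens[OF vector_space_field] hopf_hom_comult[OF g vector_space_field \<phi>]
          hopf_hom_comult[OF f vector_space_field bil])
  qed
qed (simp_all add: hopf_homD[OF f] hopf_homD[OF g])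

section \<open>The setting of the theorem\<close>

locale hopf_extension =
  fixes sH :: "'k::field \<Rightarrow> 'h::ring_1 \<Rightarrow> 'h"
    and \<Delta> :: "'h \<Rightarrow> ('h \<times> 'h) list" and \<epsilon> :: "'h \<Rightarrow> 'k" and S :: "'h \<Rightarrow> 'h"
    and sV :: "'k \<Rightarrow> 'v::ab_group_add \<Rightarrow> 'v"
    and actV :: "'h \<Rightarrow> 'v \<Rightarrow> 'v" and \<delta> :: "'v \<Rightarrow> ('h \<times> 'v) list"
    and sM :: "'k \<Rightarrow> 'm::ab_group_add \<Rightarrow> 'm" and actM :: "'h \<Rightarrow> 'm \<Rightarrow> 'm"
    and \<iota> :: "'h \<Rightarrow> 'm" and \<pi> :: "'m \<Rightarrow> 'v"
    and X :: "'m set" and B :: "'h set"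
    and sT :: "'k \<Rightarrow> 't::ring_1 \<Rightarrow> 't" and j :: "'m \<Rightarrow> 't"
    and \<Delta>T :: "'t \<Rightarrow> ('t \<times> 't) list" and \<epsilon>T :: "'t \<Rightarrow> 'k" and ST :: "'t \<Rightarrow> 't"
  assumes H_hopf: "hopf_algebra sH \<Delta> \<epsilon> S"
    and V_yetter_drinfeld: "yetter_drinfeld sH \<Delta> \<epsilon> S sV actV \<delta>"
    and M_extension: "module_extension sH \<Delta> \<epsilon> S sV actV sM actM \<iota> \<pi>"
    and X_complement: "complement_basis sM \<iota> X"
    and B_basis: "is_basis sH B"
    and T_presented: "is_TH sH sM \<iota> X B sT j"
    and T_structure: "TH_hopf_structure sH \<Delta> \<epsilon> S \<delta> sM \<iota> \<pi> X sT j \<Delta>T \<epsilon>T ST"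
begin

sublocale H: hopf_algebra sH \<Delta> \<epsilon> S by (rule H_hopf)
sublocale T: hopf_algebra sT \<Delta>T \<epsilon>T ST using T_structure by (simp add: TH_hopf_structure_def)
sublocale M: vector_space sM using M_extension by (simp add: module_extension_def algebra_module_def)
sublocale YD: yetter_drinfeld sH \<Delta> \<epsilon> S sV actV \<delta> by (rule V_yetter_drinfeld)
sublocale E: module_extension sH \<Delta> \<epsilon> S sV actV sM actM \<iota> \<pi> by (rule M_extension)

abbreviation KX :: "'m set" where "KX \<equiv> module.span sM X"

definition f :: "'h \<Rightarrow> 't" where "f h = j (\<iota> h)"

lemma f_hopf_hom: "hopf_hom sH \<Delta> \<epsilon> S sT \<Delta>T \<epsilon>T ST f"
proof -
  have "f = j \<circ> \<iota>" by (simp add: fun_eq_iff f_def)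
  then show ?thesis using T_structure by (simp add: TH_hopf_structure_def hopf_embedding_def)
qed

lemma sM_vector_space: "vector_space sM" and sV_vector_space: "vector_space sV"
  by unfold_locales

lemmas vector_spaces = vector_space_field H.vector_space_axioms T.vector_space_axioms
  sM_vector_space sV_vector_space

lemma iota_linmap: "linmap s sH g \<Longrightarrow> linmap s sM (\<lambda>x. \<iota> (g x))"
  by (rule linmap_compose[OF linear_imp_linmap[OF E.\<iota>_linear]])

lemma pi_linmap: "linmap s sM g \<Longrightarrow> linmap s sV (\<lambda>x. \<pi> (g x))"
  by (rule linmap_compose[OF linear_imp_linmap[OF E.\<pi>_linear]])

lemma j_linmap: "linmap s sM g \<Longrightarrow> linmap s sT (\<lambda>x. j (g x))"
  by (rule linmap_compose[OF linear_imp_linmap]) (use T_presented in \<open>auto simp: is_TH_def\<close>)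

lemma f_linmap: "linmap s sH g \<Longrightarrow> linmap s sT (\<lambda>x. f (g x))"
  by (rule linmap_compose[OF hopf_hom_linmap[OF f_hopf_hom]])

lemma actM_linmap_left: "linmap s sH g \<Longrightarrow> linmap s sM (\<lambda>x. actM (g x) m)"
  by (rule linmap_compose[OF linear_imp_linmap[OF E.M.act_linear_left]])

lemma actM_linmap_right: "linmap s sM g \<Longrightarrow> linmap s sM (\<lambda>x. actM h (g x))"
  by (rule linmap_compose[OF linear_imp_linmap[OF E.M.act_linear_right]])

lemma pi_iota [simp]: "\<pi> (\<iota> h) = 0"
  using E.exact by blast

section \<open>The splitting of the extension along \<open>KX\<close> and \<open>H\<close>\<close>

definition P :: "'m \<Rightarrow> 'h" where "P m = (SOME h. m - \<iota> h \<in> KX)"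

definition R :: "'m \<Rightarrow> 'm" where "R m = m - \<iota> (P m)"

lemma R_in_KX: "R m \<in> KX"
proof -
  obtain x h where "x \<in> KX" "m = x + \<iota> h"
    using X_complement unfolding complement_basis_def by blast
  then have "\<exists>h. m - \<iota> h \<in> KX"
    by (intro exI[of _ h]) simp
  then show ?thesis
    unfolding P_def R_def by (rule someI_ex)
qed

lemma P_unique:
  assumes "m - \<iota> h \<in> KX"
  shows "P m = h"
proof -
  have "(m - \<iota> h) - R m \<in> KX"
    using assms R_in_KX by (rule M.span_diff)
  moreover have "(m - \<iota> h) - R m = \<iota> (P m - h)"
    by (simp add: R_def linmap_diff[OF iota_linmap[OF linmap_id]])
  ultimately have "\<iota> (P m - h) = 0"
    using X_complement by (auto simp: complement_basis_def)
  then have "\<iota> (P m - h) = \<iota> 0"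
    by (simp add: linmap_0[OF iota_linmap[OF linmap_id]])
  then show ?thesis
    using E.\<iota>_inj by (simp add: inj_eq)
qed

lemma P_iota [simp]: "P (\<iota> h) = h"
  by (rule P_unique) (simp add: M.span_zero)

lemma P_KX: "x \<in> KX \<Longrightarrow> P x = 0"
  by (rule P_unique) (simp add: linmap_0[OF iota_linmap[OF linmap_id]])

lemma R_KX: "x \<in> KX \<Longrightarrow> R x = x"
  by (simp add: R_def P_KX linmap_0[OF iota_linmap[OF linmap_id]])

lemma P_linmap: "linmap s sM g \<Longrightarrow> linmap s sH (\<lambda>x. P (g x))"
proof (rule linmap_compose[of sM sH P], rule linmapI)
  note iota = linmap_add[OF iota_linmap[OF linmap_id]] linmap_scale[OF iota_linmap[OF linmap_id]]
  show "P (x + y) = P x + P y" for x y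
  proof (rule P_unique)
    have "x + y - \<iota> (P x + P y) = R x + R y"
      by (simp add: R_def iota)
    then show "x + y - \<iota> (P x + P y) \<in> KX"
      by (simp add: R_in_KX M.span_add)
  qed
  show "P (sM c x) = sH c (P x)" for c x
  proof (rule P_unique)
    have "sM c x - \<iota> (sH c (P x)) = sM c (R x)"
      by (simp add: R_def iota M.scale_right_diff_distrib)
    then show "sM c x - \<iota> (sH c (P x)) \<in> KX"
      by (simp add: R_in_KX M.span_scale)
  qed
qed

lemma R_linmap: "linmap s sM g \<Longrightarrow> linmap s sM (\<lambda>x. R (g x))"
  unfolding R_def by (intro linmap_intros vector_spaces iota_linmap P_linmap)

lemma pi_R [simp]: "\<pi> (R m) = \<pi> m"
  by (simp add: R_def linmap_diff[OF pi_linmap[OF linmap_id]])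

lemma j_R: "j (R m) = j m - f (P m)"
  by (simp add: R_def f_def linmap_diff[OF j_linmap[OF linmap_id]])

text \<open>The kernel of \<open>\<pi>\<close> is the image of \<open>H\<close> and meets
  \<open>KX\<close> only in zero, so \<open>\<pi>\<close> is injective on \<open>KX\<close>;
  moreover \<open>R m\<close> and \<open>m\<close> differ by an element of this kernel.\<close>

lemma lift_pi [simp]: "lift_V sM X \<pi> (\<pi> m) = R m"
proof -
  have "inj_on \<pi> KX"
  proof (rule inj_onI)
    fix x y assume xy: "x \<in> KX" "y \<in> KX" "\<pi> x = \<pi> y"
    then have "\<pi> (x - y) = 0"
      by (simp add: linmap_diff[OF pi_linmap[OF linmap_id]])
    then obtain h where h: "x - y = \<iota> h"
      using E.exact by (metis (mono_tags, lifting) mem_Collect_eq rangeE)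
    have "x - y \<in> KX"
      using xy by (simp add: M.span_diff)
    then have "x - y \<in> KX \<inter> range \<iota>"
      using h by simp
    then have "x - y = 0"
      using X_complement unfolding complement_basis_def by blast
    then show "x = y" by simp
  qed
  then show ?thesis
    unfolding lift_V_def using inv_into_f_f[of \<pi> KX "R m"] R_in_KX by simp
qed

lemma pi_lift [simp]: "\<pi> (lift_V sM X \<pi> v) = v"
  using E.\<pi>_surj by (metis lift_pi pi_R surjD)

lemma lift_in_KX: "lift_V sM X \<pi> v \<in> KX"
  using E.\<pi>_surj by (metis R_in_KX lift_pi surjD)

lemma lift_linmap: "linmap s sV g \<Longrightarrow> linmap s sM (\<lambda>x. lift_V sM X \<pi> (g x))"
proof (rule linmap_compose[of sV sM "lift_V sM X \<pi>"], rule linmapI)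
  show "lift_V sM X \<pi> (v + w) = lift_V sM X \<pi> v + lift_V sM X \<pi> w" for v w
    using lift_pi[of "lift_V sM X \<pi> v + lift_V sM X \<pi> w"]
    by (simp add: linmap_add[OF pi_linmap[OF linmap_id]] R_KX M.span_add lift_in_KX)
  show "lift_V sM X \<pi> (sV c v) = sM c (lift_V sM X \<pi> v)" for c v
    using lift_pi[of "sM c (lift_V sM X \<pi> v)"]
    by (simp add: linmap_scale[OF pi_linmap[OF linmap_id]] R_KX M.span_scale lift_in_KX)
qed

section \<open>The coaction transported to \<open>KX\<close>\<close>

abbreviation cX :: "'m \<Rightarrow> ('h \<times> 'm) list" where "cX \<equiv> coaction_X sM X \<pi> \<delta>"

lemma psum_cX: "psum (cX m) \<phi> = psum (\<delta> (\<pi> m)) (\<lambda>g v. \<phi> g (lift_V sM X \<pi> v))"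
  by (simp add: coaction_X_def psum_map)

lemma cX_in_KX: "(g, y) \<in> set (cX m) \<Longrightarrow> y \<in> KX"
  by (auto simp: coaction_X_def lift_in_KX)

lemma cX_R: "cX (R m) = cX m"
  by (simp add: coaction_X_def)

lemma lift_bilinmap:
  assumes "bilinmap sH sM sC \<phi>"
  shows "bilinmap sH sV sC (\<lambda>g v. \<phi> g (lift_V sM X \<pi> v))"
  by (intro linmap_intros bilinmap_compose_left[OF assms] bilinmap_compose_right[OF assms] lift_linmap)

lemma cX_linmap:
  assumes sC: "vector_space sC" and \<phi>: "bilinmap sH sM sC \<phi>" and g: "linmap s sM g"
  shows "linmap s sC (\<lambda>x. psum (cX (g x)) \<phi>)"
  unfolding psum_cX
proof (rule linmapI)
  note ev = lext_add[OF sC] lext_fscale[OF sC] lext2_formal_sum[OF sC]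
  note pi_g = pi_linmap[OF g]
  show "psum (\<delta> (\<pi> (g (x + y)))) (\<lambda>g v. \<phi> g (lift_V sM X \<pi> v)) =
      psum (\<delta> (\<pi> (g x))) (\<lambda>g v. \<phi> g (lift_V sM X \<pi> v)) + psum (\<delta> (\<pi> (g y))) (\<lambda>g v. \<phi> g (lift_V sM X \<pi> v))" for x y
    using tensor_eqD[OF sC YD.coact_add lift_bilinmap[OF \<phi>]] by (simp add: ev linmap_add[OF pi_g])
  show "psum (\<delta> (\<pi> (g (s c x)))) (\<lambda>g v. \<phi> g (lift_V sM X \<pi> v)) =
      sC c (psum (\<delta> (\<pi> (g x))) (\<lambda>g v. \<phi> g (lift_V sM X \<pi> v)))" for c x
    using tensor_eqD[OF sC YD.coact_scale lift_bilinmap[OF \<phi>]] by (simp add: ev linmap_scale[OF pi_g])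
qed

text \<open>\<open>R m\<close> appears instead of \<open>m\<close> because the transported coaction
  sees \<open>m\<close> only through \<open>\<pi>\<close>.\<close>

lemma cX_counit:
  assumes "linmap sM sC L"
  shows "psum (cX m) (\<lambda>g y. sC (\<epsilon> g) (L y)) = L (R m)"
proof -
  have L: "linmap sV sC (\<lambda>v. L (lift_V sM X \<pi> v))"
    by (intro linmap_compose[OF assms] lift_linmap linmap_id)
  have "psum (cX m) (\<lambda>g y. sC (\<epsilon> g) (L y)) = L (lift_V sM X \<pi> (psum (\<delta> (\<pi> m)) (\<lambda>g v. sV (\<epsilon> g) v)))"
    by (simp add: psum_cX linmap_psum[OF L] linmap_scale[OF L])
  then show ?thesis
    using YD.coact_counit by (simp add: psum_def)
qed

text \<open>The Yetter--Drinfeld condition read on \<open>KX\<close>, where the action of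
  \<open>V\<close> becomes the action of \<open>M\<close> followed by \<open>R\<close>.\<close>

lemma cX_act:
  assumes sC: "vector_space sC" and \<phi>: "bilinmap sH sM sC \<phi>"
  shows "psum (cX (actM h m)) \<phi> =
    psum (\<Delta> h) (\<lambda>a z. psum (\<Delta> z) (\<lambda>b c. psum (cX m) (\<lambda>g y. \<phi> (a * g * S c) (R (actM b y)))))"
proof -
  have lift_act: "lift_V sM X \<pi> (actV b v) = R (actM b (lift_V sM X \<pi> v))" for b v
    using E.\<pi>_hom[of b "lift_V sM X \<pi> v"] by (metis lift_pi pi_lift)
  have "tensor_eq sH sV (formal_sum (\<delta> (actV h v)))
      (psum (\<Delta> h) (\<lambda>a z. psum (\<Delta> z) (\<lambda>b c. psum (\<delta> v) (\<lambda>g w. tens (a * g * S c) (actV b w)))))" for v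
    using YD.yetter_drinfeld_compat[of h v] unfolding psum_comult3 psum_def .
  from tensor_eqD[OF sC this lift_bilinmap[OF \<phi>]] show ?thesis
    by (simp add: lext2_formal_sum[OF sC] lext_psum[OF sC] lext2_tens[OF sC] psum_cX E.\<pi>_hom lift_act)
qed

lemma comult_j_KX:
  assumes sC: "vector_space sC" and \<phi>: "bilinmap sT sT sC \<phi>" and x: "x \<in> KX"
  shows "psum (\<Delta>T (j x)) \<phi> = \<phi> (j x) 1 + psum (cX x) (\<lambda>g y. \<phi> (f g) (j y))"
proof -
  have "tensor_eq sT sT (formal_sum (\<Delta>T (j x)))
      (tens (j x) 1 + psum (cX x) (\<lambda>g y. tens (f g) (j y)))"
    using T_structure x by (simp add: TH_hopf_structure_def psum_def f_def)
  from tensor_eqD[OF sC this \<phi>] show ?thesis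
    by (simp add: lext2_formal_sum[OF sC] lext_psum[OF sC] lext2_tens[OF sC] lext_add[OF sC])
qed

section \<open>The map \<Gamma> as an extension of the multiplication of \<open>H\<close>\<close>

definition \<Gamma> :: "'h \<Rightarrow> 'm \<Rightarrow> 'h" where
  "\<Gamma> h m = psum (\<Delta> h) (\<lambda>a b. P (actM a m) * b)"

lemma Gamma_linmap_left: "linmap s sH g \<Longrightarrow> linmap s sH (\<lambda>x. \<Gamma> (g x) m)"
  unfolding \<Gamma>_def
  by (intro H.hopf_linmap_intros linmap_intros P_linmap actM_linmap_left)

lemma Gamma_linmap_right: "linmap s sM g \<Longrightarrow> linmap s sH (\<lambda>x. \<Gamma> h (g x))"
  unfolding \<Gamma>_def
  by (intro linmap_intros H.hopf_linmap_intros P_linmap actM_linmap_right)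

lemmas setting_linmap_intros = vector_spaces H.hopf_linmap_intros T.hopf_linmap_intros
  iota_linmap pi_linmap j_linmap f_linmap actM_linmap_left actM_linmap_right P_linmap R_linmap
  cX_linmap Gamma_linmap_left Gamma_linmap_right

text \<open>On the image of \<open>H\<close> the action is adjoint, and \<open>h1 k S(h2) h3\<close>
  collapses to \<open>hk\<close>.\<close>

lemma Gamma_iota: "\<Gamma> h (\<iota> k) = h * k"
proof -
  have P_act: "P (actM a (\<iota> k)) = psum (\<Delta> a) (\<lambda>c d. c * k * S d)" for a
    by (simp add: E.\<iota>_hom[symmetric] adjoint_action_def psum_def)
  have "\<Gamma> h (\<iota> k) = psum (\<Delta> h) (\<lambda>a b. psum (\<Delta> a) (\<lambda>c d. c * k * S d * b))"
    by (simp add: \<Gamma>_def P_act psum_mult_right)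
  also have "\<dots> = psum (\<Delta> h) (\<lambda>c a. psum (\<Delta> a) (\<lambda>d b. c * k * S d * b))"
    by (intro H.comult_coassoc[where sC = sH, symmetric] linmap_intros setting_linmap_intros)
  also have "\<dots> = psum (\<Delta> h) (\<lambda>c a. sH (\<epsilon> a) (c * k))"
    by (simp add: mult.assoc psum_mult_left[symmetric] H.antipode_left_psum H.scale_mult_right)
  also have "\<dots> = h * k"
    by (intro H.comult_counit_right linmap_intros setting_linmap_intros)
  finally show ?thesis .
qed

text \<open>Multiplicativity of \<open>\<Delta>\<close> and associativity of the action on
  \<open>M\<close>. Read with \<open>\<Gamma> g (\<iota> h) = g * h\<close>, it says that
  \<open>h\<close> followed by \<open>m\<close> acts on \<open>g\<close> as the sum of
  \<open>h1 \<cdot> m\<close> followed by \<open>h2\<close>, which is the relation imposed by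
  \<open>J\<close>.\<close>

lemma Gamma_mult: "\<Gamma> (g * h) m = psum (\<Delta> h) (\<lambda>a b. \<Gamma> g (actM a m) * b)"
proof -
  have "\<Gamma> (g * h) m = psum (\<Delta> g) (\<lambda>c d. psum (\<Delta> h) (\<lambda>a b. P (actM (c * a) m) * (d * b)))"
    unfolding \<Gamma>_def by (intro H.comult_mult_psum[where sC = sH] linmap_intros setting_linmap_intros)
  also have "\<dots> = psum (\<Delta> h) (\<lambda>a b. psum (\<Delta> g) (\<lambda>c d. P (actM (c * a) m) * (d * b)))"
    by (rule psum_swap)
  also have "\<dots> = psum (\<Delta> h) (\<lambda>a b. \<Gamma> g (actM a m) * b)"
    by (simp add: \<Gamma>_def psum_mult_right mult.assoc E.M.act_mult)
  finally show ?thesis .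
qed

section \<open>The right action of the free extension on the Hopf algebra\<close>

lemma span_generators: "M.span (X \<union> \<iota> ` B) = UNIV"
proof -
  have "m \<in> M.span (X \<union> \<iota> ` B)" for m
  proof -
    interpret \<iota>: module_hom sH sM \<iota>
      using E.\<iota>_linear by (simp add: linear_iff_module_hom)
    have "\<iota> (P m) \<in> M.span (\<iota> ` B)"
      using B_basis by (simp add: \<iota>.span_image is_basis_def)
    then have "R m + \<iota> (P m) \<in> M.span (X \<union> \<iota> ` B)"
      using R_in_KX M.span_mono by (intro M.span_add) blast+
    then show ?thesis by (simp add: R_def)
  qed
  then show ?thesis by blast
qed

lemma linmap_eq_on_M:
  assumes "vector_space sC" "linmap sM sC F" "linmap sM sC G" "\<And>m. m \<in> X \<union> \<iota> ` B \<Longrightarrow> F m = G m"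
  shows "F m = G m"
proof -
  have "F m - G m = 0"
    by (rule linmap_eq_0_on_span[where f = "\<lambda>m. F m - G m" and K = "X \<union> \<iota> ` B", OF sM_vector_space assms(1)])
      (use assms(4) span_generators in \<open>auto intro!: linmap_intros assms(1-3)\<close>)
  then show ?thesis by simp
qed

lemma linmap_free_eqI:
  assumes "vector_space s" "linmap fscale s F" "linmap fscale s G"
    and "\<And>w. F (Poly_Mapping.single w 1) = G (Poly_Mapping.single w 1)"
  shows "F u = G u"
  using lext_unique[OF assms(1,2), of u] lext_unique[OF assms(1,3), of u] assms(4) by simp

lemma fscale_mult_linmap:
  fixes g :: "'x::ab_group_add \<Rightarrow> ('w::monoid_add \<Rightarrow>\<^sub>0 'k)"
  shows "linmap s fscale g \<Longrightarrow> linmap s fscale (\<lambda>x. g x * c)"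
    "linmap s fscale g \<Longrightarrow> linmap s fscale (\<lambda>x. c * g x)"
  by (simp_all add: linmap_def algebra_simps fscale_mult)

text \<open>The free algebra acts from the right, so the first letter of a word acts first; hence
  \<open>foldl\<close>.\<close>

definition word_act :: "('m word \<Rightarrow>\<^sub>0 'k) \<Rightarrow> 'h \<Rightarrow> 'h" where
  "word_act y u = lext sH (\<lambda>w. foldl \<Gamma> u (letters w)) y"

lemma word_act_linmap_left: "linmap s fscale g \<Longrightarrow> linmap s sH (\<lambda>x. word_act (g x) u)"
  unfolding word_act_def by (rule linmap_compose[OF linmap_lext[OF H.vector_space_axioms]])

lemma foldl_Gamma_linmap: "linmap sH sH (\<lambda>u. foldl \<Gamma> u ms)"
  by (induction ms rule: rev_induct) (auto intro: linmap_id Gamma_linmap_left)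

lemma word_act_single: "word_act (Poly_Mapping.single w 1) u = foldl \<Gamma> u (letters w)"
  by (simp add: word_act_def lext_single[OF H.vector_space_axioms])

lemma word_act_linmap_right: "linmap sH sH (word_act y)"
  unfolding word_act_def lext_def
proof (rule linmapI)
  note lin = foldl_Gamma_linmap
  show "(\<Sum>w\<in>Poly_Mapping.keys y. sH (Poly_Mapping.lookup y w) (foldl \<Gamma> (u + v) (letters w))) =
    (\<Sum>w\<in>Poly_Mapping.keys y. sH (Poly_Mapping.lookup y w) (foldl \<Gamma> u (letters w))) +
    (\<Sum>w\<in>Poly_Mapping.keys y. sH (Poly_Mapping.lookup y w) (foldl \<Gamma> v (letters w)))" for u v
    by (simp add: linmap_add[OF lin] H.scale_right_distrib sum.distrib)
  show "(\<Sum>w\<in>Poly_Mapping.keys y. sH (Poly_Mapping.lookup y w) (foldl \<Gamma> (sH c u) (letters w))) =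
    sH c (\<Sum>w\<in>Poly_Mapping.keys y. sH (Poly_Mapping.lookup y w) (foldl \<Gamma> u (letters w)))" for c u
    by (simp add: linmap_scale[OF lin] H.scale_sum_right mult.commute)
qed

lemma word_act_mult: "word_act (y * z) u = word_act z (word_act y u)"
proof (rule linmap_free_eqI[where F = "\<lambda>y. word_act (y * z) u", OF H.vector_space_axioms])
  show "linmap fscale sH (\<lambda>y. word_act (y * z) u)"
    by (intro word_act_linmap_left fscale_mult_linmap linmap_id)
  show "linmap fscale sH (\<lambda>y. word_act z (word_act y u))"
    by (intro linmap_compose[OF word_act_linmap_right] word_act_linmap_left linmap_id)
  show "word_act (Poly_Mapping.single w 1 * z) u = word_act z (word_act (Poly_Mapping.single w 1) u)" for w
  proof (rule linmap_free_eqI[where F = "\<lambda>z. word_act (Poly_Mapping.single w 1 * z) u", OF H.vector_space_axioms])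
    show "linmap fscale sH (\<lambda>z. word_act (Poly_Mapping.single w 1 * z) u)"
      by (intro word_act_linmap_left fscale_mult_linmap linmap_id)
    show "linmap fscale sH (\<lambda>z. word_act z (word_act (Poly_Mapping.single w 1) u))"
      by (intro word_act_linmap_left linmap_id)
  qed (simp add: mult_single word_act_single plus_word_def)
qed

lemma word_act_one: "word_act 1 u = u"
  using word_act_single[of 0 u, unfolded single_one] by (simp add: zero_word_def)

lemma word_act_gen: "word_act (free_gen m) u = \<Gamma> u m"
  by (simp add: free_gen_def word_act_single)

lemma sum_representation: "(\<Sum>v | H.representation B h v \<noteq> 0. sH (H.representation B h v) v) = h"
  using B_basis by (intro H.sum_nonzero_representation_eq) (auto simp: is_basis_def)

text \<open>The relations only involve letters from the image of \<open>H\<close>, which act by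
  right multiplication; they amount to associativity in \<open>H\<close> and the expansion of
  \<open>s * t\<close> in the basis.\<close>

lemma word_act_relations:
  assumes "r \<in> TH_relations sH B \<iota>"
  shows "word_act r u = 0"
proof -
  note lin = word_act_linmap_left[OF linmap_id]
  consider s t where "r = free_gen (\<iota> s) * free_gen (\<iota> t)
        - (\<Sum>v | H.representation B (s * t) v \<noteq> 0. fscale (H.representation B (s * t) v) (free_gen (\<iota> v)))"
    | "r = free_gen (\<iota> 1) - 1"
    using assms by (auto simp: TH_relations_def)
  then show ?thesis
  proof cases
    case 1
    have "word_act r u = u * s * t - u * (\<Sum>v | H.representation B (s * t) v \<noteq> 0. sH (H.representation B (s * t) v) v)"
      by (simp add: 1 linmap_diff[OF lin] linmap_sum[OF lin] linmap_scale[OF lin] word_act_mult word_act_gen Gamma_iota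
          sum_distrib_left H.scale_mult_right)
    then show ?thesis
      by (simp add: sum_representation mult.assoc)
  qed (simp add: linmap_diff[OF lin] word_act_one word_act_gen Gamma_iota)
qed

abbreviation "gens \<equiv> X \<union> \<iota> ` B"

lemma word_act_ideal:
  assumes "z \<in> ideal_gen (free_algebra gens) (TH_relations sH B \<iota>)"
  shows "word_act z u = 0"
  using assms
proof (induction arbitrary: u)
  case (gen a r c)
  then show ?case
    by (simp add: word_act_mult word_act_relations linmap_0[OF word_act_linmap_right])
qed (simp_all add: linmap_0[OF word_act_linmap_left[OF linmap_id]] linmap_add[OF word_act_linmap_left[OF linmap_id]])

section \<open>Evaluation of words in \<open>T\<close> and descent of the action\<close>

abbreviation evT :: "('m word \<Rightarrow>\<^sub>0 'k) \<Rightarrow> 't" where "evT \<equiv> free_eval sT j"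

lemma evT_lext: "evT = lext sT (\<lambda>w. prod_list (map j (letters w)))"
  by (simp add: fun_eq_iff free_eval_def lext_def)

lemma evT_linmap: "linmap s fscale g \<Longrightarrow> linmap s sT (\<lambda>x. evT (g x))"
  unfolding evT_lext by (rule linmap_compose[OF linmap_lext[OF T.vector_space_axioms]])

lemma evT_single: "evT (Poly_Mapping.single w 1) = prod_list (map j (letters w))"
  by (simp add: evT_lext lext_single[OF T.vector_space_axioms])

lemma evT_mult: "evT (y * z) = evT y * evT z"
proof (rule linmap_free_eqI[where F = "\<lambda>y. evT (y * z)", OF T.vector_space_axioms])
  show "linmap fscale sT (\<lambda>y. evT (y * z))"
    by (intro evT_linmap fscale_mult_linmap linmap_id)
  show "linmap fscale sT (\<lambda>y. evT y * evT z)"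
    by (intro T.mult_linmap evT_linmap linmap_id)
  show "evT (Poly_Mapping.single w 1 * z) = evT (Poly_Mapping.single w 1) * evT z" for w
  proof (rule linmap_free_eqI[where F = "\<lambda>z. evT (Poly_Mapping.single w 1 * z)", OF T.vector_space_axioms])
    show "linmap fscale sT (\<lambda>z. evT (Poly_Mapping.single w 1 * z))"
      by (intro evT_linmap fscale_mult_linmap linmap_id)
    show "linmap fscale sT (\<lambda>z. evT (Poly_Mapping.single w 1) * evT z)"
      by (intro T.mult_linmap evT_linmap linmap_id)
  qed (simp add: mult_single evT_single plus_word_def)
qed

lemma evT_gen: "evT (free_gen m) = j m"
  by (simp add: free_gen_def evT_single)

lemma presentation:
  "evT ` free_algebra gens = UNIV"
  "{y \<in> free_algebra gens. evT y = 0} = ideal_gen (free_algebra gens) (TH_relations sH B \<iota>)"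
  using T_presented by (simp_all add: is_TH_def presented_by_def)

lemma free_algebra_closed:
  fixes y z :: "'w word \<Rightarrow>\<^sub>0 'k"
  assumes "y \<in> free_algebra G" "z \<in> free_algebra G"
  shows "y + z \<in> free_algebra G" "y - z \<in> free_algebra G" "fscale c y \<in> free_algebra G" "y * z \<in> free_algebra G"
proof -
  show "y + z \<in> free_algebra G" "y - z \<in> free_algebra G" "fscale c y \<in> free_algebra G"
    using assms Poly_Mapping.keys_add[of y z] keys_diff[of y z]
    by (auto simp: free_algebra_def in_keys_iff)
  show "y * z \<in> free_algebra G"
    unfolding free_algebra_def
  proof (intro CollectI ballI)
    fix w assume "w \<in> Poly_Mapping.keys (y * z)"
    then obtain a b where "w = a + b" "a \<in> Poly_Mapping.keys y" "b \<in> Poly_Mapping.keys z"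
      using Poly_Mapping.keys_mult[of y z] by blast
    then show "set (letters w) \<subseteq> G"
      using assms by (simp add: free_algebra_def plus_word_def)
  qed
qed

lemma gen_in_free_algebra: "m \<in> G \<Longrightarrow> (free_gen m :: 'w word \<Rightarrow>\<^sub>0 'k) \<in> free_algebra G"
  by (simp add: free_algebra_def free_gen_def)

text \<open>An element of \<open>T\<close> acts through a chosen preimage in the free algebra on the
  generators. Two preimages differ by an element of the ideal of relations, which acts as zero, so
  the choice is immaterial.\<close>

definition ract :: "'t \<Rightarrow> 'h \<Rightarrow> 'h" where
  "ract t u = word_act (SOME y. y \<in> free_algebra gens \<and> evT y = t) u"

lemma ract_evT:
  assumes "y \<in> free_algebra gens"
  shows "ract (evT y) u = word_act y u"
proof -
  define z where "z = (SOME z. z \<in> free_algebra gens \<and> evT z = evT y)"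
  have z: "z \<in> free_algebra gens \<and> evT z = evT y"
    unfolding z_def by (rule someI[of _ y]) (use assms in simp)
  then have "z - y \<in> {y \<in> free_algebra gens. evT y = 0}"
    using assms free_algebra_closed(2)[of z gens y] by (simp add: linmap_diff[OF evT_linmap[OF linmap_id]])
  then have "z - y \<in> ideal_gen (free_algebra gens) (TH_relations sH B \<iota>)"
    by (simp only: presentation(2))
  then have "word_act (z - y) u = 0"
    by (rule word_act_ideal)
  then show ?thesis
    by (simp add: ract_def z_def[symmetric] linmap_diff[OF word_act_linmap_left[OF linmap_id]])
qed

lemma evT_cases: obtains y where "y \<in> free_algebra gens" "t = evT y"
  using presentation(1) by blast

lemma ract_linmap_left: "linmap s sT g \<Longrightarrow> linmap s sH (\<lambda>x. ract (g x) u)"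
proof (rule linmap_compose[of sT sH "\<lambda>t. ract t u"], rule linmapI)
  show "ract (t + t') u = ract t u + ract t' u" for t t'
  proof -
    obtain y y' where "y \<in> free_algebra gens" "t = evT y" "y' \<in> free_algebra gens" "t' = evT y'"
      by (metis evT_cases)
    then show ?thesis
      by (simp add: linmap_add[OF evT_linmap[OF linmap_id], symmetric] ract_evT free_algebra_closed
          linmap_add[OF word_act_linmap_left[OF linmap_id]])
  qed
  show "ract (sT c t) u = sH c (ract t u)" for c t
  proof -
    obtain y where "y \<in> free_algebra gens" "t = evT y"
      by (metis evT_cases)
    then show ?thesis
      by (simp add: linmap_scale[OF evT_linmap[OF linmap_id], symmetric] ract_evT free_algebra_closed
          linmap_scale[OF word_act_linmap_left[OF linmap_id]])
  qed
qed

lemma ract_linmap_right: "linmap sH sH (ract t)"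
  unfolding ract_def by (rule word_act_linmap_right)

lemma ract_mult: "ract (t * t') u = ract t' (ract t u)"
proof -
  obtain y y' where "y \<in> free_algebra gens" "t = evT y" "y' \<in> free_algebra gens" "t' = evT y'"
    by (metis evT_cases)
  then show ?thesis
    by (simp add: evT_mult[symmetric] ract_evT free_algebra_closed word_act_mult)
qed

text \<open>The presentation gives this only for the generators, a spanning set of \<open>M\<close>;
  both sides are linear in \<open>m\<close>.\<close>

lemma ract_j: "ract (j m) u = \<Gamma> u m"
proof (rule linmap_eq_on_M[where F = "\<lambda>m. ract (j m) u", OF H.vector_space_axioms])
  show "ract (j m) u = \<Gamma> u m" if "m \<in> gens" for m
    using ract_evT[OF gen_in_free_algebra[OF that]] by (simp add: evT_gen word_act_gen)
qed (intro ract_linmap_left linmap_intros setting_linmap_intros)+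

lemma ract_f: "ract (f h) u = u * h"
  by (simp add: f_def ract_j Gamma_iota)

lemma span_words: "T.span (range (\<lambda>ms. prod_list (map j ms))) = UNIV"
proof -
  have "t \<in> T.span (range (\<lambda>ms. prod_list (map j ms)))" for t
  proof -
    obtain y where "t = evT y"
      by (metis evT_cases)
    moreover have "prod_list (map j ms) \<in> T.span (range (\<lambda>ms. prod_list (map j ms)))" for ms
      by (rule T.span_base) blast
    ultimately show ?thesis
      by (auto simp: free_eval_def intro!: T.span_sum T.span_scale)
  qed
  then show ?thesis by blast
qed

section \<open>The relators and the retraction onto \<open>H\<close>\<close>

definition r :: "'h \<Rightarrow> 'm \<Rightarrow> 't" where
  "r h m = f h * j m - psum (\<Delta> h) (\<lambda>a b. j (actM a m) * f b)"

abbreviation J :: "'t set" where "J \<equiv> J_ideal \<Delta> actM \<iota> j"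

lemma J_eq: "J = ideal_gen UNIV {r h m | h m. True}"
  by (simp add: J_ideal_def r_def f_def psum_def)

text \<open>The first term of the relator takes \<open>u\<close> to
  \<open>\<Gamma> (u * h) m\<close>, and \<open>Gamma_mult\<close> identifies this with the effect
  of the sum.\<close>

lemma ract_r: "ract (r h m) u = 0"
  by (simp add: r_def linmap_diff[OF ract_linmap_left[OF linmap_id]] linmap_psum[OF ract_linmap_left[OF linmap_id]]
      ract_mult ract_j ract_f Gamma_mult)

definition retr :: "'t \<Rightarrow> 'h" where "retr t = ract t 1"

lemma retr_linmap: "linmap s sT g \<Longrightarrow> linmap s sH (\<lambda>x. retr (g x))"
  unfolding retr_def by (rule ract_linmap_left)

lemma retr_f [simp]: "retr (f h) = h"
  by (simp add: retr_def ract_f)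

lemma retr_J:
  assumes "t \<in> J"
  shows "retr t = 0"
proof -
  have "t \<in> ideal_gen UNIV {r h m | h m. True}"
    using assms by (simp add: J_eq)
  \<comment> \<open>All \<open>u\<close> are needed, not only \<open>1\<close>: in a product
    \<open>a * y * c\<close> the factor \<open>a\<close> acts before the relator
    \<open>y\<close>.\<close>
  then have "ract t u = 0" for u
  proof (induction arbitrary: u rule: ideal_gen.induct)
    case zero
    show ?case by (rule linmap_0[OF ract_linmap_left[OF linmap_id]])
  next
    case (gen a y c)
    then obtain h m where "y = r h m" by blast
    then show ?case
      by (simp add: ract_mult ract_r linmap_0[OF ract_linmap_right])
  next
    case (add x y)
    then show ?case
      by (simp add: linmap_add[OF ract_linmap_left[OF linmap_id]])
  qed
  then show ?thesis by (simp add: retr_def)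
qed

end

section \<open>When the defining ideal is a Hopf ideal\<close>

context hopf_extension
begin

lemma f_mult: "f (g * h) = f g * f h"
  by (rule hopf_hom_mult[OF f_hopf_hom])

lemma f_comult:
  assumes "vector_space sC" "bilinmap sT sT sC \<phi>"
  shows "psum (\<Delta>T (f h)) \<phi> = psum (\<Delta> h) (\<lambda>a b. \<phi> (f a) (f b))"
  by (rule hopf_hom_comult[OF f_hopf_hom assms])

section \<open>Coproducts of generators and relators\<close>

lemma comult_j:
  assumes sC: "vector_space sC" and \<phi>: "bilinmap sT sT sC \<phi>"
  shows "psum (\<Delta>T (j m)) \<phi> = \<phi> (j (R m)) 1 + psum (cX m) (\<lambda>g y. \<phi> (f g) (j y))
    + psum (\<Delta> (P m)) (\<lambda>a b. \<phi> (f a) (f b))"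
proof -
  have "j m = j (R m) + f (P m)"
    by (simp add: j_R)
  then have "psum (\<Delta>T (j m)) \<phi> = psum (\<Delta>T (j (R m))) \<phi> + psum (\<Delta>T (f (P m))) \<phi>"
    using linmap_add[OF T.comult_linmap[OF sC \<phi> linmap_id]] by simp
  then show ?thesis
    by (simp add: comult_j_KX[OF sC \<phi> R_in_KX] f_comult[OF sC \<phi>] cX_R)
qed

lemma comult_j_f:
  assumes sC: "vector_space sC" and \<phi>: "bilinmap sT sT sC \<phi>"
  shows "psum (\<Delta>T (j m * f h)) \<phi> = psum (\<Delta> h) (\<lambda>c d. \<phi> (j (R m) * f c) (f d)
    + psum (cX m) (\<lambda>g y. \<phi> (f (g * c)) (j y * f d))
    + psum (\<Delta> (P m)) (\<lambda>a b. \<phi> (f (a * c)) (f (b * d))))"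
proof -
  note lin = bilinmap_compose_left[OF \<phi>] bilinmap_compose_right[OF \<phi>]
  have "psum (\<Delta>T (j m * f h)) \<phi> = psum (\<Delta>T (j m)) (\<lambda>u v. psum (\<Delta>T (f h)) (\<lambda>c d. \<phi> (u * c) (v * d)))"
    by (rule T.comult_mult_psum[OF sC \<phi>])
  also have "\<dots> = psum (\<Delta>T (j m)) (\<lambda>u v. psum (\<Delta> h) (\<lambda>c d. \<phi> (u * f c) (v * f d)))"
    by (intro psum_cong f_comult[OF sC] linmap_intros setting_linmap_intros lin)
  also have "\<dots> = psum (\<Delta> h) (\<lambda>c d. psum (\<Delta>T (j m)) (\<lambda>u v. \<phi> (u * f c) (v * f d)))"
    by (rule psum_swap)
  also have "\<dots> = psum (\<Delta> h) (\<lambda>c d. \<phi> (j (R m) * f c) (1 * f d)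
    + psum (cX m) (\<lambda>g y. \<phi> (f g * f c) (j y * f d))
    + psum (\<Delta> (P m)) (\<lambda>a b. \<phi> (f a * f c) (f b * f d)))"
    by (intro psum_cong comult_j[OF sC] linmap_intros setting_linmap_intros lin)
  finally show ?thesis
    by (simp add: f_mult)
qed

text \<open>The error terms \<Gamma> arise here: the coproduct is prescribed on \<open>KX\<close>
  only, so \<open>h1 \<cdot> m\<close> is replaced by its \<open>KX\<close>-component, and the
  discarded \<open>H\<close>-components add up to \<open>\<Gamma> h m\<close>.\<close>

lemma sum_R_act:
  "psum (\<Delta> h) (\<lambda>a b. j (R (actM a m)) * f b) = f h * j m - r h m - f (\<Gamma> h m)"
  by (simp add: r_def j_R \<Gamma>_def left_diff_distrib psum_diff linmap_psum[OF hopf_hom_linmap[OF f_hopf_hom]] f_mult)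

text \<open>
  The coaction of \<open>h\<^sub>1 \<cdot> x\<close> is \<open>h\<^sub>1x\<^sub>-\<^sub>1S(h\<^sub>3) \<otimes> h\<^sub>2 \<cdot> x\<^sub>0\<close>; multiplied by \<open>h\<^sub>4 \<otimes> h\<^sub>5\<close> the antipode cancels.
\<close>

lemma sum_coaction_act:
  assumes sC: "vector_space sC" and \<phi>: "bilinmap sT sT sC \<phi>"
  shows "psum (\<Delta> h) (\<lambda>a b. psum (\<Delta> b) (\<lambda>c d. psum (cX (actM a m)) (\<lambda>g y. \<phi> (f (g * c)) (j y * f d))))
    = psum (\<Delta> h) (\<lambda>a w. psum (cX m) (\<lambda>g y. \<phi> (f (a * g)) (f w * j y - r w y - f (\<Gamma> w y))))"
proof -
  note lin = bilinmap_compose_left[OF \<phi>] bilinmap_compose_right[OF \<phi>]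
  note intros = linmap_intros setting_linmap_intros lin sC
  \<comment> \<open>The slot \<open>u\<close> receives \<open>S a3 * c\<close>; linearity in all
    four slots permits the reassociations that follow.\<close>
  define K where "K a1 a2 u d = psum (cX m) (\<lambda>g y. \<phi> (f (a1 * g * u)) (j (R (actM a2 y)) * f d))" for a1 a2 u d
  have K1: "linmap s sH g \<Longrightarrow> linmap s sC (\<lambda>x. K (g x) a2 u d)"
    and K2: "linmap s sH g \<Longrightarrow> linmap s sC (\<lambda>x. K a1 (g x) u d)"
    and K3: "linmap s sH g \<Longrightarrow> linmap s sC (\<lambda>x. K a1 a2 (g x) d)"
    and K4: "linmap s sH g \<Longrightarrow> linmap s sC (\<lambda>x. K a1 a2 u (g x))"
    for s :: "'k \<Rightarrow> 'h \<Rightarrow> 'h" and g a1 a2 u d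
    unfolding K_def by (intro intros; assumption)+
  have "psum (\<Delta> h) (\<lambda>a b. psum (\<Delta> b) (\<lambda>c d. psum (cX (actM a m)) (\<lambda>g y. \<phi> (f (g * c)) (j y * f d))))
    = psum (\<Delta> h) (\<lambda>a b. psum (\<Delta> b) (\<lambda>c d. psum (\<Delta> a) (\<lambda>a1 z. psum (\<Delta> z) (\<lambda>a2 a3.
        psum (cX m) (\<lambda>g y. \<phi> (f (a1 * g * S a3 * c)) (j (R (actM a2 y)) * f d))))))"
    by (intro psum_cong cX_act[OF sC] intros)
  also have "\<dots> = psum (\<Delta> h) (\<lambda>a b. psum (\<Delta> b) (\<lambda>c d. psum (\<Delta> a) (\<lambda>a1 z. psum (\<Delta> z) (\<lambda>a2 a3.
        K a1 a2 (S a3 * c) d))))"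
    by (simp add: K_def mult.assoc)
  also have "\<dots> = psum (\<Delta> h) (\<lambda>a b. psum (\<Delta> a) (\<lambda>a1 z. psum (\<Delta> b) (\<lambda>c d. psum (\<Delta> z) (\<lambda>a2 a3.
        K a1 a2 (S a3 * c) d))))"
    by (intro psum_cong psum_swap)
  also have "\<dots> = psum (\<Delta> h) (\<lambda>a1 w. psum (\<Delta> w) (\<lambda>z b. psum (\<Delta> b) (\<lambda>c d. psum (\<Delta> z) (\<lambda>a2 a3.
        K a1 a2 (S a3 * c) d))))"
    by (intro H.comult_coassoc[OF sC, symmetric] intros K1 K2 K3 K4)
  also have "\<dots> = psum (\<Delta> h) (\<lambda>a1 w. psum (\<Delta> w) (\<lambda>z b. psum (\<Delta> z) (\<lambda>a2 a3. psum (\<Delta> b) (\<lambda>c d.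
        K a1 a2 (S a3 * c) d))))"
    by (intro psum_cong psum_swap)
  also have "\<dots> = psum (\<Delta> h) (\<lambda>a1 w. psum (\<Delta> w) (\<lambda>a2 v. psum (\<Delta> v) (\<lambda>a3 b. psum (\<Delta> b) (\<lambda>c d.
        K a1 a2 (S a3 * c) d))))"
    by (intro psum_cong H.comult_coassoc[OF sC, symmetric] intros K1 K2 K3 K4)
  \<comment> \<open>Now \<open>a3\<close> and \<open>c\<close> are the two legs of the single
    element \<open>e\<close>, so \<open>S a3 * c\<close> contracts to
    \<open>\<epsilon> e\<close>.\<close>
  also have "\<dots> = psum (\<Delta> h) (\<lambda>a1 w. psum (\<Delta> w) (\<lambda>a2 v. psum (\<Delta> v) (\<lambda>e d. psum (\<Delta> e) (\<lambda>a3 c.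
        K a1 a2 (S a3 * c) d))))"
    by (intro psum_cong H.comult_coassoc[OF sC] intros K1 K2 K3 K4)
  also have "\<dots> = psum (\<Delta> h) (\<lambda>a1 w. psum (\<Delta> w) (\<lambda>a2 v. psum (\<Delta> v) (\<lambda>e d. sC (\<epsilon> e) (K a1 a2 1 d))))"
    by (simp add: linmap_psum[OF K3[OF linmap_id], symmetric] H.antipode_left_psum linmap_scale[OF K3[OF linmap_id]])
  also have "\<dots> = psum (\<Delta> h) (\<lambda>a1 w. psum (\<Delta> w) (\<lambda>a2 v. K a1 a2 1 v))"
    by (intro psum_cong H.comult_counit_left K4 linmap_id)
  also have "\<dots> = psum (\<Delta> h) (\<lambda>a1 w. psum (cX m) (\<lambda>g y. psum (\<Delta> w) (\<lambda>a2 v.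
        \<phi> (f (a1 * g)) (j (R (actM a2 y)) * f v))))"
    unfolding K_def mult_1_right by (intro psum_cong psum_swap)
  also have "\<dots> = psum (\<Delta> h) (\<lambda>a1 w. psum (cX m) (\<lambda>g y.
        \<phi> (f (a1 * g)) (psum (\<Delta> w) (\<lambda>a2 v. j (R (actM a2 y)) * f v))))"
    by (simp add: linmap_psum[OF bilinmap_right[OF \<phi>]])
  finally show ?thesis
    by (simp add: sum_R_act)
qed

text \<open>Multiplicativity of \<open>\<Delta>\<close>, applied to the products
  \<open>P (actM a m) * b\<close> that make up \<open>\<Gamma> h m\<close>.\<close>

lemma sum_comult_Gamma:
  assumes sC: "vector_space sC" and \<phi>: "bilinmap sH sH sC \<phi>"
  shows "psum (\<Delta> h) (\<lambda>a b. psum (\<Delta> b) (\<lambda>c d. psum (\<Delta> (P (actM a m))) (\<lambda>p q. \<phi> (p * c) (q * d))))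
    = psum (\<Delta> (\<Gamma> h m)) \<phi>"
proof -
  have "psum (\<Delta> (\<Gamma> h m)) \<phi> = psum (\<Delta> h) (\<lambda>a b. psum (\<Delta> (P (actM a m) * b)) \<phi>)"
    unfolding \<Gamma>_def by (rule linmap_psum[OF H.comult_linmap[OF sC \<phi> linmap_id]])
  also have "\<dots> = psum (\<Delta> h) (\<lambda>a b. psum (\<Delta> (P (actM a m))) (\<lambda>p q. psum (\<Delta> b) (\<lambda>c d. \<phi> (p * c) (q * d))))"
    by (simp add: H.comult_mult_psum[OF sC \<phi>])
  also have "\<dots> = psum (\<Delta> h) (\<lambda>a b. psum (\<Delta> b) (\<lambda>c d. psum (\<Delta> (P (actM a m))) (\<lambda>p q. \<phi> (p * c) (q * d))))"
    by (intro psum_cong psum_swap)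
  finally show ?thesis ..
qed

text \<open>The coproduct of \<open>(h1 \<cdot> x) h2\<close> has three parts: from the
  \<open>KX\<close>-component tensored with 1, from its coaction, and from the
  \<open>H\<close>-component. The first two match the two parts of the coproduct of
  \<open>hx\<close> up to relators and values of \<Gamma>; the third is the coproduct of
  \<open>\<Gamma> h x\<close>. The identity is exact, not merely modulo \<open>J\<close>, and so
  serves necessity, sufficiency and the antipode alike.\<close>

lemma comult_r:
  assumes sC: "vector_space sC" and \<phi>: "bilinmap sT sT sC \<phi>" and x: "x \<in> KX"
  shows "psum (\<Delta>T (r h x)) \<phi> =
    psum (\<Delta> h) (\<lambda>a b. \<phi> (r a x) (f b)) + psum (\<Delta> h) (\<lambda>a b. psum (cX x) (\<lambda>g y. \<phi> (f (a * g)) (r b y)))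
    + (psum (\<Delta> h) (\<lambda>a b. \<phi> (f (\<Gamma> a x)) (f b)) + psum (\<Delta> h) (\<lambda>a b. psum (cX x) (\<lambda>g y. \<phi> (f (a * g)) (f (\<Gamma> b y))))
      - psum (\<Delta> (\<Gamma> h x)) (\<lambda>a b. \<phi> (f a) (f b)))"
proof -
  note lin = bilinmap_compose_left[OF \<phi>] bilinmap_compose_right[OF \<phi>]
  note intros = linmap_intros setting_linmap_intros lin sC
  note \<phi>_diff = linmap_diff[OF bilinmap_left[OF \<phi>]] linmap_diff[OF bilinmap_right[OF \<phi>]]
  have hx: "psum (\<Delta>T (f h * j x)) \<phi> = psum (\<Delta> h) (\<lambda>a b. \<phi> (f a * j x) (f b))
    + psum (\<Delta> h) (\<lambda>a b. psum (cX x) (\<lambda>g y. \<phi> (f (a * g)) (f b * j y)))"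
  proof -
    have "psum (\<Delta>T (f h * j x)) \<phi> = psum (\<Delta>T (f h)) (\<lambda>a b. psum (\<Delta>T (j x)) (\<lambda>c d. \<phi> (a * c) (b * d)))"
      by (rule T.comult_mult_psum[OF sC \<phi>])
    also have "\<dots> = psum (\<Delta> h) (\<lambda>a b. psum (\<Delta>T (j x)) (\<lambda>c d. \<phi> (f a * c) (f b * d)))"
      by (intro f_comult[OF sC] intros)
    also have "\<dots> = psum (\<Delta> h) (\<lambda>a b. \<phi> (f a * j x) (f b * 1) + psum (cX x) (\<lambda>g y. \<phi> (f a * f g) (f b * j y)))"
      by (intro psum_cong comult_j_KX[OF sC _ x] intros)
    finally show ?thesis by (simp add: psum_add f_mult)
  qed
  have "psum (\<Delta>T (psum (\<Delta> h) (\<lambda>a b. j (actM a x) * f b))) \<phi> = psum (\<Delta> h) (\<lambda>a b. psum (\<Delta>T (j (actM a x) * f b)) \<phi>)"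
    by (rule linmap_psum[OF T.comult_linmap[OF sC \<phi> linmap_id]])
  also have "\<dots> = psum (\<Delta> h) (\<lambda>a b. psum (\<Delta> b) (\<lambda>c d. \<phi> (j (R (actM a x)) * f c) (f d)))
    + psum (\<Delta> h) (\<lambda>a b. psum (\<Delta> b) (\<lambda>c d. psum (cX (actM a x)) (\<lambda>g y. \<phi> (f (g * c)) (j y * f d))))
    + psum (\<Delta> h) (\<lambda>a b. psum (\<Delta> b) (\<lambda>c d. psum (\<Delta> (P (actM a x))) (\<lambda>p q. \<phi> (f (p * c)) (f (q * d)))))"
    by (simp add: comult_j_f[OF sC \<phi>] psum_add)
  also have "psum (\<Delta> h) (\<lambda>a b. psum (\<Delta> b) (\<lambda>c d. \<phi> (j (R (actM a x)) * f c) (f d)))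
    = psum (\<Delta> h) (\<lambda>y d. psum (\<Delta> y) (\<lambda>a c. \<phi> (j (R (actM a x)) * f c) (f d)))"
    by (intro H.comult_coassoc[OF sC] intros)
  also have "\<dots> = psum (\<Delta> h) (\<lambda>a b. \<phi> (f a * j x) (f b)) - psum (\<Delta> h) (\<lambda>a b. \<phi> (r a x) (f b))
      - psum (\<Delta> h) (\<lambda>a b. \<phi> (f (\<Gamma> a x)) (f b))"
    by (simp add: linmap_psum[OF bilinmap_left[OF \<phi>], symmetric] sum_R_act \<phi>_diff psum_diff)
  also have "psum (\<Delta> h) (\<lambda>a b. psum (\<Delta> b) (\<lambda>c d. psum (cX (actM a x)) (\<lambda>g y. \<phi> (f (g * c)) (j y * f d))))
    = psum (\<Delta> h) (\<lambda>a b. psum (cX x) (\<lambda>g y. \<phi> (f (a * g)) (f b * j y)))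
      - psum (\<Delta> h) (\<lambda>a b. psum (cX x) (\<lambda>g y. \<phi> (f (a * g)) (r b y)))
      - psum (\<Delta> h) (\<lambda>a b. psum (cX x) (\<lambda>g y. \<phi> (f (a * g)) (f (\<Gamma> b y))))"
    by (simp add: sum_coaction_act[OF sC \<phi>] \<phi>_diff psum_diff)
  also have "psum (\<Delta> h) (\<lambda>a b. psum (\<Delta> b) (\<lambda>c d. psum (\<Delta> (P (actM a x))) (\<lambda>p q. \<phi> (f (p * c)) (f (q * d)))))
    = psum (\<Delta> (\<Gamma> h x)) (\<lambda>a b. \<phi> (f a) (f b))"
    by (intro sum_comult_Gamma[OF sC] intros)
  finally show ?thesis
    unfolding r_def[of h x] linmap_diff[OF T.comult_linmap[OF sC \<phi> linmap_id]] hx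
    by (simp add: algebra_simps)
qed

section \<open>The condition without coordinates, and its necessity\<close>

definition compatible :: "'h \<Rightarrow> 'm \<Rightarrow> bool" where
  "compatible h x \<longleftrightarrow> tensor_eq sH sH (formal_sum (\<Delta> (\<Gamma> h x)))
     (psum (\<Delta> h) (\<lambda>a b. tens (\<Gamma> a x) b) + psum (\<Delta> h) (\<lambda>a b. psum (cX x) (\<lambda>g y. tens (a * g) (\<Gamma> b y))))"

lemma compatibleD:
  assumes "compatible h x" and sC: "vector_space sC" and \<phi>: "bilinmap sH sH sC \<phi>"
  shows "psum (\<Delta> (\<Gamma> h x)) \<phi> =
    psum (\<Delta> h) (\<lambda>a b. \<phi> (\<Gamma> a x) b) + psum (\<Delta> h) (\<lambda>a b. psum (cX x) (\<lambda>g y. \<phi> (a * g) (\<Gamma> b y)))"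
  using tensor_eqD[OF sC assms(1)[unfolded compatible_def] \<phi>]
  by (simp add: lext2_formal_sum[OF sC] lext_psum[OF sC] lext2_tens[OF sC] lext_add[OF sC])

lemma compatibleI:
  assumes "\<And>\<phi>. bilinmap sH sH (*) \<phi> \<Longrightarrow> psum (\<Delta> (\<Gamma> h x)) \<phi> =
    psum (\<Delta> h) (\<lambda>a b. \<phi> (\<Gamma> a x) b) + psum (\<Delta> h) (\<lambda>a b. psum (cX x) (\<lambda>g y. \<phi> (a * g) (\<Gamma> b y)))"
  shows "compatible h x"
  unfolding compatible_def
  by (rule tensor_eqI)
    (simp add: assms lext2_formal_sum[OF vector_space_field] lext_psum[OF vector_space_field]
      lext2_tens[OF vector_space_field] lext_add[OF vector_space_field])

lemma r_in_J: "r h m \<in> J"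
  using ideal_gen.gen[of 1 UNIV "r h m" "{r h m | h m. True}" 1] by (auto simp: J_eq)

lemma J_two_sided_ideal: "two_sided_ideal J"
  unfolding J_eq by (rule two_sided_ideal_ideal_gen)

lemma J_subspace: "T.subspace J"
  by (rule T.subspace_two_sided_ideal[OF J_two_sided_ideal])

text \<open>Relators with second argument in \<open>H\<close> vanish by \<open>Gamma_iota\<close>,
  so only \<open>KX\<close>, where the coproduct is prescribed, has to be considered.\<close>

lemma r_R: "r h (R m) = r h m"
proof -
  have "r h (\<iota> k) = 0" for k
    using Gamma_iota[of h k]
    by (simp add: r_def f_def[symmetric] f_mult[symmetric] E.\<iota>_hom[symmetric]
        linmap_psum[OF hopf_hom_linmap[OF f_hopf_hom], symmetric] linmap_diff[OF hopf_hom_linmap[OF f_hopf_hom], symmetric])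
       (simp add: \<Gamma>_def E.\<iota>_hom[symmetric] linmap_0[OF hopf_hom_linmap[OF f_hopf_hom]])
  moreover have "linmap sM sT (r h)"
    unfolding r_def by (intro linmap_intros setting_linmap_intros)
  ultimately show ?thesis
    by (simp add: R_def linmap_diff)
qed

text \<open>For a form \<open>\<phi>\<close> on \<open>H\<close>, the form
  \<open>\<phi> (retr a) (retr b)\<close> on \<open>T\<close> vanishes as soon as one argument lies
  in \<open>J\<close>, and it restricts to \<open>\<phi>\<close> along \<open>f\<close>. Evaluated
  on the coproduct of a relator it leaves exactly the part from
  \<open>H \<otimes> H\<close>.\<close>

lemma compatible_if_hopf_ideal:
  assumes J: "hopf_ideal sT \<Delta>T \<epsilon>T ST J" and x: "x \<in> KX"
  shows "compatible h x"
proof (rule compatibleI)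
  fix \<phi> :: "'h \<Rightarrow> 'h \<Rightarrow> 'k" assume \<phi>: "bilinmap sH sH (*) \<phi>"
  note \<phi>_0 = linmap_0[OF bilinmap_left[OF \<phi>]] linmap_0[OF bilinmap_right[OF \<phi>]]
  have bil: "bilinmap sT sT (*) (\<lambda>a b. \<phi> (retr a) (retr b))"
    by (intro linmap_intros retr_linmap bilinmap_compose_left[OF \<phi>] bilinmap_compose_right[OF \<phi>])
  have "psum (\<Delta>T (r h x)) (\<lambda>a b. \<phi> (retr a) (retr b)) = 0"
    by (rule hopf_ideal_psum_eq_0[OF J r_in_J vector_space_field bil]) (auto simp: retr_J \<phi>_0)
  then show "psum (\<Delta> (\<Gamma> h x)) \<phi> =
    psum (\<Delta> h) (\<lambda>a b. \<phi> (\<Gamma> a x) b) + psum (\<Delta> h) (\<lambda>a b. psum (cX x) (\<lambda>g y. \<phi> (a * g) (\<Gamma> b y)))"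
    unfolding comult_r[OF vector_space_field bil x] by (simp add: retr_J[OF r_in_J] \<phi>_0 psum_zero)
qed

text \<open>Applying the counit to the left leg of \<open>x \<otimes> 1 + \<delta>(x)\<close> gives
  \<open>\<epsilon>T (j x)\<close> times 1 plus \<open>j x\<close>, while the counit axiom demands
  \<open>j x\<close>.\<close>

lemma counit_j_KX:
  assumes "x \<in> KX"
  shows "\<epsilon>T (j x) = 0"
proof -
  have "j x = psum (\<Delta>T (j x)) (\<lambda>a b. sT (\<epsilon>T a) b)"
    by (rule T.comult_counit_left[OF linmap_id, symmetric])
  also have "\<dots> = sT (\<epsilon>T (j x)) 1 + psum (cX x) (\<lambda>g y. sT (\<epsilon>T (f g)) (j y))"
    by (intro comult_j_KX[OF T.vector_space_axioms] assms linmap_intros setting_linmap_intros)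
  also have "psum (cX x) (\<lambda>g y. sT (\<epsilon>T (f g)) (j y)) = j x"
    using cX_counit[OF j_linmap[OF linmap_id], of x] R_KX[OF assms] by (simp add: hopf_hom_counit[OF f_hopf_hom])
  finally show ?thesis by simp
qed

text \<open>Under \<open>\<epsilon> \<otimes> \<epsilon>\<close> each of the two sums in the
  compatibility condition becomes \<open>\<epsilon> (\<Gamma> h x)\<close>, as does the left side.
  An equation \<open>e = e + e\<close> forces \<open>e = 0\<close> in every characteristic, and
  \<open>\<epsilon>T (r h x)\<close> is the negative of this value.\<close>

lemma counit_r:
  assumes x: "x \<in> KX" and comp: "compatible h x"
  shows "\<epsilon>T (r h x) = 0"
proof -
  note \<epsilon>T = T.counit_linmap[OF linmap_id] and \<epsilon> = H.counit_linmap[OF linmap_id]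
  note \<epsilon>f = hopf_hom_counit[OF f_hopf_hom]
  have \<epsilon>_Gamma: "\<epsilon> (\<Gamma> h m) = \<epsilon> (P (actM h m))" for h m
  proof -
    have "\<epsilon> (\<Gamma> h m) = psum (\<Delta> h) (\<lambda>a b. \<epsilon> b * \<epsilon> (P (actM a m)))"
      by (simp add: \<Gamma>_def linmap_psum[OF \<epsilon>] H.counit_mult mult.commute)
    also have "\<dots> = \<epsilon> (P (actM h m))"
      by (intro H.comult_counit_right linmap_intros setting_linmap_intros)
    finally show ?thesis .
  qed
  have counit2: "psum (\<Delta> u) (\<lambda>a b. \<epsilon> a * \<epsilon> b) = \<epsilon> u" for u
    by (intro H.comult_counit_left \<epsilon>)
  have "\<epsilon> (\<Gamma> h x) = psum (\<Delta> h) (\<lambda>a b. \<epsilon> (\<Gamma> a x) * \<epsilon> b)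
      + psum (\<Delta> h) (\<lambda>a b. psum (cX x) (\<lambda>g y. \<epsilon> (a * g) * \<epsilon> (\<Gamma> b y)))"
    unfolding counit2[of "\<Gamma> h x", symmetric]
    by (intro compatibleD[OF comp vector_space_field] linmap_intros setting_linmap_intros)
  also have "psum (\<Delta> h) (\<lambda>a b. \<epsilon> (\<Gamma> a x) * \<epsilon> b) = psum (\<Delta> h) (\<lambda>a b. \<epsilon> b * \<epsilon> (\<Gamma> a x))"
    by (simp add: mult.commute)
  also have "\<dots> = \<epsilon> (\<Gamma> h x)"
    by (intro H.comult_counit_right linmap_intros setting_linmap_intros)
  also have "psum (\<Delta> h) (\<lambda>a b. psum (cX x) (\<lambda>g y. \<epsilon> (a * g) * \<epsilon> (\<Gamma> b y)))
    = psum (\<Delta> h) (\<lambda>a b. \<epsilon> a * psum (cX x) (\<lambda>g y. \<epsilon> g * \<epsilon> (\<Gamma> b y)))"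
    by (simp add: psum_mult_left H.counit_mult mult.assoc)
  also have "\<dots> = psum (\<Delta> h) (\<lambda>a b. \<epsilon> a * \<epsilon> (\<Gamma> b (R x)))"
    by (intro psum_cong arg_cong2[where f = "(*)"] refl cX_counit linmap_intros setting_linmap_intros)
  also have "\<dots> = \<epsilon> (\<Gamma> h (R x))"
    by (intro H.comult_counit_left linmap_intros setting_linmap_intros)
  finally have "\<epsilon> (\<Gamma> h x) = 0"
    by (simp only: R_KX[OF x] add_cancel_right_right)
  then have "\<epsilon> (P (actM h x)) = 0"
    by (simp only: \<epsilon>_Gamma)
  have \<epsilon>_j: "\<epsilon>T (j m) = \<epsilon> (P m)" for m
    using counit_j_KX[OF R_in_KX, of m] by (simp add: j_R linmap_diff[OF \<epsilon>T] \<epsilon>f)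
  have "\<epsilon>T (psum (\<Delta> h) (\<lambda>a b. j (actM a x) * f b)) = psum (\<Delta> h) (\<lambda>a b. \<epsilon> b * \<epsilon> (P (actM a x)))"
    by (simp add: linmap_psum[OF \<epsilon>T] T.counit_mult \<epsilon>_j \<epsilon>f mult.commute)
  also have "\<dots> = \<epsilon> (P (actM h x))"
    by (intro H.comult_counit_right linmap_intros setting_linmap_intros)
  finally show ?thesis
    using \<open>\<epsilon> (P (actM h x)) = 0\<close> by (simp add: r_def linmap_diff[OF \<epsilon>T] T.counit_mult counit_j_KX[OF x])
qed

text \<open>
  Applying \<open>S \<otimes> id\<close> to the coproduct of \<open>r h x\<close> and multiplying gives \<open>S(r(h\<^sub>1, x))h\<^sub>2 \<in> J\<close>, from which
  \<open>S(r(h, x))\<close> is recovered by multiplication with \<open>S(h\<^sub>3)\<close>.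
\<close>

lemma antipode_r:
  assumes x: "x \<in> KX" and comp: "\<And>h. compatible h x"
  shows "ST (r h x) \<in> J"
proof -
  define N where "N h = psum (\<Delta> h) (\<lambda>a b. ST (r a x) * f b)" for h
  have J_psum: "(\<And>a b. (a, b) \<in> set xs \<Longrightarrow> \<phi> a b \<in> J) \<Longrightarrow> psum xs \<phi> \<in> J" for xs :: "('a \<times> 'b) list" and \<phi>
    by (rule psum_in_subspace[OF T.vector_space_axioms J_subspace])
  have J_mult: "a * y \<in> J" "y * a \<in> J" if "y \<in> J" for a y
    using J_two_sided_ideal that by (auto simp: two_sided_ideal_def)
  have r_lin: "linmap s sH g \<Longrightarrow> linmap s sT (\<lambda>h. r (g h) x)" for s :: "'k \<Rightarrow> 'h \<Rightarrow> 'h" and g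
    unfolding r_def by (intro linmap_intros setting_linmap_intros; assumption)
  have "N h \<in> J" for h
  proof -
    have bil: "bilinmap sT sT sT (\<lambda>a b. ST a * b)"
      by (intro linmap_intros setting_linmap_intros)
    \<comment> \<open>The relator has counit zero, so the antipode axiom annihilates its whole
      coproduct.\<close>
    have "psum (\<Delta>T (r h x)) (\<lambda>a b. ST a * b) = 0"
      by (simp add: T.antipode_left_psum counit_r[OF x comp])
    \<comment> \<open>Compatibility, evaluated on the \<open>T\<close>-valued map
      \<open>ST (f a) * f b\<close>, removes the part of \<open>comult_r\<close> that comes from
      \<open>H \<otimes> H\<close>.\<close>
    moreover have "psum (\<Delta> (\<Gamma> h x)) (\<lambda>a b. ST (f a) * f b) = psum (\<Delta> h) (\<lambda>a b. ST (f (\<Gamma> a x)) * f b)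
        + psum (\<Delta> h) (\<lambda>a b. psum (cX x) (\<lambda>g y. ST (f (a * g)) * f (\<Gamma> b y)))"
      by (intro compatibleD[OF comp T.vector_space_axioms] linmap_intros setting_linmap_intros)
    ultimately have "N h = - psum (\<Delta> h) (\<lambda>a b. psum (cX x) (\<lambda>g y. ST (f (a * g)) * r b y))"
      unfolding comult_r[OF T.vector_space_axioms bil x] N_def by (simp add: eq_neg_iff_add_eq_0)
    moreover have "psum (\<Delta> h) (\<lambda>a b. psum (cX x) (\<lambda>g y. ST (f (a * g)) * r b y)) \<in> J"
      by (intro J_psum J_mult r_in_J)
    ultimately show ?thesis
      by (simp add: T.subspace_neg[OF J_subspace])
  qed
  then have "psum (\<Delta> h) (\<lambda>y c. N y * f (S c)) \<in> J"
    by (intro J_psum J_mult)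
  also have "psum (\<Delta> h) (\<lambda>y c. N y * f (S c)) = psum (\<Delta> h) (\<lambda>y c. psum (\<Delta> y) (\<lambda>a b. ST (r a x) * f b * f (S c)))"
    by (simp add: N_def psum_mult_right)
  also have "\<dots> = psum (\<Delta> h) (\<lambda>a y. psum (\<Delta> y) (\<lambda>b c. ST (r a x) * f b * f (S c)))"
    by (intro H.comult_coassoc[OF T.vector_space_axioms, symmetric] linmap_intros setting_linmap_intros r_lin)
  also have "\<dots> = psum (\<Delta> h) (\<lambda>a y. sT (\<epsilon> y) (ST (r a x)))"
    by (simp add: mult.assoc f_mult[symmetric] psum_mult_left[symmetric] H.antipode_right_psum
        linmap_psum[OF hopf_hom_linmap[OF f_hopf_hom], symmetric] linmap_scale[OF hopf_hom_linmap[OF f_hopf_hom]]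
        hopf_hom_one[OF f_hopf_hom] T.scale_mult_right)
  also have "\<dots> = ST (r h x)"
    by (intro H.comult_counit_right linmap_intros setting_linmap_intros r_lin)
  finally show ?thesis .
qed

lemma hopf_ideal_if_compatible:
  assumes comp: "\<And>h x. x \<in> KX \<Longrightarrow> compatible h x"
  shows "hopf_ideal sT \<Delta>T \<epsilon>T ST J"
  unfolding hopf_ideal_def
proof (intro conjI ballI)
  show "two_sided_ideal J"
    by (rule J_two_sided_ideal)
  have J_mult: "a * y \<in> J" "y * a \<in> J" if "y \<in> J" for a y
    using J_two_sided_ideal that by (auto simp: two_sided_ideal_def)
  fix t assume "t \<in> J"
  then have t: "t \<in> ideal_gen UNIV {r h m | h m. True}"
    by (simp add: J_eq)
  have comult: "psum (\<Delta>T t) \<phi> = 0"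
    if "bilinmap sT sT (*) \<phi>" "\<And>a b. a \<in> J \<or> b \<in> J \<Longrightarrow> \<phi> a b = 0" for \<phi> :: "'t \<Rightarrow> 't \<Rightarrow> 'k"
    using t that
  proof (induction arbitrary: \<phi> rule: ideal_gen.induct)
    case zero
    then show ?case by (simp add: linmap_0[OF T.comult_linmap[OF vector_space_field _ linmap_id]])
  next
    case (add x y)
    then show ?case by (simp add: linmap_add[OF T.comult_linmap[OF vector_space_field _ linmap_id]])
  next
    case (gen a z c)
    then obtain h m where z: "z = r h m" by blast
    note lin = bilinmap_compose_left[OF gen.prems(1)] bilinmap_compose_right[OF gen.prems(1)]
    \<comment> \<open>The legs of the outer factors are held fixed and absorbed into a form
      \<open>\<psi>\<close>, which still vanishes when one argument is in \<open>J\<close>, because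
      \<open>J\<close> is two-sided. A bare relator with second argument in \<open>KX\<close>
      remains.\<close>
    have "psum (\<Delta>T z) (\<lambda>z1 z2. \<phi> (a1 * (z1 * c1)) (a2 * (z2 * c2))) = 0" for a1 a2 c1 c2
    proof -
      define \<psi> where "\<psi> z1 z2 = \<phi> (a1 * (z1 * c1)) (a2 * (z2 * c2))" for z1 z2
      have bil: "bilinmap sT sT (*) \<psi>"
        unfolding \<psi>_def by (intro linmap_intros setting_linmap_intros lin)
      have bil_f: "bilinmap sH sH (*) (\<lambda>a b. \<psi> (f a) (f b))"
        unfolding \<psi>_def by (intro linmap_intros setting_linmap_intros lin)
      have \<psi>_0: "\<psi> u v = 0" if "u \<in> J \<or> v \<in> J" for u v
        unfolding \<psi>_def using gen.prems(2) that J_mult by blast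
      have "psum (\<Delta>T (r h (R m))) \<psi> = 0"
        unfolding comult_r[OF vector_space_field bil R_in_KX] compatibleD[OF comp[OF R_in_KX] vector_space_field bil_f]
        by (simp add: \<psi>_0 r_in_J psum_zero)
      then show ?thesis
        by (simp add: r_R z \<psi>_def[abs_def])
    qed
    moreover have "psum (\<Delta>T (a * (z * c))) \<phi> = psum (\<Delta>T a) (\<lambda>a1 a2. psum (\<Delta>T (z * c)) (\<lambda>u v. \<phi> (a1 * u) (a2 * v)))"
      by (rule T.comult_mult_psum[OF vector_space_field gen.prems(1)])
    moreover have "psum (\<Delta>T (z * c)) (\<lambda>u v. \<phi> (a1 * u) (a2 * v))
      = psum (\<Delta>T z) (\<lambda>z1 z2. psum (\<Delta>T c) (\<lambda>c1 c2. \<phi> (a1 * (z1 * c1)) (a2 * (z2 * c2))))" for a1 a2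
      by (intro T.comult_mult_psum[OF vector_space_field] linmap_intros setting_linmap_intros lin)
    ultimately show ?case
      by (simp add: psum_swap[of "\<Delta>T z"] psum_zero mult.assoc)
  qed
  show "\<exists>ps. set ps \<subseteq> J \<times> UNIV \<union> UNIV \<times> J \<and> tensor_eq sT sT (formal_sum (\<Delta>T t)) (formal_sum ps)"
  proof (rule tensor_eq_formal_sumI)
    show "lext2 (*) \<phi> (formal_sum (\<Delta>T t)) = 0"
      if "bilinmap sT sT (*) \<phi>" "\<And>a b. (a, b) \<in> J \<times> UNIV \<union> UNIV \<times> J \<Longrightarrow> \<phi> a b = 0" for \<phi>
      using comult[OF that(1)] that(2) by (auto simp: lext2_formal_sum[OF vector_space_field])
  qed (auto simp: T.subspace_scale[OF J_subspace])
  show "\<epsilon>T t = 0"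
    using t
  proof (induction rule: ideal_gen.induct)
    case (gen a z c)
    then obtain h m where "z = r h (R m)"
      by (auto simp: r_R)
    then show ?case
      by (simp add: T.counit_mult counit_r[OF R_in_KX comp[OF R_in_KX]])
  qed (simp_all add: linmap_0[OF T.counit_linmap[OF linmap_id]] linmap_add[OF T.counit_linmap[OF linmap_id]])
  show "ST t \<in> J"
    using t
  proof (induction rule: ideal_gen.induct)
    case (gen a z c)
    then obtain h m where "z = r h (R m)"
      by (auto simp: r_R)
    then show ?case
      by (simp add: T.antipode_mult J_mult antipode_r[OF R_in_KX comp[OF R_in_KX]])
  qed (simp_all add: linmap_0[OF T.antipode_linmap[OF linmap_id]] linmap_add[OF T.antipode_linmap[OF linmap_id]]
      T.subspace_0[OF J_subspace] T.subspace_add[OF J_subspace])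
qed

end

section \<open>The coradical of the quotient\<close>

context hopf_extension
begin

text \<open>The factor \<open>m\<close> ranges over all of \<open>M\<close>; taking
  \<open>m = \<iota> 1\<close> makes the filtration increasing. The trailing factor
  \<open>f h\<close> makes each step stable under right multiplication by \<open>H\<close>.\<close>

fun filt :: "nat \<Rightarrow> 't set" where
  "filt 0 = range f"
| "filt (Suc n) = T.span {a * j m * f h | a m h. a \<in> filt n}"

lemma filt_subspace: "T.subspace (filt n)"
proof (cases n)
  case 0
  interpret f: module_hom sH sT f
    using linmap_imp_linear[OF H.vector_space_axioms T.vector_space_axioms hopf_hom_linmap[OF f_hopf_hom]]
    by (simp add: linear_iff_module_hom)
  show ?thesis
    using f.subspace_image[of UNIV] 0 by simp
qed simp

lemma f_1: "f 1 = 1"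
  by (rule hopf_hom_one[OF f_hopf_hom])

lemma filt_SucI: "a \<in> filt n \<Longrightarrow> a * (j m * f h) \<in> filt (Suc n)"
  by (auto intro!: T.span_base simp: mult.assoc)

lemma filt_mono: "filt n \<subseteq> filt (Suc n)"
proof
  fix a assume "a \<in> filt n"
  then have "a * (j (\<iota> 1) * f 1) \<in> filt (Suc n)"
    by (rule filt_SucI)
  then show "a \<in> filt (Suc n)"
    by (simp add: f_def[symmetric] f_1)
qed

text \<open>Needed because the coproduct of \<open>j m * f h\<close> places factors from
  \<open>H\<close> on the right of both legs.\<close>

lemma filt_mult_f: "a \<in> filt n \<Longrightarrow> a * f k \<in> filt n"
proof (cases n)
  case 0
  then show "a \<in> filt n \<Longrightarrow> a * f k \<in> filt n"
    by (auto simp: f_mult[symmetric])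
next
  case (Suc m)
  assume "a \<in> filt n"
  then have "a \<in> T.span {a * j x * f h | a x h. a \<in> filt m}"
    using Suc by simp
  then have "a * f k \<in> T.span {a * j x * f h | a x h. a \<in> filt m}"
  proof (induction rule: T.span_induct_alt)
    case base
    show ?case by (simp add: T.span_zero)
  next
    case (step c y z)
    then obtain a x h where y: "y = a * j x * f h" "a \<in> filt m" by blast
    then have "y * f k = a * j x * f (h * k)"
      by (simp add: mult.assoc f_mult)
    then have "y * f k \<in> T.span {a * j x * f h | a x h. a \<in> filt m}"
      using y(2) by (auto intro!: T.span_base)
    then show ?case
      using step.IH by (simp add: distrib_right T.scale_mult_left T.span_add T.span_scale)
  qed
  then show "a * f k \<in> filt n"
    using Suc by simp
qed

lemma prod_list_in_filt: "prod_list (map j ms) \<in> filt (length ms)"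
proof (induction ms rule: rev_induct)
  case Nil
  have "f 1 \<in> filt 0" by simp
  then show ?case by (simp add: f_1)
next
  case (snoc m ms)
  then show ?case
    using filt_SucI[of "prod_list (map j ms)" "length ms" m 1] by (simp add: f_1)
qed

lemma filt_exhaust: "\<exists>n. t \<in> filt n"
proof -
  have mono: "filt n \<subseteq> filt m" if "n \<le> m" for n m
    using lift_Suc_mono_le[of filt, OF filt_mono that] .
  have "t \<in> T.span (range (\<lambda>ms. prod_list (map j ms)))"
    by (simp add: span_words)
  then show ?thesis
  proof (induction rule: T.span_induct_alt)
    case base
    show ?case using T.subspace_0[OF filt_subspace] by blast
  next
    case (step c x y)
    then obtain n m where "x \<in> filt n" "y \<in> filt m"
      using prod_list_in_filt by blast
    then have "x \<in> filt (max n m)" "y \<in> filt (max n m)"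
      using mono[of n "max n m"] mono[of m "max n m"] by auto
    then have "sT c x + y \<in> filt (max n m)"
      by (intro T.subspace_add T.subspace_scale filt_subspace)
    then show ?case by blast
  qed
qed

text \<open>In the coproduct of a further factor \<open>j m * f h\<close>, the term from
  \<open>x \<otimes> 1\<close> raises the degree of the left leg by one, the coaction raises that of
  the right leg, and the \<open>H\<close>-component raises neither.\<close>

lemma filt_comult:
  assumes "t \<in> filt n" "bilinmap sT sT (*) \<phi>"
    and "\<And>i a b. i \<le> n \<Longrightarrow> a \<in> filt i \<Longrightarrow> b \<in> filt (n - i) \<Longrightarrow> \<phi> a b = 0"
  shows "psum (\<Delta>T t) \<phi> = 0"
  using assms
proof (induction n arbitrary: t \<phi>)
  case 0
  then obtain h where "t = f h" by auto
  then show ?case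
    using 0(3)[of 0] by (simp add: f_comult[OF vector_space_field 0(2)] psum_zero)
next
  case (Suc n)
  note \<phi> = Suc.prems(2) and vanish = Suc.prems(3)
  note lin = bilinmap_compose_left[OF \<phi>] bilinmap_compose_right[OF \<phi>]
  have gen: "psum (\<Delta>T t) \<phi> = 0" if t: "t \<in> {a * j m * f h | a m h. a \<in> filt n}" for t
  proof -
    obtain a m h where t: "t = a * (j m * f h)" "a \<in> filt n"
      using t by (auto simp: mult.assoc)
    define \<chi> where "\<chi> a1 a2 = psum (\<Delta>T (j m * f h)) (\<lambda>u v. \<phi> (a1 * u) (a2 * v))" for a1 a2
    have \<chi>: "\<chi> a1 a2 = psum (\<Delta> h) (\<lambda>c d. \<phi> (a1 * (j (R m) * f c)) (a2 * f d)
        + psum (cX m) (\<lambda>g y. \<phi> (a1 * f (g * c)) (a2 * (j y * f d)))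
        + psum (\<Delta> (P m)) (\<lambda>p q. \<phi> (a1 * f (p * c)) (a2 * f (q * d))))" for a1 a2
      unfolding \<chi>_def by (intro comult_j_f[OF vector_space_field] linmap_intros setting_linmap_intros lin)
    have "psum (\<Delta>T a) \<chi> = 0"
    proof (rule Suc.IH[OF t(2)])
      show "bilinmap sT sT (*) \<chi>"
        unfolding \<chi>_def[abs_def] by (intro linmap_intros setting_linmap_intros lin)
      show "\<chi> a1 a2 = 0" if i: "i \<le> n" and a: "a1 \<in> filt i" "a2 \<in> filt (n - i)" for i a1 a2
      proof -
        have "\<phi> (a1 * (j (R m) * f c)) (a2 * f d) = 0" for c d
          using vanish[of "Suc i"] filt_SucI[OF a(1)] filt_mult_f[OF a(2)] i by simp
        moreover have "\<phi> (a1 * f k) (a2 * (j y * f d)) = 0" for k y d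
          using vanish[of i] filt_SucI[OF a(2)] filt_mult_f[OF a(1)] i by (simp add: Suc_diff_le)
        \<comment> \<open>Here the total degree is only \<open>n\<close>; monotonicity in the right
          leg supplies the missing unit.\<close>
        moreover have "\<phi> (a1 * f k) (a2 * f d) = 0" for k d
          using vanish[of i "a1 * f k" "a2 * f d"] filt_mult_f[OF a(2)] filt_mult_f[OF a(1)] i
            filt_mono[of "n - i"] by (auto simp: Suc_diff_le simp del: filt.simps)
        ultimately show ?thesis
          by (simp add: \<chi> psum_zero)
      qed
    qed
    then show ?thesis
      by (simp add: t(1) T.comult_mult_psum[OF vector_space_field \<phi>] \<chi>_def[abs_def])
  qed
  show ?case
    by (rule linmap_eq_0_on_span[OF T.vector_space_axioms vector_space_field
          T.comult_linmap[OF vector_space_field \<phi> linmap_id] gen])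
      (use Suc.prems(1) in simp_all)
qed

lemma quotient_hopf_structure:
  fixes sQ :: "'k \<Rightarrow> 'q::ring_1 \<Rightarrow> 'q"
  assumes J: "hopf_ideal sT \<Delta>T \<epsilon>T ST J" and quot: "is_quotient_algebra sT J sQ p"
  shows "\<exists>\<Delta>Q \<epsilon>Q SQ. hopf_algebra sQ \<Delta>Q \<epsilon>Q SQ \<and> hopf_hom sT \<Delta>T \<epsilon>T ST sQ \<Delta>Q \<epsilon>Q SQ p \<and>
    hopf_embedding sH \<Delta> \<epsilon> S sQ \<Delta>Q \<epsilon>Q SQ (p \<circ> j \<circ> \<iota>) \<and>
    coradical sQ \<Delta>Q = (p \<circ> j \<circ> \<iota>) ` coradical sH \<Delta>"
proof -
  obtain \<Delta>Q \<epsilon>Q SQ where Q_hopf: "hopf_algebra sQ \<Delta>Q \<epsilon>Q SQ" and p: "hopf_hom sT \<Delta>T \<epsilon>T ST sQ \<Delta>Q \<epsilon>Q SQ p"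
    using hopf_algebra_quotient[OF T.hopf_algebra_axioms J quot] by blast
  interpret Q: hopf_algebra sQ \<Delta>Q \<epsilon>Q SQ by fact
  have surj: "surj p" and ker: "p t = 0 \<longleftrightarrow> t \<in> J" for t
    using quot by (auto simp: is_quotient_algebra_def)
  have comp: "p \<circ> j \<circ> \<iota> = p \<circ> f"
    by (simp add: fun_eq_iff f_def)
  have pf: "hopf_hom sH \<Delta> \<epsilon> S sQ \<Delta>Q \<epsilon>Q SQ (p \<circ> f)"
    by (rule hopf_hom_compose[OF Q.vector_space_axioms f_hopf_hom p])
  \<comment> \<open>The retraction vanishes on \<open>J\<close>, so it factors through the quotient;
    \<open>g\<close> is the resulting linear left inverse of \<open>p \<circ> f\<close>.\<close>
  define g where "g q = retr (inv p q)" for q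
  have g_p: "g (p t) = retr t" for t
  proof -
    have "inv p (p t) - t \<in> J"
      using surj by (simp add: ker[symmetric] linmap_diff[OF hopf_hom_linmap[OF p]] surj_f_inv_f)
    then have "retr (inv p (p t) - t) = 0"
      by (rule retr_J)
    then show ?thesis
      by (simp add: g_def linmap_diff[OF retr_linmap[OF linmap_id]])
  qed
  have g_pf: "g ((p \<circ> f) h) = h" for h
    by (simp add: g_p)
  have "linmap sQ sH g"
  proof (rule linmapI)
    fix q q' c
    obtain t t' where t: "q = p t" "q' = p t'"
      using surj by (metis surjD)
    show "g (q + q') = g q + g q'"
      by (simp add: t linmap_add[OF hopf_hom_linmap[OF p], symmetric] g_p linmap_add[OF retr_linmap[OF linmap_id]])
    show "g (sQ c q) = sH c (g q)"
      by (simp add: t linmap_scale[OF hopf_hom_linmap[OF p], symmetric] g_p linmap_scale[OF retr_linmap[OF linmap_id]])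
  qed
  have "coradical sQ \<Delta>Q = (p \<circ> f) ` coradical sH \<Delta>"
  proof (rule coradical_image[OF H.coalgebra_axioms Q.coalgebra_axioms hopf_hom_linmap[OF pf] \<open>linmap sQ sH g\<close> g_pf])
    show "psum (\<Delta>Q ((p \<circ> f) x)) \<phi> = psum (\<Delta> x) (\<lambda>a b. \<phi> ((p \<circ> f) a) ((p \<circ> f) b))"
      if "bilinmap sQ sQ (*) \<phi>" for \<phi> :: "'q \<Rightarrow> 'q \<Rightarrow> 'k" and x
      by (rule hopf_hom_comult[OF pf vector_space_field that])
    interpret p: module_hom sT sQ p
      using linmap_imp_linear[OF T.vector_space_axioms Q.vector_space_axioms hopf_hom_linmap[OF p]]
      by (simp add: linear_iff_module_hom)
    fix D assume D: "simple_subcoalgebra sQ \<Delta>Q D"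
    \<comment> \<open>The filtration of \<open>T\<close> is pushed forward along the surjective
      coalgebra map \<open>p\<close>; its degree-zero part becomes the image of
      \<open>p \<circ> f\<close>.\<close>
    have "D \<subseteq> p ` filt 0"
    proof (rule Q.simple_subcoalgebra_subset_filtration[where A = "\<lambda>n. p ` filt n", OF _ _ _ _ D])
      show "Q.subspace (p ` filt n)" for n
        by (rule p.subspace_image[OF filt_subspace])
      show "p ` filt n \<subseteq> p ` filt (Suc n)" for n
        by (rule image_mono[OF filt_mono])
      show "\<exists>n. q \<in> p ` filt n" for q
        using surj filt_exhaust by (metis imageI surjD)
      show "psum (\<Delta>Q q) \<phi> = 0"
        if q: "q \<in> p ` filt n" and \<phi>: "bilinmap sQ sQ (*) \<phi>"
          and vanish: "\<And>i a b. i \<le> n \<Longrightarrow> a \<in> p ` filt i \<Longrightarrow> b \<in> p ` filt (n - i) \<Longrightarrow> \<phi> a b = 0"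
        for n q and \<phi> :: "'q \<Rightarrow> 'q \<Rightarrow> 'k"
      proof -
        obtain t where t: "q = p t" "t \<in> filt n"
          using q by blast
        have "bilinmap sT sT (*) (\<lambda>a b. \<phi> (p a) (p b))"
          by (intro linmap_intros bilinmap_compose_left[OF \<phi>] bilinmap_compose_right[OF \<phi>] hopf_hom_linmap[OF p])
        from filt_comult[OF t(2) this] show ?thesis
          using vanish by (simp add: t(1) hopf_hom_comult[OF p vector_space_field \<phi>])
      qed
    qed
    then show "D \<subseteq> range (p \<circ> f)"
      by (simp add: image_comp)
  qed
  moreover have "inj (p \<circ> f)"
    by (rule inj_on_inverseI[of _ g]) (rule g_pf)
  ultimately show ?thesis
    using Q_hopf p pf by (auto simp: comp hopf_embedding_def)
qed

section \<open>Translation of the condition into the coefficients\<close>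

context
  fixes b :: "'h \<Rightarrow> 'h \<Rightarrow> 'm \<Rightarrow> 'k"
  assumes b: "action_coefficients sH actV sM actM \<iota> \<pi> X B b"
begin

text \<open>\<open>P\<close> kills the lifted component of \<open>h \<cdot> x\<close>, which lies in
  \<open>KX\<close>, so \<open>P (actM h x)\<close> is the basis expansion with coefficients
  \<open>b t h x\<close>. This is how the basis disappears from the condition.\<close>

lemma sum_coefficients:
  assumes L: "linmap sH (*) L" and x: "x \<in> KX"
  shows "(\<Sum>t | t \<in> B \<and> b t h x \<noteq> 0. b t h x * L t) = L (P (actM h x))"
proof -
  have "actM h x = lift_V sM X \<pi> (actV h (\<pi> x)) + \<iota> (\<Sum>t | t \<in> B \<and> b t h x \<noteq> 0. sH (b t h x) t)"
    using b x by (simp add: action_coefficients_def)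
  then have "P (actM h x) = (\<Sum>t | t \<in> B \<and> b t h x \<noteq> 0. sH (b t h x) t)"
    by (simp add: linmap_add[OF P_linmap[OF linmap_id]] P_KX lift_in_KX)
  then show ?thesis
    by (simp add: linmap_sum[OF L] linmap_scale[OF L])
qed

text \<open>Evaluated on forms, each sum over the basis becomes a value of \<open>P\<close>;
  coassociativity and multiplicativity of \<open>\<Delta>\<close> then assemble the threefold
  coproducts into \<Gamma>.\<close>

lemma compatible_iff:
  assumes x: "x \<in> KX"
  shows "compatible h x \<longleftrightarrow>
    tensor_eq sH sH
      (\<Sum>(h1, h2, h3)\<leftarrow>comult3 \<Delta> h. \<Sum>t | t \<in> B \<and> b t h1 x \<noteq> 0. \<Sum>(t1, t2)\<leftarrow>\<Delta> t.
         tens (sH (b t h1 x) (t1 * h2)) (t2 * h3))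
      ((\<Sum>(h1, h2, h3)\<leftarrow>comult3 \<Delta> h. \<Sum>t | t \<in> B \<and> b t h1 x \<noteq> 0.
         tens (sH (b t h1 x) (t * h2)) h3)
       + (\<Sum>(h1, h2, h3)\<leftarrow>comult3 \<Delta> h. \<Sum>(g, y)\<leftarrow>cX x.
            \<Sum>t | t \<in> B \<and> b t h2 y \<noteq> 0.
              tens (h1 * g) (sH (b t h2 y) (t * h3))))"
    (is "_ \<longleftrightarrow> tensor_eq sH sH ?u (?v + ?w)")
proof -
  note ev = lext_add[OF vector_space_field] lext_psum[OF vector_space_field] lext_sum[OF vector_space_field]
    lext2_tens[OF vector_space_field] lext2_formal_sum[OF vector_space_field]
  have forms: "lext2 (*) \<phi> ?u = psum (\<Delta> (\<Gamma> h x)) \<phi>"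
    "lext2 (*) \<phi> ?v = psum (\<Delta> h) (\<lambda>a b. \<phi> (\<Gamma> a x) b)"
    "lext2 (*) \<phi> ?w = psum (\<Delta> h) (\<lambda>a b. psum (cX x) (\<lambda>g y. \<phi> (a * g) (\<Gamma> b y)))"
    if \<phi>: "bilinmap sH sH (*) \<phi>" for \<phi> :: "'h \<Rightarrow> 'h \<Rightarrow> 'k"
  proof -
    note lin = bilinmap_compose_left[OF \<phi>] bilinmap_compose_right[OF \<phi>]
    note intros = linmap_intros setting_linmap_intros lin
    note \<phi>_scale = linmap_scale[OF bilinmap_left[OF \<phi>]] linmap_scale[OF bilinmap_right[OF \<phi>]]
    have inner: "lext2 (*) \<phi> (\<Sum>(t1, t2)\<leftarrow>xs. tens (sH c (t1 * h2)) (t2 * h3))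
        = c * psum xs (\<lambda>t1 t2. \<phi> (t1 * h2) (t2 * h3))" for xs c h2 h3
      unfolding psum_def[symmetric] by (simp add: ev \<phi>_scale psum_mult_left)
    have "lext2 (*) \<phi> ?u = psum (\<Delta> h) (\<lambda>h1 y. psum (\<Delta> y) (\<lambda>h2 h3.
        \<Sum>t | t \<in> B \<and> b t h1 x \<noteq> 0. b t h1 x * psum (\<Delta> t) (\<lambda>t1 t2. \<phi> (t1 * h2) (t2 * h3))))"
      unfolding psum_comult3 by (simp add: ev inner)
    also have "\<dots> = psum (\<Delta> h) (\<lambda>h1 y. psum (\<Delta> y) (\<lambda>h2 h3.
        psum (\<Delta> (P (actM h1 x))) (\<lambda>t1 t2. \<phi> (t1 * h2) (t2 * h3))))"
      by (intro psum_cong sum_coefficients[OF _ x] intros)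
    also have "\<dots> = psum (\<Delta> (\<Gamma> h x)) \<phi>"
      by (rule sum_comult_Gamma[OF vector_space_field \<phi>])
    finally show "lext2 (*) \<phi> ?u = psum (\<Delta> (\<Gamma> h x)) \<phi>" .
    have "lext2 (*) \<phi> ?v = psum (\<Delta> h) (\<lambda>h1 y. psum (\<Delta> y) (\<lambda>h2 h3.
        \<Sum>t | t \<in> B \<and> b t h1 x \<noteq> 0. b t h1 x * \<phi> (t * h2) h3))"
      unfolding psum_comult3 by (simp add: ev \<phi>_scale)
    also have "\<dots> = psum (\<Delta> h) (\<lambda>h1 y. psum (\<Delta> y) (\<lambda>h2 h3. \<phi> (P (actM h1 x) * h2) h3))"
      by (intro psum_cong sum_coefficients[OF _ x] intros)
    also have "\<dots> = psum (\<Delta> h) (\<lambda>y h3. psum (\<Delta> y) (\<lambda>h1 h2. \<phi> (P (actM h1 x) * h2) h3))"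
      by (intro H.comult_coassoc[OF vector_space_field] intros)
    finally show "lext2 (*) \<phi> ?v = psum (\<Delta> h) (\<lambda>a b. \<phi> (\<Gamma> a x) b)"
      by (simp add: \<Gamma>_def linmap_psum[OF bilinmap_left[OF \<phi>]])
    have inner_coaction: "lext2 (*) \<phi> (\<Sum>(g, y)\<leftarrow>xs. \<Sum>t | t \<in> B \<and> b t h2 y \<noteq> 0.
        tens (h1 * g) (sH (b t h2 y) (t * h3)))
      = psum xs (\<lambda>g y. \<Sum>t | t \<in> B \<and> b t h2 y \<noteq> 0. b t h2 y * \<phi> (h1 * g) (t * h3))" for xs h1 h2 h3
      unfolding psum_def[symmetric] by (simp add: ev \<phi>_scale)
    have "lext2 (*) \<phi> ?w = psum (\<Delta> h) (\<lambda>h1 z. psum (\<Delta> z) (\<lambda>h2 h3. psum (cX x) (\<lambda>g y.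
        \<Sum>t | t \<in> B \<and> b t h2 y \<noteq> 0. b t h2 y * \<phi> (h1 * g) (t * h3))))"
      unfolding psum_comult3 by (simp add: ev inner_coaction)
    also have "\<dots> = psum (\<Delta> h) (\<lambda>h1 z. psum (\<Delta> z) (\<lambda>h2 h3. psum (cX x) (\<lambda>g y.
        \<phi> (h1 * g) (P (actM h2 y) * h3))))"
      \<comment> \<open>The coefficients describe the action on \<open>KX\<close> only, and the
        right legs of the transported coaction lie there.\<close>
      by (intro psum_cong sum_coefficients[OF _ cX_in_KX] intros)
    also have "\<dots> = psum (\<Delta> h) (\<lambda>h1 z. psum (cX x) (\<lambda>g y. psum (\<Delta> z) (\<lambda>h2 h3.
        \<phi> (h1 * g) (P (actM h2 y) * h3))))"
      by (intro psum_cong psum_swap)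
    finally show "lext2 (*) \<phi> ?w = psum (\<Delta> h) (\<lambda>a b. psum (cX x) (\<lambda>g y. \<phi> (a * g) (\<Gamma> b y)))"
      by (simp add: \<Gamma>_def linmap_psum[OF bilinmap_right[OF \<phi>]])
  qed
  show ?thesis
    unfolding compatible_def tensor_eq_iff by (simp add: ev forms)
qed

end

end

theorem proposition2p4:
  fixes sH :: "'k::field \<Rightarrow> 'h::ring_1 \<Rightarrow> 'h"
    and \<Delta> :: "'h \<Rightarrow> ('h \<times> 'h) list" and \<epsilon> :: "'h \<Rightarrow> 'k" and S :: "'h \<Rightarrow> 'h"
    and sV :: "'k \<Rightarrow> 'v::ab_group_add \<Rightarrow> 'v"
    and actV :: "'h \<Rightarrow> 'v \<Rightarrow> 'v" and \<delta> :: "'v \<Rightarrow> ('h \<times> 'v) list"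
    and sM :: "'k \<Rightarrow> 'm::ab_group_add \<Rightarrow> 'm" and actM :: "'h \<Rightarrow> 'm \<Rightarrow> 'm"
    and \<iota> :: "'h \<Rightarrow> 'm" and \<pi> :: "'m \<Rightarrow> 'v"
    and X :: "'m set" and B :: "'h set" and b :: "'h \<Rightarrow> 'h \<Rightarrow> 'm \<Rightarrow> 'k"
    and sT :: "'k \<Rightarrow> 't::ring_1 \<Rightarrow> 't" and j :: "'m \<Rightarrow> 't"
    and \<Delta>T :: "'t \<Rightarrow> ('t \<times> 't) list" and \<epsilon>T :: "'t \<Rightarrow> 'k" and ST :: "'t \<Rightarrow> 't"
  assumes "hopf_algebra sH \<Delta> \<epsilon> S" and "bij S"
    and "yetter_drinfeld sH \<Delta> \<epsilon> S sV actV \<delta>"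
    and "module_extension sH \<Delta> \<epsilon> S sV actV sM actM \<iota> \<pi>"
    and "complement_basis sM \<iota> X"
    and "is_basis sH B" and "1 \<in> B"
    and "action_coefficients sH actV sM actM \<iota> \<pi> X B b"
    and "is_TH sH sM \<iota> X B sT j"
    and "TH_hopf_structure sH \<Delta> \<epsilon> S \<delta> sM \<iota> \<pi> X sT j \<Delta>T \<epsilon>T ST"
  shows "(hopf_ideal sT \<Delta>T \<epsilon>T ST (J_ideal \<Delta> actM \<iota> j) \<longleftrightarrow>
      (\<forall>h. \<forall>x\<in>module.span sM X.
        tensor_eq sH sH
          (\<Sum>(h1, h2, h3)\<leftarrow>comult3 \<Delta> h. \<Sum>t | t \<in> B \<and> b t h1 x \<noteq> 0. \<Sum>(t1, t2)\<leftarrow>\<Delta> t.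
             tens (sH (b t h1 x) (t1 * h2)) (t2 * h3))
          ((\<Sum>(h1, h2, h3)\<leftarrow>comult3 \<Delta> h. \<Sum>t | t \<in> B \<and> b t h1 x \<noteq> 0.
             tens (sH (b t h1 x) (t * h2)) h3)
           + (\<Sum>(h1, h2, h3)\<leftarrow>comult3 \<Delta> h. \<Sum>(g, y)\<leftarrow>coaction_X sM X \<pi> \<delta> x.
                \<Sum>t | t \<in> B \<and> b t h2 y \<noteq> 0.
                  tens (h1 * g) (sH (b t h2 y) (t * h3))))))
    \<and> (hopf_ideal sT \<Delta>T \<epsilon>T ST (J_ideal \<Delta> actM \<iota> j) \<longrightarrow>
      (\<forall>(sQ :: 'k \<Rightarrow> 'q::ring_1 \<Rightarrow> 'q) (p :: 't \<Rightarrow> 'q).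
        is_quotient_algebra sT (J_ideal \<Delta> actM \<iota> j) sQ p \<longrightarrow>
        (\<exists>\<Delta>Q \<epsilon>Q SQ.
           hopf_algebra sQ \<Delta>Q \<epsilon>Q SQ \<and>
           hopf_hom sT \<Delta>T \<epsilon>T ST sQ \<Delta>Q \<epsilon>Q SQ p \<and>
           hopf_embedding sH \<Delta> \<epsilon> S sQ \<Delta>Q \<epsilon>Q SQ (p \<circ> j \<circ> \<iota>) \<and>
           coradical sQ \<Delta>Q = (p \<circ> j \<circ> \<iota>) ` coradical sH \<Delta>)))"
proof -
  interpret hopf_extension sH \<Delta> \<epsilon> S sV actV \<delta> sM actM \<iota> \<pi> X B sT j \<Delta>T \<epsilon>T ST
    by (intro hopf_extension.intro assms)
  have iff: "hopf_ideal sT \<Delta>T \<epsilon>T ST J \<longleftrightarrow> (\<forall>h. \<forall>x\<in>KX. compatible h x)"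
    using compatible_if_hopf_ideal hopf_ideal_if_compatible by blast
  show ?thesis
  proof (intro conjI impI allI, goal_cases)
    case 1
    show ?case
      using iff by (simp add: compatible_iff[OF assms(8)])
  next
    case (2 sQ p)
    then show ?case by (rule quotient_hopf_structure)
  qed
qed

end
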